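(* The species $\mathscr{B}^c$ of connected bi-point-determining graphs satisfies both of the following identities of virtual species: $$\mathscr{B}^c=(1+X)^c\circ\mathscr{B}_+-(1+X)^c+X,$$ $$\mathscr{B}^c=\mathscr{G}^c\circ\bigl(2(1+X)^c-X\bigr)-(1+X)^c+X,$$ where $\mathscr{B}_+$ is the species of nonempty bi-point-determining graphs, $\mathscr{G}^c$ is the species of connected graphs, and $(1+X)^c$ is the compositional inverse of $\mathscr{E}_+$.
   Context: All graphs are finite and simple; the empty graph is not considered connected. A species $F$ is a functor from the category of finite sets with bijections to itself; for a species of graphs, $F[U]$ is a set of graphs with vertex set $U$, with transport by relabeling. Species are considered up to isomorphism. Sum is disjoint union of structures; for $\Psi[\varnothing]=\varnothing$, a $\Phi\circ\Psi$-structure on $U$ is a partition of $U$ into nonempty blocks, a $\Phi$-structure on the set of blocks, and a $\Psi$-structure on each block. $X$ is the species of singletons; $\mathscr{E}_+$ is the species of nonempty sets (one structure on each nonempty finite set). A virtual species is a formal difference $F-G$ of species, with $F-G=H-K$ iff $F+K\cong G+H$; this notion and equality extend to two-sort species. Substitution extends to virtual species: it is additive on the left, and for species $F,G,H$ with $G[\varnothing]=H[\varnothing]=\varnothing$, $F\circ(G-H)$ is obtained by putting $X:=G$, $Y:=H$ in the two-sort virtual species $F(X-Y)$, which is the unique two-sort virtual species $W(X,Y)$ with $W(X+Y,Y)=F(X)$. The virtual species $(1+X)^c$ is the unique virtual species with $\mathscr{E}_+\circ(1+X)^c=X$; it also satisfies $(1+X)^c\circ\mathscr{E}_+=X$. A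 graph is point-determining if distinct vertices have distinct neighborhoods; it is bi-point-determining if both it and its complement are point-determining. *)

theory Defs
  imports Complex_Main "HOL-Library.FSet" "HOL-Library.FuncSet" "HOL-Library.Disjoint_Sets"
begin

section \<open>Finite sets and species\<close>

text \<open>Substitution puts structures on sets of blocks, so the underlying sets have to be taken from
  a type that is closed under forming finite subsets.  The hereditarily finite sets over countably
  many atoms serve as that type: every finite set is in bijection with a finite set of labels, so
  the finite sets of labels form a category equivalent to that of all finite sets.\<close>

datatype label = Atom nat | Block "label fset"

definition blk :: "label set \<Rightarrow> label" where
  "blk B = Block (Abs_fset B)"

fun unblk :: "label \<Rightarrow> label set" where
  "unblk (Block A) = fset A"
| "unblk (Atom n) = {}"

text \<open>A multisort finite set is a finite set \<open>U\<close> of labels together with a function \<open>c\<close>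
  giving the sort of each element of \<open>U\<close>.  With sorts in \<^typ>\<open>unit\<close> this is just a finite set.
  A transport function has no argument for the target, since \<open>U\<close>, \<open>c\<close> and the bijection
  determine the target.\<close>

record ('s, 'a) species =
  structs :: "label set \<Rightarrow> (label \<Rightarrow> 's) \<Rightarrow> 'a set"
  transport :: "label set \<Rightarrow> (label \<Rightarrow> 's) \<Rightarrow> (label \<Rightarrow> label) \<Rightarrow> 'a \<Rightarrow> 'a"

definition sorted_bij ::
  "label set \<Rightarrow> (label \<Rightarrow> 's) \<Rightarrow> (label \<Rightarrow> label) \<Rightarrow> label set \<Rightarrow> (label \<Rightarrow> 's) \<Rightarrow> bool" where
  "sorted_bij U c \<sigma> V d \<longleftrightarrow> finite U \<and> bij_betw \<sigma> U V \<and> (\<forall>u\<in>U. d (\<sigma> u) = c u)"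

text \<open>The last clause says that transport depends only on the restriction of \<open>\<sigma>\<close> to \<open>U\<close>.
  That \<^const>\<open>structs\<close> depends only on the restriction of \<open>c\<close> to \<open>U\<close> follows from the first
  three clauses.\<close>

definition is_species :: "('s, 'a) species \<Rightarrow> bool" where
  "is_species F \<longleftrightarrow>
     (\<forall>U c. finite U \<longrightarrow> finite (structs F U c)) \<and>
     (\<forall>U c \<sigma> V d. sorted_bij U c \<sigma> V d \<longrightarrow>
        (\<forall>s\<in>structs F U c. transport F U c \<sigma> s \<in> structs F V d)) \<and>
     (\<forall>U c. finite U \<longrightarrow> (\<forall>s\<in>structs F U c. transport F U c id s = s)) \<and>
     (\<forall>U c \<sigma> V d \<tau> W e. sorted_bij U c \<sigma> V d \<longrightarrow> sorted_bij V d \<tau> W e \<longrightarrow>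
        (\<forall>s\<in>structs F U c.
           transport F U c (\<tau> \<circ> \<sigma>) s = transport F V d \<tau> (transport F U c \<sigma> s))) \<and>
     (\<forall>U c \<sigma> \<sigma>' V d. sorted_bij U c \<sigma> V d \<longrightarrow> (\<forall>u\<in>U. \<sigma> u = \<sigma>' u) \<longrightarrow>
        (\<forall>s\<in>structs F U c. transport F U c \<sigma> s = transport F U c \<sigma>' s))"

definition species_iso :: "('s, 'a) species \<Rightarrow> ('s, 'b) species \<Rightarrow> bool"
    (infix "\<cong>\<^sub>S" 50) where
  "F \<cong>\<^sub>S G \<longleftrightarrow>
     (\<exists>\<phi> :: label set \<Rightarrow> (label \<Rightarrow> 's) \<Rightarrow> 'a \<Rightarrow> 'b.
        (\<forall>U c. finite U \<longrightarrow> bij_betw (\<phi> U c) (structs F U c) (structs G U c)) \<and>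
        (\<forall>U c \<sigma> V d. sorted_bij U c \<sigma> V d \<longrightarrow>
           (\<forall>s\<in>structs F U c.
              \<phi> V d (transport F U c \<sigma> s) = transport G U c \<sigma> (\<phi> U c s))))"

definition sp_zero :: "('s, unit) species" where
  "sp_zero = \<lparr> structs = (\<lambda>U c. {}), transport = (\<lambda>U c \<sigma> s. s) \<rparr>"

definition sp_single :: "'s \<Rightarrow> ('s, unit) species" where
  "sp_single a =
     \<lparr> structs = (\<lambda>U c. if \<exists>u. U = {u} \<and> c u = a then {()} else {}),
       transport = (\<lambda>U c \<sigma> s. s) \<rparr>"

abbreviation sp_X :: "(unit, unit) species" where
  "sp_X \<equiv> sp_single ()"

definition sp_E_plus :: "(unit, unit) species" where
  "sp_E_plus =
     \<lparr> structs = (\<lambda>U c. if U = {} then {} else {()}),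
       transport = (\<lambda>U c \<sigma> s. s) \<rparr>"

definition sp_add :: "('s, 'a) species \<Rightarrow> ('s, 'b) species \<Rightarrow> ('s, 'a + 'b) species"
    (infixl "+\<^sub>S" 65) where
  "F +\<^sub>S G =
     \<lparr> structs = (\<lambda>U c. structs F U c <+> structs G U c),
       transport = (\<lambda>U c \<sigma>. map_sum (transport F U c \<sigma>) (transport G U c \<sigma>)) \<rparr>"

text \<open>A structure of the composite on \<open>U\<close> is a triple \<open>(P, f, g)\<close>: a partition \<open>P\<close> of \<open>U\<close> into
  nonempty blocks, a \<open>G\<close>-structure \<open>g B\<close> on each block \<open>B\<close>, and an \<open>F\<close>-structure \<open>f\<close> on the set
  of blocks, where the block \<open>B\<close> (as the label \<open>blk B\<close>) has sort \<open>\<kappa> (g B)\<close>.\<close>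

definition sp_comp_by ::
  "('b \<Rightarrow> 't) \<Rightarrow> ('t, 'a) species \<Rightarrow> ('s, 'b) species \<Rightarrow>
     ('s, label set set \<times> 'a \<times> (label set \<Rightarrow> 'b)) species" where
  "sp_comp_by \<kappa> F G =
     \<lparr> structs = (\<lambda>U c. {(P, f, g). partition_on U P \<and>
           g \<in> (\<Pi>\<^sub>E B\<in>P. structs G B c) \<and>
           f \<in> structs F (blk ` P) (\<lambda>b. \<kappa> (g (unblk b)))}),
       transport = (\<lambda>U c \<sigma> (P, f, g).
          ((`) \<sigma> ` P,
           transport F (blk ` P) (\<lambda>b. \<kappa> (g (unblk b))) (\<lambda>b. blk (\<sigma> ` unblk b)) f,
           (\<lambda>B\<in>(`) \<sigma> ` P. let A = inv_into U \<sigma> ` B in transport G A c \<sigma> (g A)))) \<rparr>"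

definition sp_comp ::
  "(unit, 'a) species \<Rightarrow> ('s, 'b) species \<Rightarrow>
     ('s, label set set \<times> 'a \<times> (label set \<Rightarrow> 'b)) species" where
  "sp_comp F G = sp_comp_by (\<lambda>_. ()) F G"

datatype two_sorts = Sort_X | Sort_Y

text \<open>\<open>W(G, H)\<close>, that is, \<open>X := G\<close> and \<open>Y := H\<close> in the two-sort species \<open>W(X, Y)\<close>: each block carries
  a \<open>G\<close>-structure or an \<open>H\<close>-structure, and has sort \<open>X\<close> or \<open>Y\<close> accordingly.\<close>

definition sp_comp2 ::
  "(two_sorts, 'a) species \<Rightarrow> ('s, 'b) species \<Rightarrow> ('s, 'c) species \<Rightarrow>
     ('s, label set set \<times> 'a \<times> (label set \<Rightarrow> 'b + 'c)) species" where
  "sp_comp2 W G H = sp_comp_by (case_sum (\<lambda>_. Sort_X) (\<lambda>_. Sort_Y)) W (G +\<^sub>S H)"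


section \<open>Virtual species\<close>

text \<open>The pair \<open>(F, G)\<close> represents the formal difference \<open>F - G\<close>; equality of virtual species is
  the relation \<open>=\<^sub>V\<close> on such pairs.\<close>

type_synonym ('s, 'a, 'b) virtual = "('s, 'a) species \<times> ('s, 'b) species"

definition is_virtual :: "('s, 'a, 'b) virtual \<Rightarrow> bool" where
  "is_virtual V \<longleftrightarrow> is_species (fst V) \<and> is_species (snd V)"

definition virtual_eq :: "('s, 'a, 'b) virtual \<Rightarrow> ('s, 'c, 'd) virtual \<Rightarrow> bool"
    (infix "=\<^sub>V" 50) where
  "V =\<^sub>V W \<longleftrightarrow> fst V +\<^sub>S snd W \<cong>\<^sub>S snd V +\<^sub>S fst W"

definition virt :: "('s, 'a) species \<Rightarrow> ('s, 'a, unit) virtual" where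
  "virt F = (F, sp_zero)"

definition virtual_add ::
  "('s, 'a, 'b) virtual \<Rightarrow> ('s, 'c, 'd) virtual \<Rightarrow> ('s, 'a + 'c, 'b + 'd) virtual"
    (infixl "+\<^sub>V" 65) where
  "V +\<^sub>V W = (fst V +\<^sub>S fst W, snd V +\<^sub>S snd W)"

definition virtual_diff ::
  "('s, 'a, 'b) virtual \<Rightarrow> ('s, 'c, 'd) virtual \<Rightarrow> ('s, 'a + 'd, 'b + 'c) virtual"
    (infixl "-\<^sub>V" 65) where
  "V -\<^sub>V W = (fst V +\<^sub>S snd W, snd V +\<^sub>S fst W)"

definition virtual_comp2 ::
  "(two_sorts, 'a, 'b) virtual \<Rightarrow> ('s, 'c) species \<Rightarrow> ('s, 'd) species \<Rightarrow>
     ('s, label set set \<times> 'a \<times> (label set \<Rightarrow> 'c + 'd),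
          label set set \<times> 'b \<times> (label set \<Rightarrow> 'c + 'd)) virtual" where
  "virtual_comp2 W G H = (sp_comp2 (fst W) G H, sp_comp2 (snd W) G H)"

text \<open>\<open>F(X - Y)\<close>, the two-sort virtual species \<open>W(X, Y)\<close> with \<open>W(X + Y, Y) = F(X)\<close>.  It is unique as
  a virtual species, and \<open>SOME\<close> picks a pair representing it.  Taking labels as structures is no
  restriction, since a species has only finitely many structures on each finite set and there are
  infinitely many labels.\<close>

definition at_X_minus_Y :: "(unit, 'a) species \<Rightarrow> (two_sorts, label, label) virtual" where
  "at_X_minus_Y F = (SOME W. is_virtual W \<and>
     virtual_comp2 W (sp_single Sort_X +\<^sub>S sp_single Sort_Y) (sp_single Sort_Y)
       =\<^sub>V virt (sp_comp F (sp_single Sort_X)))"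

text \<open>For a virtual species \<open>F\<^sub>1 - F\<^sub>2\<close> on the left, \<open>F\<^sub>1 \<circ> (G - H) - F\<^sub>2 \<circ> (G - H)\<close>.  This is meant
  for pairs \<open>(G, H)\<close> satisfying the predicate \<open>no_empty\<close>.\<close>

definition virtual_comp (infixl "\<circ>\<^sub>V" 70) where
  "F \<circ>\<^sub>V V =
     virtual_comp2 (at_X_minus_Y (fst F)) (fst V) (snd V)
       -\<^sub>V virtual_comp2 (at_X_minus_Y (snd F)) (fst V) (snd V)"

definition no_empty :: "('s, 'a, 'b) virtual \<Rightarrow> bool" where
  "no_empty V \<longleftrightarrow> (\<forall>c. structs (fst V) {} c = {} \<and> structs (snd V) {} c = {})"

text \<open>\<open>(1 + X)\<^sup>c\<close>, the compositional inverse of the species of nonempty sets; again unique as a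
  virtual species.\<close>

definition one_plus_X_c :: "(unit, label, label) virtual" where
  "one_plus_X_c = (SOME L. is_virtual L \<and> no_empty L \<and> virt sp_E_plus \<circ>\<^sub>V L =\<^sub>V virt sp_X)"


section \<open>Graphs\<close>

text \<open>A graph is a pair of a vertex set and a set of edges, the edges being two-element sets of
  vertices.\<close>

type_synonym graph = "label set \<times> label set set"

definition is_graph :: "graph \<Rightarrow> bool" where
  "is_graph = (\<lambda>(V, E). finite V \<and> E \<subseteq> {{u, v} | u v. u \<in> V \<and> v \<in> V \<and> u \<noteq> v})"

definition nbhd :: "graph \<Rightarrow> label \<Rightarrow> label set" where
  "nbhd = (\<lambda>(V, E) u. {v \<in> V. {u, v} \<in> E})"

definition complement :: "graph \<Rightarrow> graph" where
  "complement = (\<lambda>(V, E). (V, {{u, v} | u v. u \<in> V \<and> v \<in> V \<and> u \<noteq> v} - E))"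

definition connected_graph :: "graph \<Rightarrow> bool" where
  "connected_graph = (\<lambda>(V, E). V \<noteq> {} \<and> (\<forall>u\<in>V. \<forall>v\<in>V. (u, v) \<in> {(a, b). {a, b} \<in> E}\<^sup>*))"

definition point_determining :: "graph \<Rightarrow> bool" where
  "point_determining g \<longleftrightarrow> (\<forall>u\<in>fst g. \<forall>v\<in>fst g. u \<noteq> v \<longrightarrow> nbhd g u \<noteq> nbhd g v)"

definition bi_point_determining :: "graph \<Rightarrow> bool" where
  "bi_point_determining g \<longleftrightarrow> point_determining g \<and> point_determining (complement g)"

definition graph_species :: "(graph \<Rightarrow> bool) \<Rightarrow> (unit, graph) species" where
  "graph_species Q =
     \<lparr> structs = (\<lambda>U c. {g. is_graph g \<and> fst g = U \<and> Q g}),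
       transport = (\<lambda>U c \<sigma> (V, E). (\<sigma> ` V, (`) \<sigma> ` E)) \<rparr>"

definition sp_Gc :: "(unit, graph) species" where
  "sp_Gc = graph_species connected_graph"

definition sp_B_plus :: "(unit, graph) species" where
  "sp_B_plus = graph_species (\<lambda>g. fst g \<noteq> {} \<and> bi_point_determining g)"

definition sp_Bc :: "(unit, graph) species" where
  "sp_Bc = graph_species (\<lambda>g. connected_graph g \<and> bi_point_determining g)"

end

theory Submission
  imports Defs
begin

text \<open>
  A species is determined up to isomorphism by its marks: the numbers of structures on \<open>U\<close> that
  are fixed by \<open>H\<close>, for all finite sets \<open>U\<close> and all groups \<open>H\<close> of permutations of \<open>U\<close>.  This is
  Burnside's theorem on the table of marks.  Marks are additive, so a virtual species has integer
  marks, and two virtual species are equal iff their marks agree (\<open>virtual_eq_iff_umark\<close>).  The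
  theorem thereby becomes a statement about integers.

  Substitution has a closed form on marks.  An \<open>H\<close>-fixed structure of \<open>F \<circ> G\<close> consists of an
  \<open>H\<close>-invariant partition \<open>P\<close>, a fixed \<open>F\<close>-structure on the set of blocks, and an equivariant family
  of \<open>G\<close>-structures on the blocks; the latter amounts to choosing, for one block \<open>B\<close> of each orbit,
  a \<open>G\<close>-structure fixed by the stabilizer of \<open>B\<close>.  So the mark of \<open>F \<circ> G\<close> is the sum over \<open>P\<close> of the
  mark of \<open>F\<close> on the set of blocks times the product over the orbits of blocks of the marks of \<open>G\<close>;
  this operation is called \<open>plethysm\<close> below.  The formula remains true for virtual \<open>G\<close>
  (\<open>umark_comp\<close>), because the mark of \<open>F(X - Y)\<close> is the mark of \<open>F\<close> times the sign \<open>-1\<close> for every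
  orbit of elements of sort \<open>Y\<close>.  Write \<open>L\<close> for the marks of \<open>(1 + X)\<^sup>c\<close>.  They satisfy
  \<open>\<Sum>\<^sub>P \<Prod>\<^sub>B L(B) = [card U = 1]\<close> for nonempty \<open>U\<close>.

  Two vertices of a graph are called twins if every third vertex is adjacent to both or to neither.
  This is an equivalence relation, a set of pairwise twins is a clique or an independent set, and a
  graph is bi-point-determining iff its twin classes are singletons.  The marks of
  \<open>D = 2 (1 + X)\<^sup>c - X\<close> on \<open>B\<close> are \<open>L(B)\<close> times the number of ways to turn \<open>B\<close> into a clique or an
  independent set (two, but only one if \<open>B\<close> is a point).  Replacing the vertices of a graph on the
  set of blocks of \<open>P\<close> by such sets, one obtains a graph on \<open>U\<close> in which every block of \<open>P\<close> consists
  of pairwise twins, and every such graph arises once.  Substituting \<open>D\<close> into the species of nonempty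
  graphs therefore gives a sum over all \<open>H\<close>-invariant graphs on \<open>U\<close> and all \<open>P\<close> refining the twin
  classes, with weight \<open>\<Prod>\<^sub>B L(B)\<close>.  For a given graph the sum over \<open>P\<close> factors over the twin classes
  and equals 1 if all of them are singletons, and 0 otherwise.  The result is \<open>\<B>\<^sub>+\<close>.

  With connected graphs in place of all graphs the same count gives \<open>\<B>\<^sup>c\<close>, with one exception: if
  \<open>P\<close> has only one block then the quotient is connected although the graph on \<open>U\<close> may be edgeless.
  This contributes \<open>L(U)\<close> whenever \<open>U\<close> has at least two elements, so that
  \<open>\<G>\<^sup>c \<circ> D = \<B>\<^sup>c + (1 + X)\<^sup>c - X\<close>, which is the second identity.

  For the first identity it remains to see that \<open>(1 + X)\<^sup>c \<circ> \<B>\<^sub>+ = \<G>\<^sup>c \<circ> D\<close>.  Composing with \<open>\<E>\<^sub>+\<close>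
  on the left is injective, and by associativity of plethysm it sends the left side to
  \<open>X \<circ> \<B>\<^sub>+ = \<B>\<^sub>+\<close>, and the right side to \<open>(\<E>\<^sub>+ \<circ> \<G>\<^sup>c) \<circ> D\<close>, where \<open>\<E>\<^sub>+ \<circ> \<G>\<^sup>c\<close> is the species of
  nonempty graphs; this is \<open>\<B>\<^sub>+\<close> again.\<close>

section \<open>Group actions, orbits and equivariant families\<close>

text \<open>The group laws are required only as far as the action on \<open>S\<close> can see them.  A set of functions
on labels then qualifies although it is not closed under composition outside \<open>S\<close>, and the same set
acts on \<open>S\<close>, on the blocks of a partition, on families of sets, and so on.\<close>

locale group_acting =
  fixes H :: "'h set" and act :: "'h \<Rightarrow> 'x \<Rightarrow> 'x" and S :: "'x set"
  assumes closed: "\<sigma> \<in> H \<Longrightarrow> x \<in> S \<Longrightarrow> act \<sigma> x \<in> S"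
    and neutral: "\<exists>\<iota>\<in>H. \<forall>x\<in>S. act \<iota> x = x"
    and product: "\<sigma> \<in> H \<Longrightarrow> \<tau> \<in> H \<Longrightarrow> \<exists>\<rho>\<in>H. \<forall>x\<in>S. act \<rho> x = act \<sigma> (act \<tau> x)"
    and inverse: "\<sigma> \<in> H \<Longrightarrow> \<exists>\<rho>\<in>H. \<forall>x\<in>S. act \<rho> (act \<sigma> x) = x"
begin

lemma act_inj: "\<sigma> \<in> H \<Longrightarrow> x \<in> S \<Longrightarrow> y \<in> S \<Longrightarrow> act \<sigma> x = act \<sigma> y \<Longrightarrow> x = y"
  using inverse[of \<sigma>] by metis

lemma inverse_both:
  assumes "\<sigma> \<in> H"
  shows "\<exists>\<rho>\<in>H. (\<forall>x\<in>S. act \<rho> (act \<sigma> x) = x) \<and> (\<forall>x\<in>S. act \<sigma> (act \<rho> x) = x)"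
proof -
  obtain \<rho> where r: "\<rho> \<in> H" "\<forall>x\<in>S. act \<rho> (act \<sigma> x) = x"
    using inverse assms by blast
  have "act \<sigma> (act \<rho> x) = x" if "x \<in> S" for x
    by (metis act_inj assms closed r that)
  then show ?thesis using r by blast
qed

definition orbit :: "'x \<Rightarrow> 'x set" where
  "orbit x = {act \<sigma> x | \<sigma>. \<sigma> \<in> H}"

lemma orbit_self: "x \<in> S \<Longrightarrow> x \<in> orbit x"
  unfolding orbit_def using neutral by force

lemma orbit_sub: "x \<in> S \<Longrightarrow> orbit x \<subseteq> S"
  unfolding orbit_def using closed by auto

lemma orbit_eq: "x \<in> S \<Longrightarrow> y \<in> orbit x \<Longrightarrow> orbit y = orbit x"
proof -
  assume x: "x \<in> S" and y: "y \<in> orbit x"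
  obtain \<sigma> where s: "\<sigma> \<in> H" "y = act \<sigma> x" using y unfolding orbit_def by auto
  obtain \<rho> where r: "\<rho> \<in> H" "\<forall>x\<in>S. act \<rho> (act \<sigma> x) = x" using inverse s(1) by blast
  have "orbit y \<subseteq> orbit x"
    unfolding orbit_def using product[OF _ s(1)] x s(2) by (smt (verit) mem_Collect_eq subsetI)
  moreover have "orbit x \<subseteq> orbit y"
  proof
    fix z assume "z \<in> orbit x"
    then obtain \<tau> where t: "\<tau> \<in> H" "z = act \<tau> x" unfolding orbit_def by auto
    have "z = act \<tau> (act \<rho> y)" using t r s x by simp
    then show "z \<in> orbit y"
      unfolding orbit_def using product[OF t(1) r(1)] closed[OF s(1) x] s(2) by force
  qed
  ultimately show ?thesis by blast
qed

end

lemma group_acting_subset: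
  assumes "group_acting H act S" "S' \<subseteq> S" "\<And>\<sigma> x. \<sigma> \<in> H \<Longrightarrow> x \<in> S' \<Longrightarrow> act \<sigma> x \<in> S'"
  shows "group_acting H act S'"
proof -
  interpret group_acting H act S by (rule assms)
  show ?thesis
  proof
    show "\<exists>\<iota>\<in>H. \<forall>x\<in>S'. act \<iota> x = x" using neutral assms(2) by (meson subsetD)
    show "\<exists>\<rho>\<in>H. \<forall>x\<in>S'. act \<rho> x = act \<sigma> (act \<tau> x)" if "\<sigma> \<in> H" "\<tau> \<in> H" for \<sigma> \<tau>
      using product[OF that] assms(2) by (meson subsetD)
    show "\<exists>\<rho>\<in>H. \<forall>x\<in>S'. act \<rho> (act \<sigma> x) = x" if "\<sigma> \<in> H" for \<sigma>
      using inverse[OF that] assms(2) by (meson subsetD)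
  qed (rule assms(3))
qed

lemma group_acting_image:
  assumes g: "group_acting H act S"
    and e: "\<And>\<sigma> x. \<sigma> \<in> H \<Longrightarrow> x \<in> S \<Longrightarrow> act' (h \<sigma>) (j x) = j (act \<sigma> x)"
  shows "group_acting (h ` H) act' (j ` S)"
proof -
  interpret group_acting H act S by (rule g)
  show ?thesis
  proof
    show "act' \<sigma> x \<in> j ` S" if "\<sigma> \<in> h ` H" "x \<in> j ` S" for \<sigma> x
      using that e closed by auto
    show "\<exists>\<iota>\<in>h ` H. \<forall>x\<in>j ` S. act' \<iota> x = x"
    proof -
      obtain \<iota> where "\<iota> \<in> H" "\<forall>x\<in>S. act \<iota> x = x" using neutral by blast
      then show ?thesis using e by (intro bexI[of _ "h \<iota>"]) auto
    qed
    show "\<exists>\<rho>\<in>h ` H. \<forall>x\<in>j ` S. act' \<rho> x = act' \<sigma> (act' \<tau> x)" if k: "\<sigma> \<in> h ` H" "\<tau> \<in> h ` H" for \<sigma> \<tau>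
    proof -
      obtain s t where st: "\<sigma> = h s" "\<tau> = h t" "s \<in> H" "t \<in> H" using k by auto
      obtain \<rho> where "\<rho> \<in> H" "\<forall>x\<in>S. act \<rho> x = act s (act t x)" using product[OF st(3,4)] by blast
      then show ?thesis using e closed st by (intro bexI[of _ "h \<rho>"]) auto
    qed
    show "\<exists>\<rho>\<in>h ` H. \<forall>x\<in>j ` S. act' \<rho> (act' \<sigma> x) = x" if k: "\<sigma> \<in> h ` H" for \<sigma>
    proof -
      obtain s where st: "\<sigma> = h s" "s \<in> H" using k by auto
      obtain \<rho> where "\<rho> \<in> H" "\<forall>x\<in>S. act \<rho> (act s x) = x" using inverse[OF st(2)] by blast
      then show ?thesis using e closed st by (intro bexI[of _ "h \<rho>"]) auto
    qed
  qed
qed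

lemma group_acting_Pow:
  assumes "group_acting H act S"
  shows "group_acting H (\<lambda>\<sigma>. (`) (act \<sigma>)) (Pow S)"
proof -
  interpret group_acting H act S by (rule assms)
  show ?thesis
  proof
    show "act \<sigma> ` A \<in> Pow S" if "\<sigma> \<in> H" "A \<in> Pow S" for \<sigma> A using that closed by auto
    show "\<exists>\<iota>\<in>H. \<forall>A\<in>Pow S. act \<iota> ` A = A"
    proof -
      obtain \<iota> where i: "\<iota> \<in> H" "\<forall>x\<in>S. act \<iota> x = x" using neutral by blast
      have "act \<iota> ` A = (\<lambda>x. x) ` A" if "A \<subseteq> S" for A
        using i(2) that by (intro image_cong) auto
      then show ?thesis using i(1) by (intro bexI[of _ \<iota>]) simp_all
    qed
    show "\<exists>\<rho>\<in>H. \<forall>A\<in>Pow S. act \<rho> ` A = act \<sigma> ` act \<tau> ` A" if k: "\<sigma> \<in> H" "\<tau> \<in> H" for \<sigma> \<tau>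
    proof -
      obtain \<rho> where r: "\<rho> \<in> H" "\<forall>x\<in>S. act \<rho> x = act \<sigma> (act \<tau> x)" using product[OF k] by blast
      have "act \<rho> ` A = act \<sigma> ` act \<tau> ` A" if "A \<subseteq> S" for A
        unfolding image_image using r(2) that by (intro image_cong) auto
      then show ?thesis using r(1) by (intro bexI[of _ \<rho>]) simp_all
    qed
    show "\<exists>\<rho>\<in>H. \<forall>A\<in>Pow S. act \<rho> ` act \<sigma> ` A = A" if k: "\<sigma> \<in> H" for \<sigma>
    proof -
      obtain \<rho> where r: "\<rho> \<in> H" "\<forall>x\<in>S. act \<rho> (act \<sigma> x) = x" using inverse[OF k] by blast
      have "act \<rho> ` act \<sigma> ` A = (\<lambda>x. x) ` A" if "A \<subseteq> S" for A
        unfolding image_image using r(2) that by (intro image_cong) auto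
      then show ?thesis using r(1) by (intro bexI[of _ \<rho>]) simp_all
    qed
  qed
qed

definition transversal :: "'h set \<Rightarrow> ('h \<Rightarrow> 'x \<Rightarrow> 'x) \<Rightarrow> 'x set \<Rightarrow> 'x set \<Rightarrow> bool" where
  "transversal H act S T \<longleftrightarrow> T \<subseteq> S \<and> (\<forall>x\<in>S. \<exists>!t. t \<in> T \<and> (\<exists>\<sigma>\<in>H. act \<sigma> t = x))"

definition transv :: "'h set \<Rightarrow> ('h \<Rightarrow> 'x \<Rightarrow> 'x) \<Rightarrow> 'x set \<Rightarrow> 'x set" where
  "transv H act S = (SOME T. transversal H act S T)"

text \<open>A product with one factor for each orbit.  The factor is read off at the member of the orbit that
lies in an arbitrary transversal, which makes sense for values \<open>v\<close> that are constant on orbits.\<close>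

definition orbit_prod ::
  "'h set \<Rightarrow> ('h \<Rightarrow> 'x \<Rightarrow> 'x) \<Rightarrow> 'x set \<Rightarrow> ('x \<Rightarrow> int) \<Rightarrow> int" where
  "orbit_prod H act S v = prod v (transv H act S)"

lemma transversal_image:
  assumes T: "transversal H act S T" and j: "inj_on j S"
    and "\<And>\<sigma> x. \<sigma> \<in> H \<Longrightarrow> x \<in> S \<Longrightarrow> act' (h \<sigma>) (j x) = j (act \<sigma> x)"
    and cl: "\<And>\<sigma> x. \<sigma> \<in> H \<Longrightarrow> x \<in> S \<Longrightarrow> act \<sigma> x \<in> S"
  shows "transversal (h ` H) act' (j ` S) (j ` T)"
  unfolding transversal_def
proof (intro conjI ballI)
  show "j ` T \<subseteq> j ` S" using T unfolding transversal_def by auto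
next
  have TS: "T \<subseteq> S" using T unfolding transversal_def by auto
  fix y assume "y \<in> j ` S"
  then obtain x where x: "x \<in> S" "y = j x" by auto
  then obtain t where t: "t \<in> T" "\<exists>\<sigma>\<in>H. act \<sigma> t = x"
      and u: "\<And>t'. t' \<in> T \<Longrightarrow> \<exists>\<sigma>\<in>H. act \<sigma> t' = x \<Longrightarrow> t' = t"
    using T unfolding transversal_def by metis
  show "\<exists>!t. t \<in> j ` T \<and> (\<exists>\<sigma>\<in>h ` H. act' \<sigma> t = y)"
  proof (rule ex1I[of _ "j t"])
    show "j t \<in> j ` T \<and> (\<exists>\<sigma>\<in>h ` H. act' \<sigma> (j t) = y)"
      using t x TS assms(3) by blast
  next
    fix z assume z: "z \<in> j ` T \<and> (\<exists>\<sigma>\<in>h ` H. act' \<sigma> z = y)"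
    then obtain t' \<sigma> where "t' \<in> T" "z = j t'" "\<sigma> \<in> H" "act' (h \<sigma>) (j t') = y" by auto
    then have "j (act \<sigma> t') = j x" using assms(3) TS x by auto
    then have "act \<sigma> t' = x" using j cl TS x \<open>t' \<in> T\<close> \<open>\<sigma> \<in> H\<close> unfolding inj_on_def by blast
    then show "z = j t" using u \<open>t' \<in> T\<close> \<open>z = j t'\<close> \<open>\<sigma> \<in> H\<close> by blast
  qed
qed

context group_acting
begin

lemma transversal_exists: "\<exists>T. transversal H act S T"
proof -
  define T where "T = (\<lambda>Q. SOME x. x \<in> Q) ` (orbit ` S)"
  have pick: "(SOME y. y \<in> orbit x) \<in> orbit x" if "x \<in> S" for x
    using orbit_self[OF that] by (rule someI)
  have TS: "T \<subseteq> S" unfolding T_def using pick orbit_sub by blast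
  have same: "t' = t" if k: "x \<in> S" "t \<in> T" "t' \<in> T" "x \<in> orbit t" "x \<in> orbit t'" for x t t'
  proof -
    have o: "orbit t = orbit t'"
      using orbit_eq[of t x] orbit_eq[of t' x] k TS by auto
    obtain y where y: "y \<in> S" "t = (SOME z. z \<in> orbit y)" using k unfolding T_def by auto
    obtain y' where y': "y' \<in> S" "t' = (SOME z. z \<in> orbit y')" using k unfolding T_def by auto
    have "orbit t = orbit y" "orbit t' = orbit y'" using orbit_eq[OF y(1) pick[OF y(1)]] orbit_eq[OF y'(1) pick[OF y'(1)]] y(2) y'(2) by simp_all
    then show ?thesis using o y(2) y'(2) by simp
  qed
  have ex: "\<exists>t\<in>T. x \<in> orbit t" if "x \<in> S" for x
    using that pick[OF that] orbit_eq orbit_self unfolding T_def by blast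
  have "transversal H act S T"
    unfolding transversal_def
  proof (intro conjI ballI TS)
    fix x assume x: "x \<in> S"
    have e: "(\<exists>\<sigma>\<in>H. act \<sigma> t = x) \<longleftrightarrow> x \<in> orbit t" for t unfolding orbit_def by auto
    show "\<exists>!t. t \<in> T \<and> (\<exists>\<sigma>\<in>H. act \<sigma> t = x)"
      unfolding e using ex[OF x] same[OF x] by blast
  qed
  then show ?thesis by blast
qed

lemma transv: "transversal H act S (transv H act S)"
  unfolding transv_def using transversal_exists by (rule someI_ex)

lemma transv_sub: "transv H act S \<subseteq> S"
  using transv unfolding transversal_def by auto

lemma orbit_prod_eq:
  assumes T: "transversal H act S T"
    and v: "\<And>\<sigma> x. \<sigma> \<in> H \<Longrightarrow> x \<in> S \<Longrightarrow> v (act \<sigma> x) = v x"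
  shows "orbit_prod H act S v = prod v T"
proof -
  let ?R = "transv H act S"
  have R: "transversal H act S ?R" by (rule transv)
  define p where "p x = (THE t. t \<in> T \<and> (\<exists>\<sigma>\<in>H. act \<sigma> t = x))" for x
  have p: "p x \<in> T \<and> (\<exists>\<sigma>\<in>H. act \<sigma> (p x) = x)" if "x \<in> S" for x
    unfolding p_def using bspec[OF conjunct2[OF T[unfolded transversal_def]] that]
    by (elim theI'[elim_format]) auto
  have pu: "t = p x" if "x \<in> S" "t \<in> T" "\<sigma> \<in> H" "act \<sigma> t = x" for t \<sigma> x
    using T p[OF that(1)] that unfolding transversal_def by blast
  have RS: "?R \<subseteq> S" "T \<subseteq> S" using R T unfolding transversal_def by auto
  have "bij_betw p ?R T"
    unfolding bij_betw_def
  proof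
    show "inj_on p ?R"
    proof (rule inj_onI)
      fix x y assume xy: "x \<in> ?R" "y \<in> ?R" "p x = p y"
      then have S: "x \<in> S" "y \<in> S" using RS by auto
      obtain \<sigma> where s: "\<sigma> \<in> H" "act \<sigma> (p x) = x" using p S by blast
      obtain \<tau> where t: "\<tau> \<in> H" "act \<tau> (p x) = y" using p S xy by metis
      have px: "p x \<in> S" using p S RS by blast
      obtain \<sigma>' where s': "\<sigma>' \<in> H" "\<forall>x\<in>S. act \<sigma>' (act \<sigma> x) = x" using inverse s by blast
      obtain \<rho> where r: "\<rho> \<in> H" "\<forall>x\<in>S. act \<rho> x = act \<tau> (act \<sigma>' x)" using product t s' by metis
      have "act \<rho> x = y" using r s' s t px S by metis
      moreover obtain \<iota> where "\<iota> \<in> H" "act \<iota> y = y" using neutral S by metis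
      ultimately show "x = y" using R S xy r unfolding transversal_def by metis
    qed
  next
    show "p ` ?R = T"
    proof
      show "p ` ?R \<subseteq> T" using p RS by blast
      show "T \<subseteq> p ` ?R"
      proof
        fix t assume t: "t \<in> T"
        then have tS: "t \<in> S" using RS by auto
        then obtain r \<sigma> where r: "r \<in> ?R" "\<sigma> \<in> H" "act \<sigma> r = t"
          using R unfolding transversal_def by metis
        obtain \<tau> where ta: "\<tau> \<in> H" "\<forall>x\<in>S. act \<tau> (act \<sigma> x) = x" using inverse r by blast
        have "act \<tau> t = r" using ta r RS by auto
        then show "t \<in> p ` ?R" using pu[of r t \<tau>] r RS t ta by blast
      qed
    qed
  qed
  moreover have "v x = v (p x)" if "x \<in> ?R" for x
    using p[of x] v[of _ "p x"] that RS by (metis subsetD)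
  ultimately show ?thesis
    unfolding orbit_prod_def
    by (metis (mono_tags, lifting) prod.cong prod.reindex_bij_betw)
qed

end

lemma orbit_prod_image:
  assumes g: "group_acting H act S" and j: "inj_on j S"
    and e: "\<And>\<sigma> x. \<sigma> \<in> H \<Longrightarrow> x \<in> S \<Longrightarrow> act' (h \<sigma>) (j x) = j (act \<sigma> x)"
    and v: "\<And>\<sigma> x. \<sigma> \<in> H \<Longrightarrow> x \<in> S \<Longrightarrow> v (j (act \<sigma> x)) = v (j x)"
  shows "orbit_prod (h ` H) act' (j ` S) v = orbit_prod H act S (\<lambda>x. v (j x))"
proof -
  interpret g: group_acting H act S by (rule g)
  interpret g': group_acting "h ` H" act' "j ` S" 
    by (rule group_acting_image[where act = act, OF g]) (rule e)
  let ?T = "transv H act S"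
  have t: "transversal (h ` H) act' (j ` S) (j ` ?T)"
    by (rule transversal_image[where act = act and S = S and h = h, OF g.transv j]) (use e g.closed in auto)
  have "orbit_prod (h ` H) act' (j ` S) v = prod v (j ` ?T)"
    by (rule g'.orbit_prod_eq[OF t]) (auto simp: e v)
  also have "\<dots> = prod (\<lambda>x. v (j x)) ?T"
    by (subst prod.reindex) (use j g.transv_sub in \<open>auto intro: inj_on_subset\<close>)
  finally show ?thesis unfolding orbit_prod_def .
qed

lemma orbit_prod_cong:
  assumes "group_acting H act S" "\<And>x. x \<in> S \<Longrightarrow> v x = w x"
  shows "orbit_prod H act S v = orbit_prod H act S w"
  unfolding orbit_prod_def
  using group_acting.transv_sub[OF assms(1)] assms(2) by (intro prod.cong) auto

definition eqv_fam where
  "eqv_fam H act S A tr =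
     {g \<in> Pi\<^sub>E S A. \<forall>\<sigma>\<in>H. \<forall>x\<in>S. g (act \<sigma> x) = tr \<sigma> x (g x)}"

definition stab_fixed where
  "stab_fixed H act A tr t = {a \<in> A t. \<forall>\<sigma>\<in>H. act \<sigma> t = t \<longrightarrow> tr \<sigma> t a = a}"

text \<open>A family of fibres \<open>A x\<close> over \<open>S\<close> with maps between the fibres that lift the action on \<open>S\<close> to
the disjoint union of the fibres.\<close>

locale bundle_acting = group_acting H act S
  for H :: "'h set" and act :: "'h \<Rightarrow> 'x \<Rightarrow> 'x" and S :: "'x set" +
  fixes A :: "'x \<Rightarrow> 'a set" and tr :: "'h \<Rightarrow> 'x \<Rightarrow> 'a \<Rightarrow> 'a"
  assumes total: "group_acting H (\<lambda>\<sigma> (x, a). (act \<sigma> x, tr \<sigma> x a)) (Sigma S A)"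
begin

text \<open>The value of an equivariant family at \<open>t\<close> determines its values on the orbit of \<open>t\<close>.  It has to
be fixed by the stabilizer of \<open>t\<close>; if it is, the values obtained along two group elements that lead
to the same point agree.\<close>

lemma eqv_fam_bij:
  assumes T: "transversal H act S T"
  shows "bij_betw (\<lambda>g. restrict g T) (eqv_fam H act S A tr)
           (Pi\<^sub>E T (stab_fixed H act A tr))"
proof -
  interpret Z: group_acting H "\<lambda>\<sigma> (x, a). (act \<sigma> x, tr \<sigma> x a)" "Sigma S A" by (rule total)
  let ?E = "eqv_fam H act S A tr" and ?F = "stab_fixed H act A tr"
  have TS: "T \<subseteq> S" and ex: "\<And>x. x \<in> S \<Longrightarrow> \<exists>t\<in>T. \<exists>\<sigma>\<in>H. act \<sigma> t = x"
    using T unfolding transversal_def by (auto, metis)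
  have uniq: "\<And>x t t' \<sigma> \<sigma>'. x \<in> S \<Longrightarrow> t \<in> T \<Longrightarrow> t' \<in> T \<Longrightarrow> \<sigma> \<in> H \<Longrightarrow> \<sigma>' \<in> H \<Longrightarrow>
      act \<sigma> t = x \<Longrightarrow> act \<sigma>' t' = x \<Longrightarrow> t = t'"
    using T unfolding transversal_def by metis
  have inj: "inj_on (\<lambda>g. restrict g T) ?E"
  proof (rule inj_onI)
    fix g h assume gh: "g \<in> ?E" "h \<in> ?E" "restrict g T = restrict h T"
    have tt: "g t = h t" if "t \<in> T" for t using gh(3) that by (metis restrict_apply)
    have "g x = h x" if "x \<in> S" for x
    proof -
      obtain t \<sigma> where "t \<in> T" "\<sigma> \<in> H" "act \<sigma> t = x" using ex \<open>x \<in> S\<close> by blast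
      then show ?thesis using gh tt TS unfolding eqv_fam_def by (smt (verit) mem_Collect_eq subsetD)
    qed
    then show "g = h" using gh unfolding eqv_fam_def by (auto intro: PiE_ext)
  qed
  have into: "restrict g T \<in> Pi\<^sub>E T ?F" if g: "g \<in> ?E" for g
  proof (rule restrict_PiE_iff[THEN iffD2], intro ballI)
    fix t assume t: "t \<in> T"
    then have tS: "t \<in> S" using TS by auto
    show "g t \<in> ?F t"
      using g tS unfolding eqv_fam_def stab_fixed_def by (auto simp: PiE_iff) metis
  qed
  have onto: "h \<in> (\<lambda>g. restrict g T) ` ?E" if h: "h \<in> Pi\<^sub>E T ?F" for h
  proof -
    have hA: "h t \<in> A t" if "t \<in> T" for t using h that unfolding stab_fixed_def by auto
    have hZ: "(t, h t) \<in> Sigma S A" if "t \<in> T" for t using hA that TS by auto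
    have wd: "tr \<sigma> t (h t) = tr \<sigma>' t (h t)"
      if t: "t \<in> T" and s: "\<sigma> \<in> H" "\<sigma>' \<in> H" and eq: "act \<sigma> t = act \<sigma>' t" for t \<sigma> \<sigma>'
    proof -
      obtain \<rho> where r: "\<rho> \<in> H"
          "\<forall>z\<in>Sigma S A. (case (case z of (x, a) \<Rightarrow> (act \<sigma>' x, tr \<sigma>' x a)) of
              (x, a) \<Rightarrow> (act \<rho> x, tr \<rho> x a)) = z"
        using Z.inverse[OF s(2)] by blast
      have r': "act \<rho> (act \<sigma>' t) = t" "tr \<rho> (act \<sigma>' t) (tr \<sigma>' t (h t)) = h t"
        using bspec[OF r(2) hZ[OF t]] by auto
      obtain \<pi> where p: "\<pi> \<in> H"
          "\<forall>z\<in>Sigma S A. (case z of (x, a) \<Rightarrow> (act \<pi> x, tr \<pi> x a)) =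
              (case (case z of (x, a) \<Rightarrow> (act \<sigma> x, tr \<sigma> x a)) of
              (x, a) \<Rightarrow> (act \<rho> x, tr \<rho> x a))"
        using Z.product[OF r(1) s(1)] by blast
      have p': "act \<pi> t = t" "tr \<pi> t (h t) = tr \<rho> (act \<sigma> t) (tr \<sigma> t (h t))"
        using bspec[OF p(2) hZ[OF t]] eq r' by auto
      have "tr \<pi> t (h t) = h t" using h t p(1) p'(1) unfolding stab_fixed_def by auto
      then have e: "tr \<rho> (act \<sigma>' t) (tr \<sigma> t (h t)) = tr \<rho> (act \<sigma>' t) (tr \<sigma>' t (h t))"
        using p' r' eq by simp
      have m: "(act \<sigma>' t, tr \<sigma> t (h t)) \<in> Sigma S A" "(act \<sigma>' t, tr \<sigma>' t (h t)) \<in> Sigma S A"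
        using Z.closed[OF s(1) hZ[OF t]] Z.closed[OF s(2) hZ[OF t]] eq by auto
      show ?thesis using Z.act_inj[OF r(1) m] e by auto
    qed
    define sel where "sel x = (SOME p. fst p \<in> T \<and> snd p \<in> H \<and> act (snd p) (fst p) = x)" for x
    have sel: "fst (sel x) \<in> T \<and> snd (sel x) \<in> H \<and> act (snd (sel x)) (fst (sel x)) = x"
      if "x \<in> S" for x
      unfolding sel_def by (rule someI_ex) (use ex[OF that] in auto)
    define g where "g = (\<lambda>x\<in>S. tr (snd (sel x)) (fst (sel x)) (h (fst (sel x))))"
    have g: "g (act \<sigma> t) = tr \<sigma> t (h t)" if "t \<in> T" "\<sigma> \<in> H" for t \<sigma>
    proof -
      have x: "act \<sigma> t \<in> S" using closed that TS by blast
      have "fst (sel (act \<sigma> t)) = t"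
        using uniq[OF x _ that(1) _ that(2)] sel[OF x] by auto
      then show ?thesis
        using wd[OF that(1), of "snd (sel (act \<sigma> t))" \<sigma>] sel[OF x] that x unfolding g_def by auto
    qed
    have gA: "g x \<in> A x" if "x \<in> S" for x
    proof -
      obtain t \<sigma> where t: "t \<in> T" "\<sigma> \<in> H" "act \<sigma> t = x" using ex \<open>x \<in> S\<close> by blast
      then show ?thesis using g[OF t(1,2)] Z.closed[OF t(2) hZ[OF t(1)]] by auto
    qed
    have geq: "g (act \<tau> x) = tr \<tau> x (g x)" if x: "x \<in> S" and ta: "\<tau> \<in> H" for x \<tau>
    proof -
      obtain t \<sigma> where t: "t \<in> T" "\<sigma> \<in> H" "act \<sigma> t = x" using ex x by blast
      obtain \<pi> where p: "\<pi> \<in> H"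
          "\<forall>z\<in>Sigma S A. (case z of (x, a) \<Rightarrow> (act \<pi> x, tr \<pi> x a)) =
              (case (case z of (x, a) \<Rightarrow> (act \<sigma> x, tr \<sigma> x a)) of
              (x, a) \<Rightarrow> (act \<tau> x, tr \<tau> x a))"
        using Z.product[OF ta t(2)] by blast
      have p': "act \<pi> t = act \<tau> x" "tr \<pi> t (h t) = tr \<tau> x (tr \<sigma> t (h t))"
        using bspec[OF p(2) hZ[OF t(1)]] t by auto
      show ?thesis using g[OF t(1) p(1)] g[OF t(1,2)] p' t(3) by simp
    qed
    have "g \<in> ?E" unfolding eqv_fam_def using gA geq by (auto simp: g_def)
    moreover have "restrict g T = h"
    proof
      fix t
      show "restrict g T t = h t"
      proof (cases "t \<in> T")
        case True
        then obtain \<iota> where i: "\<iota> \<in> H" "act \<iota> t = t" using neutral TS by blast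
        then have "g t = tr \<iota> t (h t)" using g[OF True i(1)] by simp
        also have "\<dots> = h t" using h True i unfolding stab_fixed_def by auto
        finally show ?thesis using True by simp
      next
        case False then show ?thesis using h by (auto simp: PiE_def extensional_def)
      qed
    qed
    ultimately show ?thesis by blast
  qed
  show ?thesis unfolding bij_betw_def using inj into onto by blast
qed

text \<open>By the previous bijection an equivariant family is a free choice of one fixed element for each
orbit, so the distributive law applies.\<close>

lemma sum_eqv_fam:
  fixes \<phi> :: "'x \<Rightarrow> 'a \<Rightarrow> int"
  assumes S: "finite S" and A: "\<And>x. x \<in> S \<Longrightarrow> finite (A x)"
  shows "(\<Sum>g\<in>eqv_fam H act S A tr. orbit_prod H act S (\<lambda>x. \<phi> x (g x))) =
         orbit_prod H act S (\<lambda>x. \<Sum>a\<in>stab_fixed H act A tr x. \<phi> x a)"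
proof -
  let ?T = "transv H act S"
  have TS: "?T \<subseteq> S" by (rule transv_sub)
  have "(\<Prod>t\<in>?T. \<Sum>a\<in>stab_fixed H act A tr t. \<phi> t a) =
        (\<Sum>h\<in>Pi\<^sub>E ?T (stab_fixed H act A tr). \<Prod>t\<in>?T. \<phi> t (h t))"
    by (rule prod_sum_PiE)
      (use S A TS in \<open>auto simp: stab_fixed_def intro: finite_subset\<close>)
  also have "\<dots> = (\<Sum>g\<in>eqv_fam H act S A tr. \<Prod>t\<in>?T. \<phi> t (restrict g ?T t))"
    by (rule sum.reindex_bij_betw[OF eqv_fam_bij[OF transv], symmetric])
  finally show ?thesis unfolding orbit_prod_def by simp
qed

end

context group_acting
begin

text \<open>Burnside's theorem.  Choose a maximal group \<open>K\<close> among the stabilizers of points of \<open>A\<close> and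
\<open>B\<close>.  One of the two sets has a point fixed by \<open>K\<close>, hence both have one, and by maximality its
stabilizer is \<open>K\<close>.  The orbits of the two points are isomorphic; remove them and repeat.\<close>

lemma equal_marks_imp_equivariant_bij:
  assumes "finite A" "finite B" "A \<subseteq> S" "B \<subseteq> S"
    "\<And>\<sigma> a. \<sigma> \<in> H \<Longrightarrow> a \<in> A \<Longrightarrow> act \<sigma> a \<in> A" "\<And>\<sigma> b. \<sigma> \<in> H \<Longrightarrow> b \<in> B \<Longrightarrow> act \<sigma> b \<in> B"
    "\<And>z. z \<in> S \<Longrightarrow> card {a\<in>A. \<forall>\<sigma>\<in>H. act \<sigma> z = z \<longrightarrow> act \<sigma> a = a} =
                   card {b\<in>B. \<forall>\<sigma>\<in>H. act \<sigma> z = z \<longrightarrow> act \<sigma> b = b}"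
  shows "\<exists>\<phi>. bij_betw \<phi> A B \<and> (\<forall>\<sigma>\<in>H. \<forall>a\<in>A. \<phi> (act \<sigma> a) = act \<sigma> (\<phi> a))"
  using assms
proof (induction "card A" arbitrary: A B rule: less_induct)
  case less
  note finA = less.prems(1) and finB = less.prems(2) and AS = less.prems(3) and BS = less.prems(4)
    and cA = less.prems(5) and cB = less.prems(6) and marks = less.prems(7)
  define st where "st z = {\<sigma>\<in>H. act \<sigma> z = z}" for z
  have marks': "card {a\<in>A. st z \<subseteq> st a} = card {b\<in>B. st z \<subseteq> st b}" if "z \<in> S" for z
  proof -
    have "{a\<in>X. st z \<subseteq> st a} = {a\<in>X. \<forall>\<sigma>\<in>H. act \<sigma> z = z \<longrightarrow> act \<sigma> a = a}" for X
      unfolding st_def by auto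
    then show ?thesis using marks[OF that] by simp
  qed
  show ?case
  proof (cases "A \<union> B = {}")
    case True then show ?thesis by (auto intro!: exI[of _ id])
  next
    case False
    obtain K where K: "K \<in> st ` (A \<union> B)" "\<forall>K'\<in>st ` (A \<union> B). K \<subseteq> K' \<longrightarrow> K = K'"
      using finite_has_maximal[of "st ` (A \<union> B)"] finA finB False by auto
    then obtain z where z: "z \<in> A \<union> B" "K = st z" by auto
    have fin: "finite {a\<in>A. st z \<subseteq> st a}" "finite {b\<in>B. st z \<subseteq> st b}" using finA finB by auto
    have "z \<in> {a\<in>A. st z \<subseteq> st a} \<or> z \<in> {b\<in>B. st z \<subseteq> st b}" using z by auto
    then have "{a\<in>A. st z \<subseteq> st a} \<noteq> {} \<and> {b\<in>B. st z \<subseteq> st b} \<noteq> {}"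
      using marks'[of z] z AS BS fin by (metis (no_types, lifting) UnE card_0_eq empty_iff subsetD)
    then obtain a b where ab: "a \<in> A" "b \<in> B" "st z \<subseteq> st a" "st z \<subseteq> st b" by blast
    then have st: "st a = st b" using K z by auto
    have aS: "a \<in> S" and bS: "b \<in> S" using ab AS BS by auto
    have key: "act \<sigma> b = act \<tau> b" if k: "act \<sigma> a = act \<tau> a" "\<sigma> \<in> H" "\<tau> \<in> H"
      "st a = st b" "a \<in> S" "b \<in> S" for \<sigma> \<tau> a b
    proof -
      obtain \<rho> where r: "\<rho> \<in> H" "\<forall>x\<in>S. act \<rho> (act \<tau> x) = x" using inverse k(3) by blast
      obtain \<pi> where p: "\<pi> \<in> H" "\<forall>x\<in>S. act \<pi> x = act \<rho> (act \<sigma> x)" using product r(1) k(2) by blast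
      have "act \<pi> a = a" using p r that by auto
      then have "\<pi> \<in> st b" using that(4) p(1) unfolding st_def by blast
      then have "act \<rho> (act \<sigma> b) = act \<rho> (act \<tau> b)" using p r that unfolding st_def by auto
      then show ?thesis using act_inj r(1) closed that by blast
    qed
    define \<psi> where "\<psi> x = act (SOME \<sigma>. \<sigma> \<in> H \<and> act \<sigma> a = x) b" for x
    have psi: "\<psi> (act \<sigma> a) = act \<sigma> b" if "\<sigma> \<in> H" for \<sigma>
    proof -
      have "(SOME \<tau>. \<tau> \<in> H \<and> act \<tau> a = act \<sigma> a) \<in> H \<and>
          act (SOME \<tau>. \<tau> \<in> H \<and> act \<tau> a = act \<sigma> a) a = act \<sigma> a"
        by (rule someI[of _ \<sigma>]) (use that in auto)
      then show ?thesis unfolding \<psi>_def using key[OF _ _ that st aS bS] by blast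
    qed
    have psibij: "bij_betw \<psi> (orbit a) (orbit b)"
      unfolding bij_betw_def inj_on_def
    proof (intro conjI ballI impI)
      fix x y assume "x \<in> orbit a" "y \<in> orbit a" "\<psi> x = \<psi> y"
      moreover obtain \<sigma> \<tau> where "\<sigma> \<in> H" "\<tau> \<in> H" "x = act \<sigma> a" "y = act \<tau> a"
        using calculation unfolding orbit_def by auto
      moreover from this have "act \<sigma> b = act \<tau> b" using psi calculation(3) by metis
      ultimately show "x = y" using key[OF _ _ _ st[symmetric] bS aS, of \<sigma> \<tau>] by metis
    next
      show "\<psi> ` orbit a = orbit b" unfolding orbit_def using psi by force
    qed
    have psieq: "\<psi> (act \<sigma> x) = act \<sigma> (\<psi> x)" if x: "x \<in> orbit a" and s: "\<sigma> \<in> H" for \<sigma> x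
    proof -
      obtain \<tau> where t: "\<tau> \<in> H" "x = act \<tau> a" using x unfolding orbit_def by auto
      obtain \<pi> where p: "\<pi> \<in> H" "\<forall>x\<in>S. act \<pi> x = act \<sigma> (act \<tau> x)" using product[OF s t(1)] by blast
      show ?thesis using psi[OF p(1)] psi[OF t(1)] p(2) aS bS t(2) by auto
    qed
    have orbc: "act \<sigma> x \<in> orbit y" if k: "x \<in> orbit y" "\<sigma> \<in> H" "y \<in> S" for \<sigma> x y
    proof -
      obtain \<tau> where t: "\<tau> \<in> H" "x = act \<tau> y" using k unfolding orbit_def by auto
      obtain \<pi> where p: "\<pi> \<in> H" "\<forall>x\<in>S. act \<pi> x = act \<sigma> (act \<tau> x)" using product[OF k(2) t(1)] by blast
      show ?thesis unfolding orbit_def using p t k by force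
    qed
    have orbA: "orbit a \<subseteq> A" "orbit b \<subseteq> B" unfolding orbit_def using cA cB ab by auto
    have comp: "act \<sigma> x \<notin> orbit y" if k: "x \<notin> orbit y" "x \<in> S" "\<sigma> \<in> H" "y \<in> S" for \<sigma> x y
    proof
      assume *: "act \<sigma> x \<in> orbit y"
      obtain \<rho> where r: "\<rho> \<in> H" "\<forall>x\<in>S. act \<rho> (act \<sigma> x) = x" using inverse k(3) by blast
      have "x \<in> orbit y" using orbc[OF * r(1)] r(2) k by auto
      then show False using k by simp
    qed
    have sts: "st (\<psi> x) = st x" if x: "x \<in> orbit a" for x
    proof -
      have xS: "x \<in> S" using x orbit_sub aS by auto
      have "\<psi> x \<in> orbit b" using psibij x unfolding bij_betw_def by auto
      then have yS: "\<psi> x \<in> S" using orbit_sub bS by auto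
      have inj: "inj_on \<psi> (orbit a)" using psibij unfolding bij_betw_def by auto
      show ?thesis unfolding st_def
        using psieq[OF x] inj_onD[OF inj, of _ x] orbc[OF x] x aS by (metis (no_types, lifting))
    qed
    have "card (A - orbit a) < card A"
      using finA ab(1) orbit_self[OF aS] by (intro psubset_card_mono) auto
    moreover have "card {x \<in> A - orbit a. \<forall>\<sigma>\<in>H. act \<sigma> z = z \<longrightarrow> act \<sigma> x = x} =
         card {x \<in> B - orbit b. \<forall>\<sigma>\<in>H. act \<sigma> z = z \<longrightarrow> act \<sigma> x = x}" if zS: "z \<in> S" for z
    proof -
      have e: "{x\<in>X. \<forall>\<sigma>\<in>H. act \<sigma> z = z \<longrightarrow> act \<sigma> x = x} = {x\<in>X. st z \<subseteq> st x}" for X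
        unfolding st_def by auto
      have "bij_betw \<psi> {x \<in> orbit a. st z \<subseteq> st x} {x \<in> orbit b. st z \<subseteq> st x}"
        unfolding bij_betw_def
      proof
        show "inj_on \<psi> {x \<in> orbit a. st z \<subseteq> st x}"
          using psibij unfolding bij_betw_def inj_on_def by auto
        have "\<psi> ` orbit a = orbit b" using psibij unfolding bij_betw_def by auto
        then show "\<psi> ` {x \<in> orbit a. st z \<subseteq> st x} = {x \<in> orbit b. st z \<subseteq> st x}"
          using sts by (intro set_eqI iffI) (fastforce simp: image_iff)+
      qed
      then have o: "card {x \<in> orbit a. st z \<subseteq> st x} = card {x \<in> orbit b. st z \<subseteq> st x}"
        by (rule bij_betw_same_card)
      have d: "{x \<in> X - Y. st z \<subseteq> st x} = {x \<in> X. st z \<subseteq> st x} - {x \<in> Y. st z \<subseteq> st x}" for X Y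
        by auto
      have "card {x \<in> A - orbit a. st z \<subseteq> st x} =
          card {x \<in> A. st z \<subseteq> st x} - card {x \<in> orbit a. st z \<subseteq> st x}"
        unfolding d using orbA finA by (intro card_Diff_subset) (auto intro: finite_subset)
      moreover have "card {x \<in> B - orbit b. st z \<subseteq> st x} =
          card {x \<in> B. st z \<subseteq> st x} - card {x \<in> orbit b. st z \<subseteq> st x}"
        unfolding d using orbA finB by (intro card_Diff_subset) (auto intro: finite_subset)
      ultimately show ?thesis using marks'[OF zS] o unfolding e by simp
    qed
    ultimately obtain \<phi> where phi: "bij_betw \<phi> (A - orbit a) (B - orbit b)"
        "\<forall>\<sigma>\<in>H. \<forall>x\<in>A - orbit a. \<phi> (act \<sigma> x) = act \<sigma> (\<phi> x)"
      using less.hyps[of "A - orbit a" "B - orbit b"] finA finB AS BS cA cB comp aS bS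
      by (smt (verit, best) Diff_iff finite_Diff subset_iff)
    define \<chi> where "\<chi> x = (if x \<in> orbit a then \<psi> x else \<phi> x)" for x
    have "bij_betw \<chi> (orbit a \<union> (A - orbit a)) (orbit b \<union> (B - orbit b))"
    proof (rule bij_betw_combine)
      show "bij_betw \<chi> (orbit a) (orbit b)"
        using psibij by (rule bij_betw_cong[THEN iffD1, rotated]) (simp add: \<chi>_def)
      show "bij_betw \<chi> (A - orbit a) (B - orbit b)"
        using phi(1) by (rule bij_betw_cong[THEN iffD1, rotated]) (simp add: \<chi>_def)
    qed auto
    moreover have "orbit a \<union> (A - orbit a) = A" "orbit b \<union> (B - orbit b) = B" using orbA by auto
    moreover have "\<chi> (act \<sigma> x) = act \<sigma> (\<chi> x)" if "\<sigma> \<in> H" "x \<in> A" for \<sigma> x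
      using that psieq phi(2) orbc[of x a \<sigma>] comp[of x a \<sigma>] aS AS unfolding \<chi>_def by auto
    ultimately show ?thesis by auto
  qed
qed

end

section \<open>Species and their marks\<close>

lemma sorted_bijD:
  assumes "sorted_bij U c \<sigma> V d"
  shows "finite U" "finite V" "bij_betw \<sigma> U V" "inj_on \<sigma> U" "\<sigma> ` U = V"
    "\<And>u. u \<in> U \<Longrightarrow> d (\<sigma> u) = c u"
  using assms unfolding sorted_bij_def bij_betw_def by auto

lemma sorted_bij_id: "finite U \<Longrightarrow> sorted_bij U c id U c"
  unfolding sorted_bij_def by auto

lemma sorted_bij_id': "finite U \<Longrightarrow> (\<And>u. u \<in> U \<Longrightarrow> d u = c u) \<Longrightarrow> sorted_bij U c id U d"
  unfolding sorted_bij_def by auto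

lemma sorted_bij_comp:
  "sorted_bij U c \<sigma> V d \<Longrightarrow> sorted_bij V d \<tau> W e \<Longrightarrow> sorted_bij U c (\<tau> \<circ> \<sigma>) W e"
  unfolding sorted_bij_def by (auto intro: bij_betw_trans simp: bij_betwE)

lemma sorted_bij_inv:
  "sorted_bij U c \<sigma> V d \<Longrightarrow> sorted_bij V d (inv_into U \<sigma>) U c"
  unfolding sorted_bij_def
  by (auto simp: bij_betw_inv_into bij_betw_finite bij_betw_imp_surj_on inv_into_into f_inv_into_f
      dest: bij_betw_finite) (metis bij_betw_imp_surj_on f_inv_into_f inv_into_into)

lemma sorted_bij_cong:
  "sorted_bij U c \<sigma> V d \<Longrightarrow> (\<And>u. u \<in> U \<Longrightarrow> \<sigma> u = \<sigma>' u) \<Longrightarrow> sorted_bij U c \<sigma>' V d"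
  unfolding sorted_bij_def by (auto cong: bij_betw_cong)

lemma sorted_bij_unit: "sorted_bij U c \<sigma> V (d :: label \<Rightarrow> unit) \<longleftrightarrow> finite U \<and> bij_betw \<sigma> U V"
  unfolding sorted_bij_def by auto

lemma is_speciesD:
  assumes "is_species F"
  shows "finite U \<Longrightarrow> finite (structs F U c)"
    "sorted_bij U c \<sigma> V d \<Longrightarrow> s \<in> structs F U c \<Longrightarrow> transport F U c \<sigma> s \<in> structs F V d"
    "finite U \<Longrightarrow> s \<in> structs F U c \<Longrightarrow> transport F U c id s = s"
    "sorted_bij U c \<sigma> V d \<Longrightarrow> sorted_bij V d \<tau> W e \<Longrightarrow> s \<in> structs F U c \<Longrightarrow>
       transport F V d \<tau> (transport F U c \<sigma> s) = transport F U c (\<tau> \<circ> \<sigma>) s"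
    "sorted_bij U c \<sigma> V d \<Longrightarrow> (\<And>u. u \<in> U \<Longrightarrow> \<sigma> u = \<sigma>' u) \<Longrightarrow> s \<in> structs F U c \<Longrightarrow>
       transport F U c \<sigma> s = transport F U c \<sigma>' s"
proof -
  show "finite U \<Longrightarrow> finite (structs F U c)"
    using assms unfolding is_species_def by meson
  show "sorted_bij U c \<sigma> V d \<Longrightarrow> s \<in> structs F U c \<Longrightarrow> transport F U c \<sigma> s \<in> structs F V d"
    using assms unfolding is_species_def by meson
  show "finite U \<Longrightarrow> s \<in> structs F U c \<Longrightarrow> transport F U c id s = s"
    using assms unfolding is_species_def by meson
  show "sorted_bij U c \<sigma> V d \<Longrightarrow> sorted_bij V d \<tau> W e \<Longrightarrow> s \<in> structs F U c \<Longrightarrow>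
       transport F V d \<tau> (transport F U c \<sigma> s) = transport F U c (\<tau> \<circ> \<sigma>) s"
    using assms unfolding is_species_def by metis
  show "sorted_bij U c \<sigma> V d \<Longrightarrow> (\<And>u. u \<in> U \<Longrightarrow> \<sigma> u = \<sigma>' u) \<Longrightarrow> s \<in> structs F U c \<Longrightarrow>
       transport F U c \<sigma> s = transport F U c \<sigma>' s"
    using assms unfolding is_species_def by meson
qed

lemma is_speciesI:
  assumes "\<And>U c. finite U \<Longrightarrow> finite (structs F U c)"
    "\<And>U c \<sigma> V d s. sorted_bij U c \<sigma> V d \<Longrightarrow> s \<in> structs F U c \<Longrightarrow> transport F U c \<sigma> s \<in> structs F V d"
    "\<And>U c s. finite U \<Longrightarrow> s \<in> structs F U c \<Longrightarrow> transport F U c id s = s"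
    "\<And>U c \<sigma> V d \<tau> W e s. sorted_bij U c \<sigma> V d \<Longrightarrow> sorted_bij V d \<tau> W e \<Longrightarrow> s \<in> structs F U c \<Longrightarrow>
       transport F U c (\<tau> \<circ> \<sigma>) s = transport F V d \<tau> (transport F U c \<sigma> s)"
    "\<And>U c \<sigma> \<sigma>' V d s. sorted_bij U c \<sigma> V d \<Longrightarrow> (\<And>u. u \<in> U \<Longrightarrow> \<sigma> u = \<sigma>' u) \<Longrightarrow> s \<in> structs F U c \<Longrightarrow>
       transport F U c \<sigma> s = transport F U c \<sigma>' s"
  shows "is_species F"
  unfolding is_species_def
  apply (intro conjI allI impI ballI)
  subgoal by (rule assms(1))
  subgoal by (rule assms(2))
  subgoal by (rule assms(3))
  subgoal by (rule assms(4))
  subgoal by (rule assms(5)) auto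
  done

lemma transport_id_on:
  assumes F: "is_species F" and "finite U" "s \<in> structs F U c" "\<And>u. u \<in> U \<Longrightarrow> \<sigma> u = u"
  shows "transport F U c \<sigma> s = s"
  using is_speciesD(5)[OF F sorted_bij_id[OF assms(2)], of \<sigma> s] is_speciesD(3)[OF F] assms by auto

lemma structs_cong:
  assumes F: "is_species F" and "finite U" "\<And>u. u \<in> U \<Longrightarrow> d u = c u"
  shows "structs F U c = structs F U d"
proof -
  have "structs F U c \<subseteq> structs F U d" if "\<And>u. u \<in> U \<Longrightarrow> d u = c u" for c d
  proof
    fix s assume s: "s \<in> structs F U c"
    show "s \<in> structs F U d"
      using is_speciesD(2)[OF F sorted_bij_id'[OF assms(2) that] s] is_speciesD(3)[OF F assms(2) s] by simp
  qed
  then show ?thesis using assms(3) by (metis subset_antisym)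
qed

lemma transport_inv:
  assumes F: "is_species F" and b: "sorted_bij U c \<sigma> V d" and s: "s \<in> structs F U c"
  shows "transport F V d (inv_into U \<sigma>) (transport F U c \<sigma> s) = s"
  using is_speciesD(4)[OF F b sorted_bij_inv[OF b] s]
    transport_id_on[OF F _ s, of "inv_into U \<sigma> \<circ> \<sigma>"] sorted_bijD[OF b] by simp

lemma transport_bij:
  assumes F: "is_species F" and b: "sorted_bij U c \<sigma> V d"
  shows "bij_betw (transport F U c \<sigma>) (structs F U c) (structs F V d)"
proof (rule bij_betw_byWitness[where f' = "transport F V d (inv_into U \<sigma>)"])
  show "\<forall>s\<in>structs F U c. transport F V d (inv_into U \<sigma>) (transport F U c \<sigma> s) = s"
    using transport_inv[OF F b] by blast
  show "\<forall>s\<in>structs F V d. transport F U c \<sigma> (transport F V d (inv_into U \<sigma>) s) = s"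
  proof
    fix s assume s: "s \<in> structs F V d"
    show "transport F U c \<sigma> (transport F V d (inv_into U \<sigma>) s) = s"
      using is_speciesD(4)[OF F sorted_bij_inv[OF b] b s]
        transport_id_on[OF F _ s, of "\<sigma> \<circ> inv_into U \<sigma>"] sorted_bijD[OF b]
      by (simp add: f_inv_into_f)
  qed
qed (use is_speciesD(2)[OF F b] is_speciesD(2)[OF F sorted_bij_inv[OF b]] in auto)

text \<open>Groups act on finite sets of labels by functions that are arbitrary outside the set, so that the
stabilizer of a subset acts on this subset without any change of its elements.\<close>

definition group_on :: "label set \<Rightarrow> (label \<Rightarrow> label) set \<Rightarrow> bool" where
  "group_on U H \<longleftrightarrow> finite U \<and> group_acting H (\<lambda>\<sigma>. \<sigma>) U"

lemma group_onD:
  assumes "group_on U H"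
  shows "finite U" "group_acting H (\<lambda>\<sigma>. \<sigma>) U" "\<sigma> \<in> H \<Longrightarrow> bij_betw \<sigma> U U"
    "\<sigma> \<in> H \<Longrightarrow> inj_on \<sigma> U" "\<sigma> \<in> H \<Longrightarrow> \<sigma> ` U = U"
proof -
  show U: "finite U" and g: "group_acting H (\<lambda>\<sigma>. \<sigma>) U"
    using assms unfolding group_on_def by auto
  interpret group_acting H "\<lambda>\<sigma>. \<sigma>" U by (rule g)
  show i: "\<sigma> \<in> H \<Longrightarrow> inj_on \<sigma> U" using act_inj by (auto simp: inj_on_def)
  then show e: "\<sigma> \<in> H \<Longrightarrow> \<sigma> ` U = U" using closed U by (simp add: endo_inj_surj image_subsetI)
  show "\<sigma> \<in> H \<Longrightarrow> bij_betw \<sigma> U U" using i e unfolding bij_betw_def by auto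
qed

definition keeps_sorts :: "label set \<Rightarrow> (label \<Rightarrow> 's) \<Rightarrow> (label \<Rightarrow> label) set \<Rightarrow> bool" where
  "keeps_sorts U c H \<longleftrightarrow> (\<forall>\<sigma>\<in>H. \<forall>u\<in>U. c (\<sigma> u) = c u)"

lemma keeps_sorts_unit [simp]: "keeps_sorts U (c :: label \<Rightarrow> unit) H"
  unfolding keeps_sorts_def by auto

lemma group_on_sorted_bij:
  "group_on U H \<Longrightarrow> keeps_sorts U c H \<Longrightarrow> \<sigma> \<in> H \<Longrightarrow> sorted_bij U c \<sigma> U c"
  using group_onD unfolding sorted_bij_def keeps_sorts_def by blast

definition fixed_structs where
  "fixed_structs F U c H = {s \<in> structs F U c. \<forall>\<sigma>\<in>H. transport F U c \<sigma> s = s}"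

text \<open>An entry of Burnside's table of marks, taken for all degrees at once.\<close>

definition mark where
  "mark F U c H = int (card (fixed_structs F U c H))"

definition vmark where
  "vmark V U c H = mark (fst V) U c H - mark (snd V) U c H"

lemma finite_fixed: "is_species F \<Longrightarrow> finite U \<Longrightarrow> finite (fixed_structs F U c H)"
  unfolding fixed_structs_def using is_speciesD(1) by fastforce

lemma card_Collect_bij:
  assumes "bij_betw f A B" "\<And>a. a \<in> A \<Longrightarrow> P a \<longleftrightarrow> Q (f a)"
  shows "card {a\<in>A. P a} = card {b\<in>B. Q b}"
proof (rule bij_betw_same_card)
  show "bij_betw f {a\<in>A. P a} {b\<in>B. Q b}"
    using assms unfolding bij_betw_def inj_on_def by (auto simp: image_iff)
qed

text \<open>Transport along \<open>j\<close> is a bijection between the structures on \<open>U\<close> and on \<open>V\<close>.  The hypotheses on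
\<open>K\<close> say that it is the conjugate of \<open>H\<close> under \<open>j\<close>, up to values of functions outside \<open>V\<close>.\<close>

lemma mark_conj:
  assumes F: "is_species F" and b: "sorted_bij U c j V d"
    and H: "group_on U H" "keeps_sorts U c H"
    and K: "\<And>\<sigma>. \<sigma> \<in> H \<Longrightarrow> \<exists>\<tau>\<in>K. \<forall>u\<in>U. \<tau> (j u) = j (\<sigma> u)"
      "\<And>\<tau>. \<tau> \<in> K \<Longrightarrow> \<exists>\<sigma>\<in>H. \<forall>u\<in>U. \<tau> (j u) = j (\<sigma> u)"
  shows "mark F V d K = mark F U c H"
proof -
  have sb: "sorted_bij V d \<tau> V d"
    and eq: "s \<in> structs F U c \<Longrightarrow>
      transport F V d \<tau> (transport F U c j s) = transport F U c j (transport F U c \<sigma> s)"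
    if s: "\<sigma> \<in> H" and t: "\<forall>u\<in>U. \<tau> (j u) = j (\<sigma> u)" for \<sigma> \<tau> s
  proof -
    have ss: "sorted_bij U c \<sigma> U c" using group_on_sorted_bij[OF H s] .
    have 1: "sorted_bij U c (j \<circ> \<sigma>) V d" using sorted_bij_comp[OF ss b] .
    have 2: "sorted_bij V d ((j \<circ> \<sigma>) \<circ> inv_into U j) V d"
      using sorted_bij_comp[OF sorted_bij_inv[OF b] 1] .
    show sb: "sorted_bij V d \<tau> V d"
    proof (rule sorted_bij_cong[OF 2])
      fix v assume v: "v \<in> V"
      then have i: "inv_into U j v \<in> U" "j (inv_into U j v) = v"
        using sorted_bijD(5)[OF b] by (auto simp: inv_into_into f_inv_into_f)
      then show "((j \<circ> \<sigma>) \<circ> inv_into U j) v = \<tau> v" using bspec[OF t i(1)] by simp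
    qed
    assume s: "s \<in> structs F U c"
    have "transport F V d \<tau> (transport F U c j s) = transport F U c (\<tau> \<circ> j) s"
      by (rule is_speciesD(4)[OF F b sb s])
    also have "\<dots> = transport F U c (j \<circ> \<sigma>) s"
      by (rule is_speciesD(5)[OF F sorted_bij_comp[OF b sb] _ s]) (use t in auto)
    also have "\<dots> = transport F U c j (transport F U c \<sigma> s)"
      by (rule is_speciesD(4)[OF F ss b s, symmetric])
    finally show "transport F V d \<tau> (transport F U c j s) = transport F U c j (transport F U c \<sigma> s)" .
  qed
  have J: "bij_betw (transport F U c j) (structs F U c) (structs F V d)"
    by (rule transport_bij[OF F b])
  have feq: "transport F U c \<sigma> s = s \<longleftrightarrow> transport F V d \<tau> (transport F U c j s) = transport F U c j s"
    if s: "s \<in> structs F U c" and st: "\<sigma> \<in> H" "\<forall>u\<in>U. \<tau> (j u) = j (\<sigma> u)" for s \<sigma> \<tau>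
  proof -
    have "transport F U c \<sigma> s \<in> structs F U c"
      using is_speciesD(2)[OF F group_on_sorted_bij[OF H st(1)] s] .
    then show ?thesis
      using eq[OF st s] inj_onD[OF bij_betw_imp_inj_on[OF J] _ _ s] by auto
  qed
  have "(\<forall>\<sigma>\<in>H. transport F U c \<sigma> s = s) \<longleftrightarrow>
      (\<forall>\<tau>\<in>K. transport F V d \<tau> (transport F U c j s) = transport F U c j s)"
    if s: "s \<in> structs F U c" for s
  proof (intro iffI ballI)
    fix \<tau> assume a: "\<forall>\<sigma>\<in>H. transport F U c \<sigma> s = s" and "\<tau> \<in> K"
    then obtain \<sigma> where "\<sigma> \<in> H" "\<forall>u\<in>U. \<tau> (j u) = j (\<sigma> u)" using K(2) by blast
    with a feq[OF s] show "transport F V d \<tau> (transport F U c j s) = transport F U c j s" by auto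
  next
    fix \<sigma> assume a: "\<forall>\<tau>\<in>K. transport F V d \<tau> (transport F U c j s) = transport F U c j s"
      and "\<sigma> \<in> H"
    then obtain \<tau> where "\<tau> \<in> K" "\<forall>u\<in>U. \<tau> (j u) = j (\<sigma> u)" using K(1) by blast
    with a feq[OF s \<open>\<sigma> \<in> H\<close>] show "transport F U c \<sigma> s = s" by auto
  qed
  then show ?thesis
    unfolding mark_def fixed_structs_def
    using card_Collect_bij[OF J, of "\<lambda>s. \<forall>\<sigma>\<in>H. transport F U c \<sigma> s = s"
        "\<lambda>s. \<forall>\<tau>\<in>K. transport F V d \<tau> s = s"] by simp
qed

lemma iso_imp_mark_eq:
  assumes F: "is_species F" and "F \<cong>\<^sub>S G" "group_on U H" "keeps_sorts U c H"
  shows "mark F U c H = mark G U c H"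
proof -
  obtain \<phi> where p0: "\<forall>U c. finite U \<longrightarrow> bij_betw (\<phi> U c) (structs F U c) (structs G U c)"
    "\<forall>U c \<sigma> V d. sorted_bij U c \<sigma> V d \<longrightarrow> (\<forall>s\<in>structs F U c.
              \<phi> V d (transport F U c \<sigma> s) = transport G U c \<sigma> (\<phi> U c s))"
    using assms(2) unfolding species_iso_def by (elim exE conjE)
  note p = p0[rule_format]
  have U: "finite U" using group_onD assms by blast
  note J = p(1)[OF U, of c]
  have eq: "\<phi> U c (transport F U c \<sigma> s) = transport G U c \<sigma> (\<phi> U c s)"
    if "s \<in> structs F U c" "\<sigma> \<in> H" for s \<sigma>
    using p(2)[OF group_on_sorted_bij[OF assms(3,4) that(2)] that(1)] .
  have "transport F U c \<sigma> s = s \<longleftrightarrow> transport G U c \<sigma> (\<phi> U c s) = \<phi> U c s"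
    if s: "s \<in> structs F U c" and sH: "\<sigma> \<in> H" for s \<sigma>
  proof -
    have "transport F U c \<sigma> s \<in> structs F U c"
      by (rule is_speciesD(2)[OF F group_on_sorted_bij[OF assms(3,4) sH] s])
    then show ?thesis
      using eq[OF s sH] inj_onD[OF bij_betw_imp_inj_on[OF J] _ _ s] by auto
  qed
  then show ?thesis
    unfolding mark_def fixed_structs_def
    using card_Collect_bij[OF J, of "\<lambda>s. \<forall>\<sigma>\<in>H. transport F U c \<sigma> s = s"
        "\<lambda>s. \<forall>\<sigma>\<in>H. transport G U c \<sigma> s = s"] by simp
qed

section \<open>Equality of marks implies isomorphism\<close>

text \<open>Burnside's theorem gives a bijection that is equivariant under all automorphisms of \<open>U\<close>, for each
\<open>U\<close> separately.  To make these bijections natural, fix one representative of each isomorphism class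
of sorted sets and carry the bijection for the representative over to \<open>U\<close> along some isomorphism
\<open>\<theta>\<close>.  Any two choices of \<open>\<theta>\<close> differ by an automorphism of the representative, with which the
bijection commutes.\<close>

lemma mark_eq_imp_iso:
  fixes F :: "('s, 'a) species" and G :: "('s, 'b) species"
  assumes F: "is_species F" and G: "is_species G"
    and m: "\<And>U c H. group_on U H \<Longrightarrow> keeps_sorts U c H \<Longrightarrow> mark F U c H = mark G U c H"
  shows "F \<cong>\<^sub>S G"
proof -
  \<comment> \<open>An equivariant bijection on a single finite set.\<close>
  have loc: "\<exists>\<phi>. bij_betw \<phi> (structs F U c) (structs G U c) \<and>
      (\<forall>\<sigma>. sorted_bij U c \<sigma> U c \<longrightarrow>
         (\<forall>s\<in>structs F U c. \<phi> (transport F U c \<sigma> s) = transport G U c \<sigma> (\<phi> s)))"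
    if U: "finite U" for U c
  proof -
    define A where "A = {\<sigma>. sorted_bij U c \<sigma> U c}"
    define act where "act \<sigma> = map_sum (transport F U c \<sigma>) (transport G U c \<sigma>)" for \<sigma>
    define S where "S = structs F U c <+> structs G U c"
    have id: "act id x = x" if "x \<in> S" for x
      using that is_speciesD(3)[OF F U] is_speciesD(3)[OF G U] unfolding S_def act_def by auto
    have comp: "act (\<sigma> \<circ> \<tau>) x = act \<sigma> (act \<tau> x)" if "\<sigma> \<in> A" "\<tau> \<in> A" "x \<in> S" for \<sigma> \<tau> x
      using that is_speciesD(4)[OF F, of U c \<tau> U c \<sigma> U c] is_speciesD(4)[OF G, of U c \<tau> U c \<sigma> U c]
      unfolding S_def act_def A_def by auto
    have cl: "act \<sigma> x \<in> S" if "\<sigma> \<in> A" "x \<in> S" for \<sigma> x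
      using that is_speciesD(2)[OF F] is_speciesD(2)[OF G] unfolding S_def act_def A_def by auto
    have inv: "act (inv_into U \<sigma>) (act \<sigma> x) = x" if "\<sigma> \<in> A" "x \<in> S" for \<sigma> x
      using that transport_inv[OF F, of U c \<sigma> U c] transport_inv[OF G, of U c \<sigma> U c]
      unfolding S_def act_def A_def by auto
    have invA: "inv_into U \<sigma> \<in> A" if "\<sigma> \<in> A" for \<sigma>
      using that sorted_bij_inv unfolding A_def by auto
    have compA: "\<sigma> \<circ> \<tau> \<in> A" if "\<sigma> \<in> A" "\<tau> \<in> A" for \<sigma> \<tau>
      using that sorted_bij_comp unfolding A_def by auto
    have idA: "id \<in> A" using sorted_bij_id[OF U] unfolding A_def by auto
    interpret group_acting A act S
    proof
      show "act \<sigma> x \<in> S" if "\<sigma> \<in> A" "x \<in> S" for \<sigma> x using cl that .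
      show "\<exists>\<iota>\<in>A. \<forall>x\<in>S. act \<iota> x = x" by (rule bexI[of _ id]) (use id idA in auto)
      show "\<exists>\<rho>\<in>A. \<forall>x\<in>S. act \<rho> x = act \<sigma> (act \<tau> x)" if "\<sigma> \<in> A" "\<tau> \<in> A" for \<sigma> \<tau>
        by (rule bexI[of _ "\<sigma> \<circ> \<tau>"]) (use comp compA that in auto)
      show "\<exists>\<rho>\<in>A. \<forall>x\<in>S. act \<rho> (act \<sigma> x) = x" if "\<sigma> \<in> A" for \<sigma>
        by (rule bexI[of _ "inv_into U \<sigma>"]) (use inv invA that in auto)
    qed
    have finS: "finite (structs F U c)" "finite (structs G U c)"
      using is_speciesD(1)[OF F U] is_speciesD(1)[OF G U] by auto
    have st: "group_on U {\<sigma>\<in>A. act \<sigma> z = z}" if z: "z \<in> S" for z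
    proof -
      have "\<exists>\<rho>\<in>{\<sigma>\<in>A. act \<sigma> z = z}. \<forall>x\<in>U. \<rho> (\<sigma> x) = x" if "\<sigma> \<in> {\<sigma>\<in>A. act \<sigma> z = z}" for \<sigma>
      proof -
        have s: "\<sigma> \<in> A" "act \<sigma> z = z" using that by auto
        have "act (inv_into U \<sigma>) z = z" using inv[OF s(1) z] s(2) by simp
        moreover have "\<forall>x\<in>U. inv_into U \<sigma> (\<sigma> x) = x"
          using s(1) sorted_bijD(4) unfolding A_def by fastforce
        ultimately show ?thesis using invA[OF s(1)] by blast
      qed
      moreover have "\<exists>\<rho>\<in>{\<sigma>\<in>A. act \<sigma> z = z}. \<forall>x\<in>U. \<rho> x = \<sigma> (\<tau> x)"
        if "\<sigma> \<in> {\<sigma>\<in>A. act \<sigma> z = z}" "\<tau> \<in> {\<sigma>\<in>A. act \<sigma> z = z}" for \<sigma> \<tau>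
        using that comp[OF _ _ z] compA by (intro bexI[of _ "\<sigma> \<circ> \<tau>"]) auto
      moreover have "\<sigma> x \<in> U" if "\<sigma> \<in> A" "x \<in> U" for \<sigma> x
        using that sorted_bijD(5) unfolding A_def by fastforce
      moreover have "id \<in> {\<sigma>\<in>A. act \<sigma> z = z}" using idA id[OF z] by auto
      ultimately show ?thesis 
        unfolding group_on_def group_acting_def using U
        by (intro conjI allI impI) (auto intro!: bexI[of _ id])
    qed
    have ks: "keeps_sorts U c {\<sigma>\<in>A. act \<sigma> z = z}" for z
      unfolding keeps_sorts_def A_def using sorted_bijD(6) by fastforce
    have "\<exists>\<phi>. bij_betw \<phi> (Inl ` structs F U c) (Inr ` structs G U c) \<and>
        (\<forall>\<sigma>\<in>A. \<forall>a\<in>Inl ` structs F U c. \<phi> (act \<sigma> a) = act \<sigma> (\<phi> a))"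
    proof (rule equal_marks_imp_equivariant_bij)
      fix z assume z: "z \<in> S"
      have 1: "{a\<in>Inl ` structs F U c. \<forall>\<sigma>\<in>A. act \<sigma> z = z \<longrightarrow> act \<sigma> a = a} =
          Inl ` fixed_structs F U c {\<sigma>\<in>A. act \<sigma> z = z}"
        unfolding fixed_structs_def act_def by auto
      have 2: "{a\<in>Inr ` structs G U c. \<forall>\<sigma>\<in>A. act \<sigma> z = z \<longrightarrow> act \<sigma> a = a} =
          Inr ` fixed_structs G U c {\<sigma>\<in>A. act \<sigma> z = z}"
        unfolding fixed_structs_def act_def by auto
      show "card {a\<in>Inl ` structs F U c. \<forall>\<sigma>\<in>A. act \<sigma> z = z \<longrightarrow> act \<sigma> a = a} =
          card {a\<in>Inr ` structs G U c. \<forall>\<sigma>\<in>A. act \<sigma> z = z \<longrightarrow> act \<sigma> a = a}"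
        unfolding 1 2 using m[OF st[OF z] ks] unfolding mark_def by (simp add: card_image)
    qed (use finS is_speciesD(2)[OF F] is_speciesD(2)[OF G] in \<open>auto simp: S_def act_def A_def\<close>)
    then obtain \<phi> where p: "bij_betw \<phi> (Inl ` structs F U c) (Inr ` structs G U c)"
        "\<forall>\<sigma>\<in>A. \<forall>a\<in>Inl ` structs F U c. \<phi> (act \<sigma> a) = act \<sigma> (\<phi> a)" by blast
    have "bij_betw projr (Inr ` structs G U c :: ('a + 'b) set) (structs G U c)"
      by (rule bij_betw_byWitness[where f' = Inr]) auto
    moreover have "bij_betw Inl (structs F U c) (Inl ` structs F U c :: ('a + 'b) set)"
      by (rule bij_betw_byWitness[where f' = projl]) auto
    ultimately have "bij_betw (projr \<circ> \<phi> \<circ> Inl) (structs F U c) (structs G U c)"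
      using p(1) by (metis bij_betw_trans comp_assoc)
    moreover have "(projr \<circ> \<phi> \<circ> Inl) (transport F U c \<sigma> s) = transport G U c \<sigma> ((projr \<circ> \<phi> \<circ> Inl) s)"
      if k: "sorted_bij U c \<sigma> U c" "s \<in> structs F U c" for \<sigma> s
    proof -
      have "\<phi> (act \<sigma> (Inl s)) = act \<sigma> (\<phi> (Inl s))" using p(2) k unfolding A_def by auto
      moreover obtain t where "\<phi> (Inl s) = Inr t" using p(1) k(2) unfolding bij_betw_def by blast
      ultimately show ?thesis unfolding act_def by simp
    qed
    ultimately show ?thesis by blast
  qed
  define \<phi>0 where "\<phi>0 U c = (SOME \<phi>. bij_betw \<phi> (structs F U c) (structs G U c) \<and>
      (\<forall>\<sigma>. sorted_bij U c \<sigma> U c \<longrightarrow>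
         (\<forall>s\<in>structs F U c. \<phi> (transport F U c \<sigma> s) = transport G U c \<sigma> (\<phi> s))))" for U c
  have \<phi>0: "bij_betw (\<phi>0 U c) (structs F U c) (structs G U c)"
    "\<And>\<sigma> s. sorted_bij U c \<sigma> U c \<Longrightarrow> s \<in> structs F U c \<Longrightarrow>
        \<phi>0 U c (transport F U c \<sigma> s) = transport G U c \<sigma> (\<phi>0 U c s)" if "finite U" for U c
    using someI_ex[OF loc[OF that, of c]] unfolding \<phi>0_def by blast+
  define rep where "rep U c = (SOME q. \<exists>\<sigma>. sorted_bij U c \<sigma> (fst q) (snd q))"
    for U and c :: "label \<Rightarrow> 's"
  define \<theta> where "\<theta> U c = (SOME \<sigma>. sorted_bij U c \<sigma> (fst (rep U c)) (snd (rep U c)))"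
    for U and c :: "label \<Rightarrow> 's"
  have \<theta>: "sorted_bij U c (\<theta> U c) (fst (rep U c)) (snd (rep U c))" if U: "finite U" for U c
  proof -
    have "\<exists>q. \<exists>\<sigma>. sorted_bij U c \<sigma> (fst q) (snd q)"
      using sorted_bij_id[OF U, of c] by (metis fst_conv snd_conv)
    then have "\<exists>\<sigma>. sorted_bij U c \<sigma> (fst (rep U c)) (snd (rep U c))"
      unfolding rep_def by (rule someI_ex)
    then show ?thesis unfolding \<theta>_def by (rule someI_ex)
  qed
  have rep: "rep V d = rep U c" if "sorted_bij U c \<sigma> V d" for U c \<sigma> V d
  proof -
    have "(\<exists>\<tau>. sorted_bij U c \<tau> (fst q) (snd q)) \<longleftrightarrow> (\<exists>\<tau>. sorted_bij V d \<tau> (fst q) (snd q))" for q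
      using sorted_bij_comp[OF that] sorted_bij_comp[OF sorted_bij_inv[OF that]] by blast
    then show ?thesis unfolding rep_def by simp
  qed
  define R where "R U c = fst (rep U c)" for U c
  define e where "e U c = snd (rep U c)" for U c
  define \<phi> where "\<phi> U c s =
      transport G (R U c) (e U c) (inv_into U (\<theta> U c)) (\<phi>0 (R U c) (e U c) (transport F U c (\<theta> U c) s))" for U c s
  have th: "sorted_bij U c (\<theta> U c) (R U c) (e U c)" if "finite U" for U c
    using \<theta>[OF that] unfolding R_def e_def .
  have "bij_betw (\<phi> U c) (structs F U c) (structs G U c)" if U: "finite U" for U c
  proof -
    have "bij_betw (transport G (R U c) (e U c) (inv_into U (\<theta> U c)) \<circ>
        \<phi>0 (R U c) (e U c) \<circ> transport F U c (\<theta> U c)) (structs F U c) (structs G U c)"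
      using transport_bij[OF F th[OF U]] \<phi>0(1)[OF sorted_bijD(2)[OF th[OF U]]]
        transport_bij[OF G sorted_bij_inv[OF th[OF U]]]
      by (metis bij_betw_trans)
    then show ?thesis unfolding \<phi>_def comp_def by simp
  qed
  moreover have "\<phi> V d (transport F U c \<sigma> s) = transport G U c \<sigma> (\<phi> U c s)"
    if b: "sorted_bij U c \<sigma> V d" and s: "s \<in> structs F U c" for U c \<sigma> V d s
  proof -
    have U: "finite U" and V: "finite V" using sorted_bijD b by blast+
    let ?R = "R U c" and ?e = "e U c"
    have RV: "R V d = ?R" "e V d = ?e" unfolding R_def e_def rep[OF b] by auto
    have tU: "sorted_bij U c (\<theta> U c) ?R ?e" using th[OF U] .
    have tV: "sorted_bij V d (\<theta> V d) ?R ?e" using th[OF V, of d] unfolding RV .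
    note iU = sorted_bij_inv[OF tU] and iV = sorted_bij_inv[OF tV]
    define \<pi> where "\<pi> = \<theta> V d \<circ> \<sigma> \<circ> inv_into U (\<theta> U c)"
    have p: "sorted_bij ?R ?e \<pi> ?R ?e"
      unfolding \<pi>_def using sorted_bij_comp[OF iU sorted_bij_comp[OF b tV]] by (simp add: comp_assoc)
    let ?s = "transport F U c (\<theta> U c) s"
    have sR: "?s \<in> structs F ?R ?e" by (rule is_speciesD(2)[OF F tU s])
    let ?t = "\<phi>0 ?R ?e ?s"
    have tR: "?t \<in> structs G ?R ?e"
      using \<phi>0(1)[OF sorted_bijD(2)[OF tU]] sR bij_betwE by blast
    have i1: "inv_into U (\<theta> U c) (\<theta> U c u) = u" if "u \<in> U" for u
      using sorted_bijD(4)[OF tU] that by simp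
    have i2: "inv_into V (\<theta> V d) (\<theta> V d v) = v" if "v \<in> V" for v
      using sorted_bijD(4)[OF tV] that by simp
    have "transport F V d (\<theta> V d) (transport F U c \<sigma> s) = transport F U c (\<theta> V d \<circ> \<sigma>) s"
      by (rule is_speciesD(4)[OF F b tV s])
    also have "\<dots> = transport F U c (\<pi> \<circ> \<theta> U c) s"
      by (rule is_speciesD(5)[OF F sorted_bij_comp[OF b tV] _ s]) (simp add: \<pi>_def i1)
    also have "\<dots> = transport F ?R ?e \<pi> ?s" by (rule is_speciesD(4)[OF F tU p s, symmetric])
    finally have 1: "\<phi>0 ?R ?e (transport F V d (\<theta> V d) (transport F U c \<sigma> s)) = transport G ?R ?e \<pi> ?t"
      using \<phi>0(2)[OF sorted_bijD(2)[OF tU] p sR] by simp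
    have "transport G ?R ?e (inv_into V (\<theta> V d)) (transport G ?R ?e \<pi> ?t) =
        transport G ?R ?e (inv_into V (\<theta> V d) \<circ> \<pi>) ?t"
      by (rule is_speciesD(4)[OF G p iV tR])
    also have "\<dots> = transport G ?R ?e (\<sigma> \<circ> inv_into U (\<theta> U c)) ?t"
    proof (rule is_speciesD(5)[OF G sorted_bij_comp[OF p iV] _ tR])
      fix u assume "u \<in> ?R"
      then have "inv_into U (\<theta> U c) u \<in> U" using sorted_bijD(5)[OF iU] by auto
      then have "\<sigma> (inv_into U (\<theta> U c) u) \<in> V" using sorted_bijD(5)[OF b] by auto
      then show "(inv_into V (\<theta> V d) \<circ> \<pi>) u = (\<sigma> \<circ> inv_into U (\<theta> U c)) u"
        unfolding \<pi>_def by (simp add: i2)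
    qed
    also have "\<dots> = transport G U c \<sigma> (transport G ?R ?e (inv_into U (\<theta> U c)) ?t)"
      by (rule is_speciesD(4)[OF G iU b tR, symmetric])
    finally show ?thesis unfolding \<phi>_def RV 1 .
  qed
  ultimately show ?thesis unfolding species_iso_def by (intro exI[of _ \<phi>]) blast
qed

section \<open>Relabelling structures\<close>

text \<open>The species with each structure replaced by a label.  Transport determines the sorts on the
target only inside the target set, so the encoding must depend on nothing but the restriction of
\<open>c\<close> to \<open>U\<close>.\<close>

definition relabelled :: "('s, 'a) species \<Rightarrow> ('s, label) species" where
  "relabelled F =
     (let enc = (\<lambda>U c. SOME e :: 'a \<Rightarrow> label. inj_on e (structs F U c)) in
     \<lparr> structs = (\<lambda>U c. enc U (restrict c U) ` structs F U c),
       transport = (\<lambda>U c \<sigma> l.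
         enc (\<sigma> ` U) (restrict (c \<circ> inv_into U \<sigma>) (\<sigma> ` U))
           (transport F U c \<sigma> (inv_into (structs F U c) (enc U (restrict c U)) l))) \<rparr>)"

lemma relabelled_iso:
  fixes F :: "('s, 'a) species"
  assumes F: "is_species F"
  shows "is_species (relabelled F) \<and> F \<cong>\<^sub>S relabelled F"
proof -
  define enc where "enc U c = (SOME e :: 'a \<Rightarrow> label. inj_on e (structs F U c))" for U c
  define e where "e U c = enc U (restrict c U)" for U c
  have e: "inj_on (e U c) (structs F U c)" if U: "finite U" for U c
  proof -
    have "finite (structs F U c)" using is_speciesD(1)[OF F U] .
    then obtain f :: "'a \<Rightarrow> nat" where "inj_on f (structs F U c)"
      using finite_imp_inj_to_nat_seg by metis
    then have "inj_on (Atom \<circ> f) (structs F U c)" by (auto simp: inj_on_def)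
    moreover have s: "structs F U (restrict c U) = structs F U c"
      using structs_cong[OF F U, of c "restrict c U"] by simp
    ultimately have "\<exists>e :: 'a \<Rightarrow> label. inj_on e (structs F U (restrict c U))" by auto
    then have "inj_on (SOME e :: 'a \<Rightarrow> label. inj_on e (structs F U (restrict c U))) (structs F U (restrict c U))"
      by (rule someI_ex)
    then show ?thesis unfolding e_def enc_def s by simp
  qed
  have st: "structs (relabelled F) U c = e U c ` structs F U c" for U c
    unfolding relabelled_def e_def enc_def by simp
  have tr: "transport (relabelled F) U c \<sigma> (e U c s) = e V d (transport F U c \<sigma> s)"
    if b: "sorted_bij U c \<sigma> V d" and s: "s \<in> structs F U c" for U c \<sigma> V d s
  proof -
    have "inv_into (structs F U c) (e U c) (e U c s) = s"
      using inv_into_f_f[OF e s] sorted_bijD(1)[OF b] by simp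
    moreover have "restrict (c \<circ> inv_into U \<sigma>) (\<sigma> ` U) = restrict d V"
      using sorted_bijD[OF b] by (auto simp: restrict_def fun_eq_iff)
    ultimately show ?thesis
      using sorted_bijD(5)[OF b] unfolding relabelled_def e_def enc_def by simp
  qed
  have "is_species (relabelled F)"
  proof (rule is_speciesI)
    fix U :: "label set" and c :: "label \<Rightarrow> 's"
    assume "finite U" then show "finite (structs (relabelled F) U c)"
      unfolding st using is_speciesD(1)[OF F] by auto
  next
    fix U c \<sigma> V d l
    assume "sorted_bij U c \<sigma> V d" "l \<in> structs (relabelled F) U c"
    then show "transport (relabelled F) U c \<sigma> l \<in> structs (relabelled F) V d"
      unfolding st using tr is_speciesD(2)[OF F] by fastforce
  next
    fix U c l assume U: "finite U" and l: "l \<in> structs (relabelled F) U c"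
    then obtain s where s: "s \<in> structs F U c" "l = e U c s" unfolding st by auto
    show "transport (relabelled F) U c id l = l"
      using tr[OF sorted_bij_id[OF U] s(1)] is_speciesD(3)[OF F U s(1)] s(2) by simp
  next
    fix U c \<sigma> V d \<tau> W k l
    assume b: "sorted_bij U c \<sigma> V d" "sorted_bij V d \<tau> W k" and l: "l \<in> structs (relabelled F) U c"
    then obtain s where s: "s \<in> structs F U c" "l = e U c s" unfolding st by auto
    show "transport (relabelled F) U c (\<tau> \<circ> \<sigma>) l =
        transport (relabelled F) V d \<tau> (transport (relabelled F) U c \<sigma> l)"
      unfolding s(2) tr[OF b(1) s(1)] tr[OF b(2) is_speciesD(2)[OF F b(1) s(1)]]
        tr[OF sorted_bij_comp[OF b] s(1)] is_speciesD(4)[OF F b s(1)] ..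
  next
    fix U c \<sigma> \<sigma>' V d l
    assume b: "sorted_bij U c \<sigma> V d" and ss: "\<And>u. u \<in> U \<Longrightarrow> \<sigma> u = \<sigma>' u"
      and l: "l \<in> structs (relabelled F) U c"
    then obtain s where s: "s \<in> structs F U c" "l = e U c s" unfolding st by auto
    show "transport (relabelled F) U c \<sigma> l = transport (relabelled F) U c \<sigma>' l"
      using tr[OF b s(1)] tr[OF sorted_bij_cong[OF b, of \<sigma>'] s(1)]
        is_speciesD(5)[OF F b, of \<sigma>', OF _ s(1)] ss s(2) by simp
  qed
  moreover have "F \<cong>\<^sub>S relabelled F"
    unfolding species_iso_def
  proof (intro exI[of _ e] conjI allI impI ballI)
    fix U :: "label set" and c :: "label \<Rightarrow> 's"
    assume "finite U"
    then show "bij_betw (e U c) (structs F U c) (structs (relabelled F) U c)"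
      unfolding st bij_betw_def using e by auto
  qed (use tr in auto)
  ultimately show ?thesis by blast
qed

lemma relabelled:
  assumes F: "is_species F"
  shows "is_species (relabelled F)"
    and "group_on U H \<Longrightarrow> keeps_sorts U c H \<Longrightarrow> mark (relabelled F) U c H = mark F U c H"
  using relabelled_iso[OF F] iso_imp_mark_eq[OF F, of "relabelled F" U H c] by auto

section \<open>Elementary species and sums\<close>

lemma singleton_sorted_bij:
  "sorted_bij U c \<sigma> V d \<Longrightarrow> (\<exists>u. U = {u} \<and> c u = a) \<longleftrightarrow> (\<exists>v. V = {v} \<and> d v = a)"
proof -
  have "\<exists>v. V = {v} \<and> d v = a" if "sorted_bij U c \<sigma> V d" "\<exists>u. U = {u} \<and> c u = a" for U V c d \<sigma>
    using that sorted_bijD(5,6)[OF that(1)] by auto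
  then show "sorted_bij U c \<sigma> V d \<Longrightarrow> ?thesis" using sorted_bij_inv by blast
qed

lemma is_species_zero: "is_species sp_zero"
  by (rule is_speciesI) (auto simp: sp_zero_def)

lemma is_species_single: "is_species (sp_single a)"
proof (rule is_speciesI)
  fix U V :: "label set" and c d \<sigma> s
  assume "sorted_bij U c \<sigma> V d" "s \<in> structs (sp_single a) U c"
  then show "transport (sp_single a) U c \<sigma> s \<in> structs (sp_single a) V d"
    using singleton_sorted_bij[of U c \<sigma> V d a] by (auto simp: sp_single_def split: if_splits)
qed (auto simp: sp_single_def)

lemma is_species_E_plus: "is_species sp_E_plus"
  by (rule is_speciesI) (auto simp: sp_E_plus_def dest: sorted_bijD)

lemma is_species_add:
  assumes F: "is_species F" and G: "is_species G"
  shows "is_species (F +\<^sub>S G)"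
proof (rule is_speciesI)
  fix U :: "label set" and c assume "finite U"
  then show "finite (structs (F +\<^sub>S G) U c)"
    using is_speciesD(1)[OF F] is_speciesD(1)[OF G] by (auto simp: sp_add_def)
next
  fix U V c d \<sigma> s
  assume "sorted_bij U c \<sigma> V d" "s \<in> structs (F +\<^sub>S G) U c"
  then show "transport (F +\<^sub>S G) U c \<sigma> s \<in> structs (F +\<^sub>S G) V d"
    using is_speciesD(2)[OF F] is_speciesD(2)[OF G] by (auto simp: sp_add_def)
next
  fix U c s
  assume "finite U" "s \<in> structs (F +\<^sub>S G) U c"
  then show "transport (F +\<^sub>S G) U c id s = s"
    using is_speciesD(3)[OF F] is_speciesD(3)[OF G] by (auto simp: sp_add_def)
next
  fix U V W c d e \<sigma> \<tau> s
  assume "sorted_bij U c \<sigma> V d" "sorted_bij V d \<tau> W e" "s \<in> structs (F +\<^sub>S G) U c"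
  then show "transport (F +\<^sub>S G) U c (\<tau> \<circ> \<sigma>) s =
      transport (F +\<^sub>S G) V d \<tau> (transport (F +\<^sub>S G) U c \<sigma> s)"
    using is_speciesD(4)[OF F] is_speciesD(4)[OF G] by (auto simp: sp_add_def)
next
  fix U V c d \<sigma> \<sigma>' s
  assume "sorted_bij U c \<sigma> V d" "\<And>u. u \<in> U \<Longrightarrow> \<sigma> u = \<sigma>' u" "s \<in> structs (F +\<^sub>S G) U c"
  then show "transport (F +\<^sub>S G) U c \<sigma> s = transport (F +\<^sub>S G) U c \<sigma>' s"
    using is_speciesD(5)[OF F, of U c \<sigma> V d \<sigma>'] is_speciesD(5)[OF G, of U c \<sigma> V d \<sigma>']
    by (auto simp: sp_add_def)
qed

lemma mark_zero: "mark sp_zero U c H = 0"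
  by (simp add: mark_def fixed_structs_def sp_zero_def)

lemma mark_single: "mark (sp_single a) U c H = of_bool (\<exists>u. U = {u} \<and> c u = a)"
  by (auto simp: mark_def fixed_structs_def sp_single_def)

lemma mark_E_plus: "mark sp_E_plus U c H = of_bool (U \<noteq> {})"
  by (auto simp: mark_def fixed_structs_def sp_E_plus_def)

lemma mark_add:
  assumes "is_species F" "is_species G" "finite U"
  shows "mark (F +\<^sub>S G) U c H = mark F U c H + mark G U c H"
proof -
  have "fixed_structs (F +\<^sub>S G) U c H = fixed_structs F U c H <+> fixed_structs G U c H"
    unfolding fixed_structs_def sp_add_def by auto
  then show ?thesis
    unfolding mark_def using finite_fixed[OF assms(1,3)] finite_fixed[OF assms(2,3)]
    by (simp add: card_Plus)
qed

text \<open>Marks being integers, cancellation of species is cancellation of integers.\<close>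

lemma virtual_eq_iff_vmark:
  assumes V: "is_virtual V" and W: "is_virtual W"
  shows "V =\<^sub>V W \<longleftrightarrow>
    (\<forall>U c H. group_on U H \<longrightarrow> keeps_sorts U c H \<longrightarrow> vmark V U c H = vmark W U c H)"
proof -
  have s: "is_species (fst V)" "is_species (snd V)" "is_species (fst W)" "is_species (snd W)"
    using V W unfolding is_virtual_def by auto
  have eq: "vmark V U c H = vmark W U c H \<longleftrightarrow>
      mark (fst V +\<^sub>S snd W) U c H = mark (snd V +\<^sub>S fst W) U c H" if "group_on U H" for U c H
    using mark_add s group_onD(1)[OF that] unfolding vmark_def by (smt (verit))
  show ?thesis
  proof
    assume "V =\<^sub>V W"
    then show "\<forall>U c H. group_on U H \<longrightarrow> keeps_sorts U c H \<longrightarrow> vmark V U c H = vmark W U c H"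
      using eq iso_imp_mark_eq[OF is_species_add[OF s(1,4)]] unfolding virtual_eq_def by blast
  next
    assume "\<forall>U c H. group_on U H \<longrightarrow> keeps_sorts U c H \<longrightarrow> vmark V U c H = vmark W U c H"
    then show "V =\<^sub>V W"
      unfolding virtual_eq_def
      using eq by (intro mark_eq_imp_iso is_species_add s) blast
  qed
qed

section \<open>Composites are species\<close>

lemma unblk_blk [simp]: "finite B \<Longrightarrow> unblk (blk B) = B"
  by (simp add: blk_def Abs_fset_inverse)

definition lift :: "(label \<Rightarrow> label) \<Rightarrow> label \<Rightarrow> label" where
  "lift \<sigma> b = blk (\<sigma> ` unblk b)"

lemma lift_blk [simp]: "finite B \<Longrightarrow> lift \<sigma> (blk B) = blk (\<sigma> ` B)"
  by (simp add: lift_def)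

lemma partition_block:
  assumes "partition_on U P" "B \<in> P"
  shows "B \<subseteq> U" "B \<noteq> {}" "finite U \<Longrightarrow> finite B"
  using assms unfolding partition_on_def by (auto intro: finite_subset)

lemma inj_on_blk: "finite U \<Longrightarrow> partition_on U P \<Longrightarrow> inj_on blk P"
  by (metis inj_onI partition_block(3) unblk_blk)

lemma partition_image:
  assumes "partition_on U P" "inj_on \<sigma> U"
  shows "partition_on (\<sigma> ` U) ((`) \<sigma> ` P)"
proof -
  have "{} \<notin> (`) \<sigma> ` P" using partition_block(2)[OF assms(1)] by auto
  then show ?thesis using partition_on_inj_image[OF assms] by simp
qed

lemma inv_into_image: "inj_on \<sigma> U \<Longrightarrow> B \<subseteq> U \<Longrightarrow> inv_into U \<sigma> ` \<sigma> ` B = B"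
  by (rule inv_into_image_cancel)

lemma sorted_bij_block:
  "sorted_bij U c \<sigma> V d \<Longrightarrow> B \<subseteq> U \<Longrightarrow> sorted_bij B c \<sigma> (\<sigma> ` B) d"
  unfolding sorted_bij_def by (meson bij_betw_subset finite_subset subsetD image_mono bij_betw_def inj_on_subset)

definition tr_fam where
  "tr_fam G U c \<sigma> P g =
     (\<lambda>B\<in>(`) \<sigma> ` P. let A = inv_into U \<sigma> ` B in transport G A c \<sigma> (g A))"

lemma tr_fam_app:
  "sorted_bij U c \<sigma> V d \<Longrightarrow> partition_on U P \<Longrightarrow> B \<in> P \<Longrightarrow>
    tr_fam G U c \<sigma> P g (\<sigma> ` B) = transport G B c \<sigma> (g B)"
  unfolding tr_fam_def
  by (simp add: inv_into_image[OF sorted_bijD(4)] partition_block(1) Let_def)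

text \<open>The sorts of the blocks, as used in \<^const>\<open>sp_comp_by\<close>.\<close>

definition block_sorts :: "('b \<Rightarrow> 't) \<Rightarrow> (label set \<Rightarrow> 'b) \<Rightarrow> label \<Rightarrow> 't" where
  "block_sorts \<kappa> g b = \<kappa> (g (unblk b))"

lemma sp_comp_by_simps:
  "structs (sp_comp_by \<kappa> F G) U c = {(P, f, g). partition_on U P \<and>
           g \<in> (\<Pi>\<^sub>E B\<in>P. structs G B c) \<and> f \<in> structs F (blk ` P) (block_sorts \<kappa> g)}"
  "transport (sp_comp_by \<kappa> F G) U c \<sigma> (P, f, g) =
     ((`) \<sigma> ` P, transport F (blk ` P) (block_sorts \<kappa> g) (lift \<sigma>) f, tr_fam G U c \<sigma> P g)"
  unfolding sp_comp_by_def tr_fam_def block_sorts_def lift_def by (simp_all add: fun_eq_iff)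

text \<open>The condition on \<open>\<kappa>\<close> under which moving a family of \<open>G\<close>-structures does not change the sorts
of the blocks, so that the \<open>F\<close>-structure on the set of blocks can be moved along.\<close>

definition sort_invariant where
  "sort_invariant \<kappa> G \<longleftrightarrow> (\<forall>U c \<sigma> V d s. sorted_bij U c \<sigma> V d \<longrightarrow> s \<in> structs G U c \<longrightarrow>
     \<kappa> (transport G U c \<sigma> s) = \<kappa> s)"

lemma lift_sorted_bij:
  assumes b: "sorted_bij U c \<sigma> V d" and P: "partition_on U P"
    and g: "\<And>B. B \<in> P \<Longrightarrow> \<kappa> (g' (\<sigma> ` B)) = \<kappa> (g B)"
  shows "sorted_bij (blk ` P) (block_sorts \<kappa> g) (lift \<sigma>) (blk ` (`) \<sigma> ` P) (block_sorts \<kappa> g')"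
proof -
  have fin: "finite B" "finite (\<sigma> ` B)" if "B \<in> P" for B
    using partition_block(3)[OF P that sorted_bijD(1)[OF b]] by auto
  have "inj_on (lift \<sigma>) (blk ` P)"
  proof (rule inj_onI)
    fix x y assume "x \<in> blk ` P" "y \<in> blk ` P" and eq: "lift \<sigma> x = lift \<sigma> y"
    then obtain A B where AB: "A \<in> P" "B \<in> P" "x = blk A" "y = blk B" by auto
    then have "\<sigma> ` A = \<sigma> ` B" using eq fin by (metis lift_blk unblk_blk)
    then show "x = y"
      using AB sorted_bijD(4)[OF b] partition_block(1)[OF P] by (metis inv_into_image)
  qed
  moreover have "lift \<sigma> ` blk ` P = blk ` (`) \<sigma> ` P"
    using fin by (force simp: image_iff)
  moreover have "finite P" using finite_elements[OF sorted_bijD(1)[OF b] P] .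
  ultimately show ?thesis
    unfolding sorted_bij_def bij_betw_def block_sorts_def using fin g by auto
qed

lemma is_species_comp_by:
  assumes F: "is_species F" and G: "is_species G" and k: "sort_invariant \<kappa> G"
  shows "is_species (sp_comp_by \<kappa> F G)"
proof (rule is_speciesI)
  let ?C = "sp_comp_by \<kappa> F G"
  have D: "partition_on U P" "g \<in> (\<Pi>\<^sub>E B\<in>P. structs G B c)" "f \<in> structs F (blk ` P) (block_sorts \<kappa> g)"
    "\<And>B. B \<in> P \<Longrightarrow> g B \<in> structs G B c"
    if "(P, f, g) \<in> structs ?C U c" for P f g U c
    using that by (auto simp: sp_comp_by_simps)
  have sb: "sorted_bij (blk ` P) (block_sorts \<kappa> g) (lift \<sigma>) (blk ` (`) \<sigma> ` P)
      (block_sorts \<kappa> (tr_fam G U c \<sigma> P g))"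
    if b: "sorted_bij U c \<sigma> V d" and s: "(P, f, g) \<in> structs ?C U c" for U c \<sigma> V d P f g
  proof (rule lift_sorted_bij[OF b D(1)[OF s]])
    fix B assume B: "B \<in> P"
    show "\<kappa> (tr_fam G U c \<sigma> P g (\<sigma> ` B)) = \<kappa> (g B)"
      unfolding tr_fam_app[OF b D(1)[OF s] B]
      using k sorted_bij_block[OF b partition_block(1)[OF D(1)[OF s] B]] D(4)[OF s B]
      unfolding sort_invariant_def by blast
  qed
  {
    fix U :: "label set" and c assume U: "finite U"
    let ?g = "\<lambda>P. (\<Pi>\<^sub>E B\<in>P. structs G B c)"
    have "structs ?C U c \<subseteq> (SIGMA P:{P. partition_on U P}.
        prod.swap ` (SIGMA g:?g P. structs F (blk ` P) (block_sorts \<kappa> g)))"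
      by (auto simp: sp_comp_by_simps image_iff)
    moreover have "finite (SIGMA P:{P. partition_on U P}.
        prod.swap ` (SIGMA g:?g P. structs F (blk ` P) (block_sorts \<kappa> g)))"
    proof (intro finite_SigmaI finite_imageI)
      fix P assume "P \<in> {P. partition_on U P}"
      then have P: "partition_on U P" by simp
      then have fP: "finite P" using finite_elements[OF U] by blast
      show "finite (?g P)"
        using fP is_speciesD(1)[OF G] partition_block(3)[OF P _ U] by (intro finite_PiE) auto
      show "finite (structs F (blk ` P) (block_sorts \<kappa> g))" for g
        using fP by (intro is_speciesD(1)[OF F]) auto
    qed (use U finitely_many_partition_on in auto)
    ultimately show "finite (structs ?C U c)" by (rule finite_subset)
  next
    fix U V c d \<sigma> s
    assume b: "sorted_bij U c \<sigma> V d" and s: "s \<in> structs ?C U c"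
    obtain P f g where sP: "s = (P, f, g)" by (cases s)
    note s = s[unfolded sP]
    have P: "partition_on V ((`) \<sigma> ` P)"
      using partition_image[OF D(1)[OF s] sorted_bijD(4)[OF b]] sorted_bijD(5)[OF b] by simp
    have "tr_fam G U c \<sigma> P g (\<sigma> ` B) \<in> structs G (\<sigma> ` B) d" if B: "B \<in> P" for B
      unfolding tr_fam_app[OF b D(1)[OF s] B]
      by (rule is_speciesD(2)[OF G sorted_bij_block[OF b partition_block(1)[OF D(1)[OF s] B]] D(4)[OF s B]])
    then have "tr_fam G U c \<sigma> P g \<in> (\<Pi>\<^sub>E B\<in>(`) \<sigma> ` P. structs G B d)"
      by (auto simp: PiE_iff) (simp add: tr_fam_def)
    then show "transport ?C U c \<sigma> s \<in> structs ?C V d"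
      unfolding sP using P is_speciesD(2)[OF F sb[OF b s] D(3)[OF s]]
      by (simp add: sp_comp_by_simps)
  next
    fix U c s
    assume U: "finite U" and s: "s \<in> structs ?C U c"
    obtain P f g where sP: "s = (P, f, g)" by (cases s)
    note s = s[unfolded sP]
    have fin: "finite B" "B \<subseteq> U" if "B \<in> P" for B using partition_block[OF D(1)[OF s] that] U by auto
    have f: "transport F (blk ` P) (block_sorts \<kappa> g) (lift id) f = f"
      by (rule transport_id_on[OF F _ D(3)[OF s]])
        (use finite_elements[OF U D(1)[OF s]] fin in auto)
    have g: "tr_fam G U c id P g = g"
    proof (rule extensionalityI[of _ P])
      show "tr_fam G U c id P g \<in> extensional P" unfolding tr_fam_def by simp
      show "g \<in> extensional P" using D(2)[OF s] by (auto simp: PiE_def)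
      fix B assume B: "B \<in> P"
      show "tr_fam G U c id P g B = g B"
        using tr_fam_app[OF sorted_bij_id[OF U] D(1)[OF s] B, of G c g]
          is_speciesD(3)[OF G fin(1)[OF B] D(4)[OF s B]] by simp
    qed
    show "transport ?C U c id s = s" unfolding sP sp_comp_by_simps f g by simp
  next
    fix U V W c d e \<sigma> \<tau> s
    assume b: "sorted_bij U c \<sigma> V d" and b': "sorted_bij V d \<tau> W e" and s: "s \<in> structs ?C U c"
    obtain P f g where sP: "s = (P, f, g)" by (cases s)
    note s = s[unfolded sP]
    have P: "partition_on V ((`) \<sigma> ` P)"
      using partition_image[OF D(1)[OF s] sorted_bijD(4)[OF b]] sorted_bijD(5)[OF b] by simp
    have fin: "finite B" "B \<subseteq> U" if "B \<in> P" for B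
      using partition_block[OF D(1)[OF s] that] sorted_bijD(1)[OF b] by auto
    have g: "tr_fam G U c (\<tau> \<circ> \<sigma>) P g = tr_fam G V d \<tau> ((`) \<sigma> ` P) (tr_fam G U c \<sigma> P g)"
    proof (rule extensionalityI[of _ "(`) \<tau> ` (`) \<sigma> ` P"])
      show "tr_fam G U c (\<tau> \<circ> \<sigma>) P g \<in> extensional ((`) \<tau> ` (`) \<sigma> ` P)"
        unfolding tr_fam_def by (simp add: image_comp comp_def)
      show "tr_fam G V d \<tau> ((`) \<sigma> ` P) (tr_fam G U c \<sigma> P g) \<in> extensional ((`) \<tau> ` (`) \<sigma> ` P)"
        unfolding tr_fam_def by simp
      fix B assume "B \<in> (`) \<tau> ` (`) \<sigma> ` P"
      then obtain A where A: "A \<in> P" "B = \<tau> ` \<sigma> ` A" by auto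
      have 1: "tr_fam G U c (\<tau> \<circ> \<sigma>) P g B = transport G A c (\<tau> \<circ> \<sigma>) (g A)"
        using tr_fam_app[OF sorted_bij_comp[OF b b'] D(1)[OF s] A(1), of G g] A(2)
        by (simp add: image_comp)
      have 2: "tr_fam G V d \<tau> ((`) \<sigma> ` P) (tr_fam G U c \<sigma> P g) B =
          transport G (\<sigma> ` A) d \<tau> (transport G A c \<sigma> (g A))"
        using tr_fam_app[OF b' P, of "\<sigma> ` A" G] A tr_fam_app[OF b D(1)[OF s] A(1), of G g] by simp
      have 3: "sorted_bij A c \<sigma> (\<sigma> ` A) d" "sorted_bij (\<sigma> ` A) d \<tau> (\<tau> ` \<sigma> ` A) e"
        using sorted_bij_block[OF b fin(2)[OF A(1)]] sorted_bij_block[OF b', of "\<sigma> ` A"]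
          fin(2)[OF A(1)] sorted_bijD(5)[OF b] by auto
      show "tr_fam G U c (\<tau> \<circ> \<sigma>) P g B =
          tr_fam G V d \<tau> ((`) \<sigma> ` P) (tr_fam G U c \<sigma> P g) B"
        unfolding 1 2 using is_speciesD(4)[OF G 3 D(4)[OF s A(1)]] by simp
    qed
    let ?s = "block_sorts \<kappa> g" and ?t = "block_sorts \<kappa> (tr_fam G U c \<sigma> P g)"
    have t: "((`) \<sigma> ` P, transport F (blk ` P) ?s (lift \<sigma>) f, tr_fam G U c \<sigma> P g) \<in> structs ?C V d"
    proof -
      have "tr_fam G U c \<sigma> P g (\<sigma> ` B) \<in> structs G (\<sigma> ` B) d" if B: "B \<in> P" for B
        unfolding tr_fam_app[OF b D(1)[OF s] B]
        by (rule is_speciesD(2)[OF G sorted_bij_block[OF b partition_block(1)[OF D(1)[OF s] B]] D(4)[OF s B]])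
      then have "tr_fam G U c \<sigma> P g \<in> (\<Pi>\<^sub>E B\<in>(`) \<sigma> ` P. structs G B d)"
        by (auto simp: PiE_iff) (simp add: tr_fam_def)
      then show ?thesis using P is_speciesD(2)[OF F sb[OF b s] D(3)[OF s]] by (simp add: sp_comp_by_simps)
    qed
    have "transport F (blk ` (`) \<sigma> ` P) ?t (lift \<tau>) (transport F (blk ` P) ?s (lift \<sigma>) f) =
        transport F (blk ` P) ?s (lift \<tau> \<circ> lift \<sigma>) f"
      by (rule is_speciesD(4)[OF F sb[OF b s] sb[OF b' t] D(3)[OF s]])
    also have "\<dots> = transport F (blk ` P) ?s (lift (\<tau> \<circ> \<sigma>)) f"
      by (rule is_speciesD(5)[OF F sorted_bij_comp[OF sb[OF b s] sb[OF b' t]] _ D(3)[OF s]])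
        (use fin in \<open>auto simp: image_comp\<close>)
    finally show "transport ?C U c (\<tau> \<circ> \<sigma>) s = transport ?C V d \<tau> (transport ?C U c \<sigma> s)"
      unfolding sP sp_comp_by_simps g by (simp add: image_comp comp_def image_image)
  next
    fix U V c d \<sigma> \<sigma>' s
    assume b: "sorted_bij U c \<sigma> V d" and eq: "\<And>u. u \<in> U \<Longrightarrow> \<sigma> u = \<sigma>' u" and s: "s \<in> structs ?C U c"
    obtain P f g where sP: "s = (P, f, g)" by (cases s)
    note s = s[unfolded sP]
    have fin: "finite B" "B \<subseteq> U" if "B \<in> P" for B
      using partition_block[OF D(1)[OF s] that] sorted_bijD(1)[OF b] by auto
    have im: "\<sigma> ` B = \<sigma>' ` B" if "B \<in> P" for B using eq fin(2)[OF that] by (auto intro!: image_cong)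
    then have P: "(`) \<sigma> ` P = (`) \<sigma>' ` P" by auto
    have b': "sorted_bij U c \<sigma>' V d" by (rule sorted_bij_cong[OF b eq])
    have f: "transport F (blk ` P) (block_sorts \<kappa> g) (lift \<sigma>) f =
        transport F (blk ` P) (block_sorts \<kappa> g) (lift \<sigma>') f"
      by (rule is_speciesD(5)[OF F sb[OF b s] _ D(3)[OF s]]) (use fin im in auto)
    have g: "tr_fam G U c \<sigma> P g = tr_fam G U c \<sigma>' P g"
    proof (rule extensionalityI[of _ "(`) \<sigma> ` P"])
      show "tr_fam G U c \<sigma> P g \<in> extensional ((`) \<sigma> ` P)" "tr_fam G U c \<sigma>' P g \<in> extensional ((`) \<sigma> ` P)"
        unfolding tr_fam_def P by simp_all
      fix A assume "A \<in> (`) \<sigma> ` P"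
      then obtain B where B: "B \<in> P" "A = \<sigma> ` B" by auto
      have "transport G B c \<sigma> (g B) = transport G B c \<sigma>' (g B)"
        by (rule is_speciesD(5)[OF G sorted_bij_block[OF b fin(2)[OF B(1)]] _ D(4)[OF s B(1)]])
          (use eq fin(2)[OF B(1)] in auto)
      then show "tr_fam G U c \<sigma> P g A = tr_fam G U c \<sigma>' P g A"
        using tr_fam_app[OF b D(1)[OF s] B(1), of G g] tr_fam_app[OF b' D(1)[OF s] B(1), of G g]
          im[OF B(1)] B(2) by simp
    qed
    show "transport ?C U c \<sigma> s = transport ?C U c \<sigma>' s"
      unfolding sP sp_comp_by_simps f g P ..
  }
qed

section \<open>Marks of composites\<close>

definition inv_partitions :: "label set \<Rightarrow> (label \<Rightarrow> label) set \<Rightarrow> label set set set" where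
  "inv_partitions U H = {P. partition_on U P \<and> (\<forall>\<sigma>\<in>H. \<forall>B\<in>P. \<sigma> ` B \<in> P)}"

definition stab :: "(label \<Rightarrow> label) set \<Rightarrow> label set \<Rightarrow> (label \<Rightarrow> label) set" where
  "stab H B = {\<sigma>\<in>H. \<sigma> ` B = B}"

lemma inv_partitionsD:
  assumes "P \<in> inv_partitions U H"
  shows "partition_on U P" "\<sigma> \<in> H \<Longrightarrow> B \<in> P \<Longrightarrow> \<sigma> ` B \<in> P" "B \<in> P \<Longrightarrow> B \<subseteq> U" "B \<in> P \<Longrightarrow> B \<noteq> {}"
    "finite U \<Longrightarrow> finite P" "finite U \<Longrightarrow> B \<in> P \<Longrightarrow> finite B" "\<Union>P = U"
    "B \<in> P \<Longrightarrow> B' \<in> P \<Longrightarrow> x \<in> B \<Longrightarrow> x \<in> B' \<Longrightarrow> B = B'"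
proof -
  show P: "partition_on U P" using assms unfolding inv_partitions_def by auto
  show "\<sigma> \<in> H \<Longrightarrow> B \<in> P \<Longrightarrow> \<sigma> ` B \<in> P" using assms unfolding inv_partitions_def by auto
  show "B \<in> P \<Longrightarrow> B \<subseteq> U" "B \<in> P \<Longrightarrow> B \<noteq> {}" "finite U \<Longrightarrow> B \<in> P \<Longrightarrow> finite B"
    using partition_block[OF P] by auto
  show "finite U \<Longrightarrow> finite P" using finite_elements[OF _ P] .
  show "\<Union>P = U" "B \<in> P \<Longrightarrow> B' \<in> P \<Longrightarrow> x \<in> B \<Longrightarrow> x \<in> B' \<Longrightarrow> B = B'"
    using P unfolding partition_on_def disjoint_def by auto
qed

lemma finite_inv_partitions: "finite U \<Longrightarrow> finite (inv_partitions U H)"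
  unfolding inv_partitions_def by (rule finite_subset[OF _ finitely_many_partition_on]) auto

lemma group_acting_blocks:
  assumes H: "group_on U H" and P: "P \<in> inv_partitions U H"
  shows "group_acting H (`) P"
  using group_acting_subset[OF group_acting_Pow[OF group_onD(2)[OF H]], of P] inv_partitionsD(2,3)[OF P]
  by blast

lemma group_on_stab:
  assumes H: "group_on U H" and B: "B \<subseteq> U"
  shows "group_on B (stab H B)"
proof -
  interpret group_acting H "\<lambda>\<sigma>. \<sigma>" U using group_onD(2)[OF H] .
  have "group_acting (stab H B) (\<lambda>\<sigma>. \<sigma>) B"
  proof
    show "\<exists>\<iota>\<in>stab H B. \<forall>x\<in>B. \<iota> x = x"
    proof -
      obtain \<iota> where i: "\<iota> \<in> H" "\<forall>x\<in>U. \<iota> x = x" using neutral by blast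
      then have b: "\<forall>x\<in>B. \<iota> x = x" using B by auto
      then have "\<iota> ` B = B" by simp
      then show ?thesis using i b unfolding stab_def by blast
    qed
    show "\<exists>\<rho>\<in>stab H B. \<forall>x\<in>B. \<rho> x = \<sigma> (\<tau> x)" if k: "\<sigma> \<in> stab H B" "\<tau> \<in> stab H B" for \<sigma> \<tau>
    proof -
      obtain \<rho> where r: "\<rho> \<in> H" "\<forall>x\<in>U. \<rho> x = \<sigma> (\<tau> x)"
        using product[of \<sigma> \<tau>] k unfolding stab_def by blast
      then have b: "\<forall>x\<in>B. \<rho> x = \<sigma> (\<tau> x)" using B by auto
      then have "\<rho> ` B = \<sigma> ` \<tau> ` B" by (auto simp: image_image intro!: image_cong)
      then have "\<rho> ` B = B" using k unfolding stab_def by auto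
      then show ?thesis using r b unfolding stab_def by blast
    qed
    show "\<exists>\<rho>\<in>stab H B. \<forall>x\<in>B. \<rho> (\<sigma> x) = x" if k: "\<sigma> \<in> stab H B" for \<sigma>
    proof -
      obtain \<rho> where r: "\<rho> \<in> H" "\<forall>x\<in>U. \<rho> (\<sigma> x) = x"
        using inverse[of \<sigma>] k unfolding stab_def by blast
      have b: "\<forall>x\<in>B. \<rho> (\<sigma> x) = x" using B r by auto
      then have "\<rho> ` \<sigma> ` B = B" by (simp add: image_image)
      then have "\<rho> ` B = B" using k unfolding stab_def by auto
      then show ?thesis using r b unfolding stab_def by blast
    qed
  qed (auto simp: stab_def)
  then show ?thesis unfolding group_on_def using group_onD(1)[OF H] B finite_subset by auto
qed

lemma stab_stab: "C \<subseteq> B \<Longrightarrow> stab H C \<subseteq> stab H B \<Longrightarrow> stab (stab H B) C = stab H C"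
  unfolding stab_def by auto

lemma group_on_lift:
  assumes H: "group_on U H" and P: "P \<in> inv_partitions U H"
  shows "group_on (blk ` P) (lift ` H)"
proof -
  have U: "finite U" by (rule group_onD(1)[OF H])
  have "group_acting (lift ` H) (\<lambda>\<sigma>. \<sigma>) (blk ` P)"
    by (rule group_acting_image[OF group_acting_blocks[OF H P]]) (simp add: inv_partitionsD(6)[OF P U])
  then show ?thesis unfolding group_on_def using inv_partitionsD(5)[OF P U] by simp
qed

abbreviation block_fams where
  "block_fams G P c H \<equiv>
     eqv_fam H (`) P (\<lambda>B. structs G B c) (\<lambda>\<sigma> B. transport G B c \<sigma>)"

lemma bundle_acting_structs:
  assumes G: "is_species G" and H: "group_on U H" "keeps_sorts U c H" and P: "P \<in> inv_partitions U H"
  shows "bundle_acting H (`) P (\<lambda>B. structs G B c) (\<lambda>\<sigma> B. transport G B c \<sigma>)"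
proof -
  interpret U: group_acting H "\<lambda>\<sigma>. \<sigma>" U using group_onD(2)[OF H(1)] .
  interpret group_acting H "(`)" P by (rule group_acting_blocks[OF H(1) P])
  have sb: "sorted_bij B c \<sigma> (\<sigma> ` B) c" if "\<sigma> \<in> H" "B \<in> P" for \<sigma> B
    using sorted_bij_block[OF group_on_sorted_bij[OF H that(1)] inv_partitionsD(3)[OF P that(2)]] .
  have fin: "finite B" "B \<subseteq> U" if "B \<in> P" for B
    using inv_partitionsD(3,6)[OF P] group_onD(1)[OF H(1)] that by blast+
  have eqv: "\<rho> ` B = B \<and> transport G B c \<rho> s = s"
    if "B \<in> P" "s \<in> structs G B c" "\<forall>x\<in>U. \<rho> x = x" for \<rho> B s
  proof -
    have "\<forall>x\<in>B. \<rho> x = x" using that fin(2)[OF that(1)] by auto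
    then show ?thesis using transport_id_on[OF G fin(1)[OF that(1)] that(2), of \<rho>] by simp
  qed
  show ?thesis
  proof
    show "(case x of (B, a) \<Rightarrow> (\<sigma> ` B, transport G B c \<sigma> a)) \<in> (SIGMA B:P. structs G B c)"
      if "\<sigma> \<in> H" "x \<in> (SIGMA B:P. structs G B c)" for \<sigma> x
      using that closed is_speciesD(2)[OF G sb] by auto
    show "\<exists>\<iota>\<in>H. \<forall>x\<in>SIGMA B:P. structs G B c. (case x of (B, a) \<Rightarrow> (\<iota> ` B, transport G B c \<iota> a)) = x"
    proof -
      obtain \<iota> where i: "\<iota> \<in> H" "\<forall>x\<in>U. \<iota> x = x" using U.neutral by blast
      show ?thesis by (rule bexI[OF _ i(1)]) (use eqv i in fastforce)
    qed
    show "\<exists>\<rho>\<in>H. \<forall>x\<in>SIGMA B:P. structs G B c. (case x of (B, a) \<Rightarrow> (\<rho> ` B, transport G B c \<rho> a)) =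
        (case case x of (B, a) \<Rightarrow> (\<tau> ` B, transport G B c \<tau> a) of (B, a) \<Rightarrow> (\<sigma> ` B, transport G B c \<sigma> a))"
      if k: "\<sigma> \<in> H" "\<tau> \<in> H" for \<sigma> \<tau>
    proof -
      obtain \<rho> where r: "\<rho> \<in> H" "\<forall>x\<in>U. \<rho> x = \<sigma> (\<tau> x)" using U.product k by blast
      have "\<rho> ` B = \<sigma> ` \<tau> ` B \<and> transport G B c \<rho> s = transport G (\<tau> ` B) c \<sigma> (transport G B c \<tau> s)"
        if B: "B \<in> P" and s: "s \<in> structs G B c" for B s
      proof -
        have e: "\<forall>x\<in>B. \<rho> x = \<sigma> (\<tau> x)" using r(2) fin(2)[OF B] by auto
        have "transport G (\<tau> ` B) c \<sigma> (transport G B c \<tau> s) = transport G B c (\<sigma> \<circ> \<tau>) s"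
          by (rule is_speciesD(4)[OF G sb[OF k(2) B] sb[OF k(1) closed[OF k(2) B]] s])
        also have "\<dots> = transport G B c \<rho> s"
          by (rule is_speciesD(5)[OF G sorted_bij_comp[OF sb[OF k(2) B] sb[OF k(1) closed[OF k(2) B]]] _ s])
            (use e in auto)
        finally show ?thesis using e by (auto simp: image_image intro!: image_cong)
      qed
      then show ?thesis by (intro bexI[OF _ r(1)]) auto
    qed
    show "\<exists>\<rho>\<in>H. \<forall>x\<in>SIGMA B:P. structs G B c.
        (case case x of (B, a) \<Rightarrow> (\<sigma> ` B, transport G B c \<sigma> a) of (B, a) \<Rightarrow> (\<rho> ` B, transport G B c \<rho> a)) = x"
      if k: "\<sigma> \<in> H" for \<sigma>
    proof -
      obtain \<rho> where r: "\<rho> \<in> H" "\<forall>x\<in>U. \<rho> (\<sigma> x) = x" using U.inverse k by blast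
      have "\<rho> ` \<sigma> ` B = B \<and> transport G (\<sigma> ` B) c \<rho> (transport G B c \<sigma> s) = s"
        if B: "B \<in> P" and s: "s \<in> structs G B c" for B s
      proof -
        have e: "\<forall>x\<in>B. \<rho> (\<sigma> x) = x" using r(2) fin(2)[OF B] by auto
        have "transport G (\<sigma> ` B) c \<rho> (transport G B c \<sigma> s) = transport G B c (\<rho> \<circ> \<sigma>) s"
          by (rule is_speciesD(4)[OF G sb[OF k B] sb[OF r(1) closed[OF k B]] s])
        also have "\<dots> = s" by (rule transport_id_on[OF G fin(1)[OF B] s]) (use e in auto)
        finally show ?thesis using e by (simp add: image_image)
      qed
      then show ?thesis by (intro bexI[OF _ r(1)]) auto
    qed
  qed
qed

lemma stab_fixed_structs:
  "stab_fixed H (`) (\<lambda>B. structs G B c) (\<lambda>\<sigma> B. transport G B c \<sigma>) B = fixed_structs G B c (stab H B)"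
  unfolding stab_fixed_def fixed_structs_def stab_def by auto

lemma block_sorts_keeps:
  assumes k: "sort_invariant \<kappa> G" and H: "group_on U H" "keeps_sorts U c H"
    and P: "P \<in> inv_partitions U H" and g: "g \<in> block_fams G P c H"
  shows "keeps_sorts (blk ` P) (block_sorts \<kappa> g) (lift ` H)"
proof -
  have "\<kappa> (g (\<sigma> ` B)) = \<kappa> (g B)" if "\<sigma> \<in> H" "B \<in> P" for \<sigma> B
  proof -
    have "sorted_bij B c \<sigma> (\<sigma> ` B) c"
      using sorted_bij_block[OF group_on_sorted_bij[OF H that(1)] inv_partitionsD(3)[OF P that(2)]] .
    moreover have "g B \<in> structs G B c" "g (\<sigma> ` B) = transport G B c \<sigma> (g B)"
      using g that unfolding eqv_fam_def by auto
    ultimately show ?thesis using k unfolding sort_invariant_def by metis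
  qed
  then show ?thesis
    unfolding keeps_sorts_def block_sorts_def
    using inv_partitionsD(6)[OF P group_onD(1)[OF H(1)]] by auto
qed

text \<open>Being fixed by \<open>\<sigma>\<close> means three things: \<open>\<sigma>\<close> permutes the blocks, the structures on the blocks
correspond under \<open>\<sigma>\<close>, and the structure on the set of blocks is fixed by the induced permutation.\<close>

lemma fixed_structs_comp_by:
  assumes H: "group_on U H" "keeps_sorts U c H"
  shows "fixed_structs (sp_comp_by \<kappa> F G) U c H =
    (\<lambda>(P, g, f). (P, f, g)) ` (SIGMA P:inv_partitions U H. SIGMA g:block_fams G P c H.
       fixed_structs F (blk ` P) (block_sorts \<kappa> g) (lift ` H))" (is "_ = _ ` ?S")
proof -
  have sb: "sorted_bij U c \<sigma> U c" if "\<sigma> \<in> H" for \<sigma> using group_on_sorted_bij[OF H that] .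
  have "(P, f, g) \<in> fixed_structs (sp_comp_by \<kappa> F G) U c H \<longleftrightarrow> (P, g, f) \<in> ?S" for P f g
  proof (cases "partition_on U P \<and> g \<in> (\<Pi>\<^sub>E B\<in>P. structs G B c)")
    case True
    then have P: "partition_on U P" and g: "g \<in> (\<Pi>\<^sub>E B\<in>P. structs G B c)" by auto
    have fP: "finite P" using finite_elements[OF group_onD(1)[OF H(1)] P] .
    have im: "(`) \<sigma> ` P = P \<longleftrightarrow> (\<forall>B\<in>P. \<sigma> ` B \<in> P)" if "\<sigma> \<in> H" for \<sigma>
    proof
      assume "\<forall>B\<in>P. \<sigma> ` B \<in> P"
      moreover have "inj_on ((`) \<sigma>) P"
        using inj_on_image[of \<sigma> P] group_onD(4)[OF H(1) that] P unfolding partition_on_def by simp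
      ultimately show "(`) \<sigma> ` P = P" using fP by (simp add: endo_inj_surj image_subset_iff)
    qed auto
    have tr: "tr_fam G U c \<sigma> P g = g \<longleftrightarrow> (\<forall>B\<in>P. g (\<sigma> ` B) = transport G B c \<sigma> (g B))"
      if s: "\<sigma> \<in> H" and e: "(`) \<sigma> ` P = P" for \<sigma>
    proof
      assume *: "tr_fam G U c \<sigma> P g = g"
      show "\<forall>B\<in>P. g (\<sigma> ` B) = transport G B c \<sigma> (g B)"
      proof
        fix B assume B: "B \<in> P"
        show "g (\<sigma> ` B) = transport G B c \<sigma> (g B)"
          using tr_fam_app[OF sb[OF s] P B, of G g] unfolding * .
      qed
    next
      assume *: "\<forall>B\<in>P. g (\<sigma> ` B) = transport G B c \<sigma> (g B)"
      show "tr_fam G U c \<sigma> P g = g"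
      proof (rule extensionalityI[of _ P])
        show "tr_fam G U c \<sigma> P g \<in> extensional P"
          using e unfolding tr_fam_def by (metis restrict_extensional)
        show "g \<in> extensional P" using g by (auto simp: PiE_def)
        fix A assume "A \<in> P"
        then obtain B where B: "B \<in> P" "A = \<sigma> ` B" using e by blast
        then show "tr_fam G U c \<sigma> P g A = g A" using tr_fam_app[OF sb[OF s] P, of B G g] * by auto
      qed
    qed
    have "(\<forall>\<sigma>\<in>H. (`) \<sigma> ` P = P \<and> transport F (blk ` P) (block_sorts \<kappa> g) (lift \<sigma>) f = f \<and>
        tr_fam G U c \<sigma> P g = g) \<longleftrightarrow>
      (\<forall>\<sigma>\<in>H. \<forall>B\<in>P. \<sigma> ` B \<in> P) \<and> (\<forall>\<sigma>\<in>H. \<forall>B\<in>P. g (\<sigma> ` B) = transport G B c \<sigma> (g B)) \<and>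
      (\<forall>\<sigma>\<in>H. transport F (blk ` P) (block_sorts \<kappa> g) (lift \<sigma>) f = f)"
      using im tr by meson
    then show ?thesis
      using P g unfolding fixed_structs_def eqv_fam_def inv_partitions_def
      by (auto simp: sp_comp_by_simps)
  next
    case False
    then show ?thesis
      unfolding fixed_structs_def eqv_fam_def inv_partitions_def by (auto simp: sp_comp_by_simps)
  qed
  then show ?thesis by (auto simp: image_iff)
qed

lemma finite_block_fams:
  assumes G: "is_species G" and U: "finite U" and P: "P \<in> inv_partitions U H"
  shows "finite (block_fams G P c H)"
proof -
  have "finite (\<Pi>\<^sub>E B\<in>P. structs G B c)"
    using inv_partitionsD(5,6)[OF P U] is_speciesD(1)[OF G] by (intro finite_PiE) auto
  then show ?thesis unfolding eqv_fam_def by (rule rev_finite_subset) auto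
qed

lemma mark_comp_by:
  assumes F: "is_species F" and G: "is_species G"
    and H: "group_on U H" "keeps_sorts U c H"
  shows "mark (sp_comp_by \<kappa> F G) U c H =
    (\<Sum>P\<in>inv_partitions U H. \<Sum>g\<in>block_fams G P c H.
       mark F (blk ` P) (block_sorts \<kappa> g) (lift ` H))"
proof -
  have U: "finite U" using group_onD(1)[OF H(1)] .
  have finF: "finite (fixed_structs F (blk ` P) (block_sorts \<kappa> g) (lift ` H))"
    if "P \<in> inv_partitions U H" for P g
    using inv_partitionsD(5)[OF that U] by (intro finite_fixed[OF F]) auto
  have "mark (sp_comp_by \<kappa> F G) U c H = int (card (SIGMA P:inv_partitions U H. SIGMA g:block_fams G P c H.
       fixed_structs F (blk ` P) (block_sorts \<kappa> g) (lift ` H)))"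
    unfolding mark_def fixed_structs_comp_by[OF H] 
    by (subst card_image) (auto simp: inj_on_def)
  also have "\<dots> = (\<Sum>P\<in>inv_partitions U H. \<Sum>g\<in>block_fams G P c H.
       int (card (fixed_structs F (blk ` P) (block_sorts \<kappa> g) (lift ` H))))"
    using finite_inv_partitions[OF U] finite_block_fams[OF G U] finF
    by (simp add: card_SigmaI)
  finally show ?thesis unfolding mark_def .
qed

lemma orbit_prod_one: "orbit_prod H act S (\<lambda>x. 1) = 1"
  unfolding orbit_prod_def by simp

lemma sum_block_fams:
  assumes G: "is_species G" and H: "group_on U H" "keeps_sorts U c H" and P: "P \<in> inv_partitions U H"
  shows "(\<Sum>g\<in>block_fams G P c H. orbit_prod H (`) P (\<lambda>B. \<phi> B (g B))) =
    orbit_prod H (`) P (\<lambda>B. \<Sum>s\<in>fixed_structs G B c (stab H B). \<phi> B s)"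
  using bundle_acting.sum_eqv_fam[OF bundle_acting_structs[OF G H P], of \<phi>]
    inv_partitionsD(5,6)[OF P group_onD(1)[OF H(1)]] is_speciesD(1)[OF G]
  unfolding stab_fixed_structs by simp

lemma card_block_fams:
  assumes G: "is_species G" and H: "group_on U H" "keeps_sorts U c H" and P: "P \<in> inv_partitions U H"
  shows "int (card (block_fams G P c H)) = orbit_prod H (`) P (\<lambda>B. mark G B c (stab H B))"
  using sum_block_fams[OF G H P, of "\<lambda>_ _. 1"] unfolding orbit_prod_one mark_def by simp

section \<open>Substituting a difference\<close>

definition inv_subsets :: "label set \<Rightarrow> (label \<Rightarrow> label) set \<Rightarrow> label set set" where
  "inv_subsets Y H = {A. A \<subseteq> Y \<and> (\<forall>\<sigma>\<in>H. \<sigma> ` A = A)}"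

text \<open>The chains of subsets of \<open>Y\<close> that contain \<open>{}\<close> and \<open>Y\<close>.  The differences of consecutive members
form an ordered partition of \<open>Y\<close> into nonempty blocks.  Such partitions, with sign \<open>-1\<close> for each
block, are the virtual species \<open>1 / \<E>(Y)\<close>, where \<open>\<E>\<close> is the species of sets.\<close>

definition flags :: "label set \<Rightarrow> label set set set" where
  "flags Y = {C. C \<subseteq> Pow Y \<and> {} \<in> C \<and> Y \<in> C \<and> (\<forall>A\<in>C. \<forall>B\<in>C. A \<subseteq> B \<or> B \<subseteq> A)}"

definition Y_part :: "label set \<Rightarrow> (label \<Rightarrow> two_sorts) \<Rightarrow> label set" where
  "Y_part U c = {u\<in>U. c u = Sort_Y}"

lemma finite_flags: "finite Y \<Longrightarrow> finite (flags Y)"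
  unfolding flags_def by (rule finite_subset[of _ "Pow (Pow Y)"]) auto

lemma flags_image:
  assumes "C \<in> flags Y"
  shows "(`) \<sigma> ` C \<in> flags (\<sigma> ` Y)"
proof -
  have C: "C \<subseteq> Pow Y" "{} \<in> C" "Y \<in> C" "\<And>A B. A \<in> C \<Longrightarrow> B \<in> C \<Longrightarrow> A \<subseteq> B \<or> B \<subseteq> A"
    using assms unfolding flags_def by auto
  have "\<sigma> ` A \<subseteq> \<sigma> ` B \<or> \<sigma> ` B \<subseteq> \<sigma> ` A" if "A \<in> C" "B \<in> C" for A B
    using C(4)[OF that] by (meson image_mono)
  moreover have "(`) \<sigma> ` C \<subseteq> Pow (\<sigma> ` Y)" using C(1) by blast
  moreover have "{} \<in> (`) \<sigma> ` C" "\<sigma> ` Y \<in> (`) \<sigma> ` C" using C(2,3) by force+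
  ultimately show ?thesis unfolding flags_def by auto
qed

text \<open>The virtual species \<open>F(X - Y)\<close> is the Cartesian product of \<open>F(X + Y)\<close> and \<open>\<E>(X) / \<E>(Y)\<close>.  A
chain of odd size has an even number of steps and counts positively, so \<open>p = True\<close> gives the
positive part and \<open>p = False\<close> the negative part.\<close>

definition with_flag :: "(unit, 'a) species \<Rightarrow> bool \<Rightarrow> (two_sorts, 'a \<times> label set set) species" where
  "with_flag F p =
     \<lparr> structs = (\<lambda>U c. structs F U (\<lambda>_. ()) \<times> {C\<in>flags (Y_part U c). odd (card C) = p}),
       transport = (\<lambda>U c \<sigma> (f, C). (transport F U (\<lambda>_. ()) \<sigma> f, (`) ((`) \<sigma>) C)) \<rparr>"

lemma is_species_with_flag:
  assumes F: "is_species F"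
  shows "is_species (with_flag F p)"
proof (rule is_speciesI)
  fix U :: "label set" and c :: "label \<Rightarrow> two_sorts" assume U: "finite U"
  have "finite (Y_part U c)" using U unfolding Y_part_def by auto
  then show "finite (structs (with_flag F p) U c)"
    unfolding with_flag_def using is_speciesD(1)[OF F U] finite_flags by auto
next
  fix U V c d \<sigma> s
  assume b: "sorted_bij U c \<sigma> V d" and s: "s \<in> structs (with_flag F p) U c"
  have b': "sorted_bij U (\<lambda>_. ()) \<sigma> V (\<lambda>_. ())" using b unfolding sorted_bij_def by auto
  have Y: "\<sigma> ` Y_part U c = Y_part V d"
    using sorted_bijD(5,6)[OF b] unfolding Y_part_def by force
  obtain f C where sf: "s = (f, C)" by (cases s)
  have C: "C \<in> flags (Y_part U c)" and f: "f \<in> structs F U (\<lambda>_. ())" and p: "odd (card C) = p"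
    using s unfolding sf with_flag_def by auto
  have "C \<subseteq> Pow U" using C unfolding flags_def Y_part_def by auto
  then have "inj_on ((`) \<sigma>) C"
    using sorted_bijD(4)[OF b] by (metis inj_on_image_Pow inj_on_subset)
  then have "card ((`) \<sigma> ` C) = card C" by (rule card_image)
  then show "transport (with_flag F p) U c \<sigma> s \<in> structs (with_flag F p) V d"
    using flags_image[OF C, of \<sigma>] is_speciesD(2)[OF F b' f] p unfolding sf with_flag_def Y by simp
next
  fix U :: "label set" and c s
  assume "finite U" "s \<in> structs (with_flag F p) U c"
  then show "transport (with_flag F p) U c id s = s"
    using is_speciesD(3)[OF F] unfolding with_flag_def by auto
next
  fix U V W c d e \<sigma> \<tau> s
  assume b: "sorted_bij U c \<sigma> V d" "sorted_bij V d \<tau> W e" and s: "s \<in> structs (with_flag F p) U c"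
  have b': "sorted_bij U (\<lambda>_. ()) \<sigma> V (\<lambda>_. ())" "sorted_bij V (\<lambda>_. ()) \<tau> W (\<lambda>_. ())"
    using b unfolding sorted_bij_def by auto
  show "transport (with_flag F p) U c (\<tau> \<circ> \<sigma>) s =
      transport (with_flag F p) V d \<tau> (transport (with_flag F p) U c \<sigma> s)"
    using s is_speciesD(4)[OF F b'] unfolding with_flag_def by (auto simp: image_image image_comp)
next
  fix U V c d \<sigma> \<sigma>' s
  assume b: "sorted_bij U c \<sigma> V d" and eq: "\<And>u. u \<in> U \<Longrightarrow> \<sigma> u = \<sigma>' u"
    and s: "s \<in> structs (with_flag F p) U c"
  have b': "sorted_bij U (\<lambda>_. ()) \<sigma> V (\<lambda>_. ())" using b unfolding sorted_bij_def by auto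
  obtain f C where sf: "s = (f, C)" by (cases s)
  have f: "f \<in> structs F U (\<lambda>_. ())" and "C \<subseteq> Pow U"
    using s unfolding sf with_flag_def flags_def Y_part_def by auto
  then have "\<forall>A\<in>C. \<sigma> ` A = \<sigma>' ` A" using eq by (auto intro!: image_cong)
  then have "(`) ((`) \<sigma>) C = (`) ((`) \<sigma>') C" by (auto intro!: image_cong)
  then show "transport (with_flag F p) U c \<sigma> s = transport (with_flag F p) U c \<sigma>' s"
    using is_speciesD(5)[OF F b' _ f] eq unfolding sf with_flag_def by auto
qed

text \<open>The members of a chain have distinct cardinalities, so a permutation that maps the chain to itself
maps every member to itself.\<close>

lemma flag_fixed:
  assumes C: "C \<in> flags Y" and Y: "finite Y" "inj_on \<sigma> Y"
  shows "(`) \<sigma> ` C = C \<longleftrightarrow> (\<forall>A\<in>C. \<sigma> ` A = A)"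
proof
  assume e: "(`) \<sigma> ` C = C"
  show "\<forall>A\<in>C. \<sigma> ` A = A"
  proof
    fix A assume A: "A \<in> C"
    then have "\<sigma> ` A \<in> C" using e by blast
    then have "\<sigma> ` A \<subseteq> A \<or> A \<subseteq> \<sigma> ` A" using C A unfolding flags_def by blast
    moreover have AY: "A \<subseteq> Y" using C A unfolding flags_def by blast
    then have "card (\<sigma> ` A) = card A" using Y(2) by (meson card_image inj_on_subset)
    moreover have "finite A" using AY Y(1) finite_subset by blast
    ultimately show "\<sigma> ` A = A" by (metis card_subset_eq finite_imageI)
  qed
qed (auto simp: image_iff)

definition inv_flags where
  "inv_flags Y H p = {C\<in>flags Y. odd (card C) = p \<and> (\<forall>\<sigma>\<in>H. \<forall>A\<in>C. \<sigma> ` A = A)}"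

lemma mark_with_flag:
  assumes H: "group_on U H"
  shows "mark (with_flag F p) U c H = mark F U (\<lambda>_. ()) H * int (card (inv_flags (Y_part U c) H p))"
proof -
  have Y: "finite (Y_part U c)" "\<And>\<sigma>. \<sigma> \<in> H \<Longrightarrow> inj_on \<sigma> (Y_part U c)"
    using group_onD(1,4)[OF H] unfolding Y_part_def by (auto intro: inj_on_subset)
  have "fixed_structs (with_flag F p) U c H =
      fixed_structs F U (\<lambda>_. ()) H \<times> inv_flags (Y_part U c) H p"
  proof -
    have "(\<forall>\<sigma>\<in>H. (`) \<sigma> ` C = C) \<longleftrightarrow> (\<forall>\<sigma>\<in>H. \<forall>A\<in>C. \<sigma> ` A = A)" if "C \<in> flags (Y_part U c)" for C
      using flag_fixed[OF that Y] by (intro ball_cong refl)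
    moreover have "fixed_structs (with_flag F p) U c H = {(f, C). f \<in> fixed_structs F U (\<lambda>_. ()) H \<and>
        C \<in> flags (Y_part U c) \<and> odd (card C) = p \<and> (\<forall>\<sigma>\<in>H. (`) \<sigma> ` C = C)}"
      unfolding fixed_structs_def with_flag_def by auto
    then have "fixed_structs (with_flag F p) U c H = fixed_structs F U (\<lambda>_. ()) H \<times>
        {C \<in> flags (Y_part U c). odd (card C) = p \<and> (\<forall>\<sigma>\<in>H. (`) \<sigma> ` C = C)}" by auto
    moreover have "inv_flags (Y_part U c) H p =
        {C \<in> flags (Y_part U c). odd (card C) = p \<and> (\<forall>\<sigma>\<in>H. (`) \<sigma> ` C = C)}"
      unfolding inv_flags_def using calculation(1) by (metis (no_types, lifting))
    ultimately show ?thesis by simp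
  qed
  then show ?thesis unfolding mark_def by (simp add: card_cartesian_product)
qed

lemma finite_inv_subsets: "finite Y \<Longrightarrow> finite (inv_subsets Y H)"
  unfolding inv_subsets_def by auto

text \<open>The union over \<open>A\<close> of the flags of \<open>A\<close> consists of all chains of invariant subsets of \<open>Y\<close> that
contain \<open>{}\<close>.  If \<open>Y\<close> is nonempty, adding or removing \<open>Y\<close> pairs these chains with opposite signs.\<close>

lemma sum_inv_flags:
  assumes Y: "finite Y" "Y \<in> inv_subsets Y H"
  shows "(\<Sum>A\<in>inv_subsets Y H. int (card (inv_flags A H True)) - int (card (inv_flags A H False))) =
    of_bool (Y = {})"
proof -
  define s :: "label set set \<Rightarrow> int" where "s C = (if odd (card C) then 1 else -1)" for C
  define I where "I A = {C\<in>flags A. \<forall>\<sigma>\<in>H. \<forall>A\<in>C. \<sigma> ` A = A}" for A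
  have finI: "finite (I A)" if "A \<subseteq> Y" for A
    unfolding I_def using finite_flags[OF finite_subset[OF that Y(1)]] by auto
  have "int (card (inv_flags A H True)) - int (card (inv_flags A H False)) = sum s (I A)"
    if "A \<subseteq> Y" for A
  proof -
    have f: "finite (inv_flags A H q)" for q
      using finI[OF that] unfolding I_def inv_flags_def by (auto intro: rev_finite_subset)
    have "I A = inv_flags A H True \<union> inv_flags A H False" unfolding I_def inv_flags_def by auto
    then have "sum s (I A) = sum s (inv_flags A H True) + sum s (inv_flags A H False)"
      using sum.union_disjoint[OF f f, of True False s] by (auto simp: inv_flags_def)
    moreover have "sum s (inv_flags A H True) = sum (\<lambda>_. 1) (inv_flags A H True)"
      by (rule sum.cong) (auto simp: inv_flags_def s_def)
    moreover have "sum s (inv_flags A H False) = sum (\<lambda>_. -1) (inv_flags A H False)"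
      by (rule sum.cong) (auto simp: inv_flags_def s_def)
    ultimately show ?thesis by simp
  qed
  then have "(\<Sum>A\<in>inv_subsets Y H. int (card (inv_flags A H True)) - int (card (inv_flags A H False))) =
      (\<Sum>A\<in>inv_subsets Y H. sum s (I A))"
    by (intro sum.cong) (auto simp: inv_subsets_def)
  also have "\<dots> = sum s (\<Union>A\<in>inv_subsets Y H. I A)"
  proof (rule sum.UNION_disjoint[symmetric])
    show "\<forall>A\<in>inv_subsets Y H. \<forall>B\<in>inv_subsets Y H. A \<noteq> B \<longrightarrow> I A \<inter> I B = {}"
    proof (intro ballI impI)
      fix A B assume "A \<in> inv_subsets Y H" "B \<in> inv_subsets Y H" "A \<noteq> B"
      have "A = B" if "C \<in> flags A" "C \<in> flags B" for C
        using that unfolding flags_def by auto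
      then show "I A \<inter> I B = {}" using \<open>A \<noteq> B\<close> unfolding I_def by auto
    qed
  qed (use finI finite_inv_subsets[OF Y(1)] in \<open>auto simp: inv_subsets_def\<close>)
  also have "\<dots> = of_bool (Y = {})"
  proof (cases "Y = {}")
    case True
    have "flags {} = {{{}}}" unfolding flags_def by auto
    then have "I {} = {{{}}}" unfolding I_def by auto
    moreover have "inv_subsets {} H = {{}}" unfolding inv_subsets_def by auto
    ultimately show ?thesis using True by (simp add: s_def)
  next
    case False
    define J where "J = (\<Union>A\<in>inv_subsets Y H. I A)"
    have J: "C \<in> J \<longleftrightarrow> C \<subseteq> inv_subsets Y H \<and> {} \<in> C \<and> (\<forall>A\<in>C. \<forall>B\<in>C. A \<subseteq> B \<or> B \<subseteq> A)" for C
    proof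
      assume "C \<in> J"
      then show "C \<subseteq> inv_subsets Y H \<and> {} \<in> C \<and> (\<forall>A\<in>C. \<forall>B\<in>C. A \<subseteq> B \<or> B \<subseteq> A)"
      proof -
        obtain A where A: "A \<subseteq> Y" and C: "C \<in> I A"
          using \<open>C \<in> J\<close> unfolding J_def inv_subsets_def by auto
        have CA: "C \<subseteq> Pow A" "{} \<in> C" "\<forall>A\<in>C. \<forall>B\<in>C. A \<subseteq> B \<or> B \<subseteq> A"
          using C unfolding I_def flags_def by simp_all
        have inv: "\<sigma> ` B = B" if "B \<in> C" "\<sigma> \<in> H" for B \<sigma> using C that unfolding I_def by simp
        have "B \<in> inv_subsets Y H" if B: "B \<in> C" for B
        proof -
          have "B \<subseteq> Y" using subsetD[OF CA(1) B] A by simp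
          then show ?thesis unfolding inv_subsets_def using inv[OF B] by simp
        qed
        then have "C \<subseteq> inv_subsets Y H" by (rule subsetI)
        then show ?thesis using CA(2,3) by simp
      qed
    next
      assume "C \<subseteq> inv_subsets Y H \<and> {} \<in> C \<and> (\<forall>A\<in>C. \<forall>B\<in>C. A \<subseteq> B \<or> B \<subseteq> A)"
      then have CI: "C \<subseteq> inv_subsets Y H" and C0: "{} \<in> C"
        and ch: "\<forall>A\<in>C. \<forall>B\<in>C. A \<subseteq> B \<or> B \<subseteq> A" by simp_all
      then have "finite C" "C \<noteq> {}" using C0 finite_subset[OF CI finite_inv_subsets[OF Y(1)]] by auto
      then obtain A where A: "A \<in> C" "\<forall>B\<in>C. A \<subseteq> B \<longrightarrow> A = B"
        using finite_has_maximal[of C] by auto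
      have "B \<subseteq> A" if "B \<in> C" for B
        using bspec[OF bspec[OF ch A(1)] that] bspec[OF A(2) that] by auto
      then have "C \<in> flags A" using C0 ch A(1) unfolding flags_def by auto
      moreover have "\<sigma> ` B = B" if "B \<in> C" "\<sigma> \<in> H" for B \<sigma>
        using subsetD[OF CI that(1)] that(2) unfolding inv_subsets_def by simp
      ultimately have "C \<in> I A" unfolding I_def by simp
      then show "C \<in> J" unfolding J_def using subsetD[OF CI A(1)] by (rule UN_I[rotated])
    qed
    have finJ: "finite J" unfolding J_def using finI finite_inv_subsets[OF Y(1)] by (auto simp: inv_subsets_def)
    have finC: "finite C" if "C \<in> J" for C
      using that J finite_inv_subsets[OF Y(1)] finite_subset by metis
    have "sum s J = sum s {C\<in>J. Y \<in> C} + sum s {C\<in>J. Y \<notin> C}"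
      by (subst sum.union_disjoint[symmetric]) (use finJ in \<open>auto intro!: sum.cong\<close>)
    also have "sum s {C\<in>J. Y \<in> C} = (\<Sum>C\<in>{C\<in>J. Y \<notin> C}. - s C)"
    proof (rule sum.reindex_bij_witness[where i = "insert Y" and j = "\<lambda>C. C - {Y}"])
      fix C assume C: "C \<in> {C\<in>J. Y \<in> C}"
      then show "C - {Y} \<in> {C\<in>J. Y \<notin> C}" using False unfolding J by blast
      show "insert Y (C - {Y}) = C" using C by auto
      show "- s (C - {Y}) = s C"
      proof -
        have "Suc (card (C - {Y})) = card C" using C finC[of C] by (intro card_Suc_Diff1) auto
        then have "odd (card C) \<longleftrightarrow> even (card (C - {Y}))" by (metis even_Suc)
        then show ?thesis unfolding s_def by simp
      qed
    next
      fix C assume C: "C \<in> {C\<in>J. Y \<notin> C}"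
      then have "C \<subseteq> Pow Y" unfolding J inv_subsets_def by auto
      then show "insert Y C \<in> {C\<in>J. Y \<in> C}" using C Y(2) unfolding J by blast
      show "insert Y C - {Y} = C" using C by auto
    qed
    finally show ?thesis using False unfolding J_def by (simp add: sum_negf)
  qed
  finally show ?thesis .
qed

text \<open>An invariant subset of \<open>Y\<close> is the choice, for each orbit in \<open>Y\<close>, of whether to take it.  The sum
is therefore a product with a factor \<open>1 - 1\<close> for each orbit in \<open>Y\<close>.\<close>

lemma sum_orbit_signs:
  assumes H: "group_on U H" and Y: "Y \<in> inv_subsets U H"
  shows "(\<Sum>A\<in>inv_subsets Y H. orbit_prod H (\<lambda>\<sigma>. \<sigma>) U (\<lambda>u. if u \<in> A then -1 else 1)) = of_bool (Y = {})"
proof -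
  interpret group_acting H "\<lambda>\<sigma>. \<sigma>" U using group_onD(2)[OF H] .
  have YU: "Y \<subseteq> U" and YH: "\<And>\<sigma>. \<sigma> \<in> H \<Longrightarrow> \<sigma> ` Y = Y" using Y unfolding inv_subsets_def by auto
  have mem: "\<sigma> u \<in> A \<longleftrightarrow> u \<in> A" if "\<sigma> \<in> H" "u \<in> U" "A \<subseteq> U" "\<sigma> ` A = A" for \<sigma> u A
    using that act_inj[OF that(1) that(2)] by (metis image_eqI image_iff subsetD)
  let ?A = "\<lambda>u. if u \<in> Y then UNIV else {False}" and ?tr = "\<lambda>\<sigma> u b. b"
  interpret bundle_acting H "\<lambda>\<sigma>. \<sigma>" U ?A ?tr
  proof
    show "(case x of (u, a) \<Rightarrow> (\<sigma> u, a)) \<in> Sigma U ?A" if "\<sigma> \<in> H" "x \<in> Sigma U ?A" for \<sigma> x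
      using that closed mem[of \<sigma> _ Y] YU YH by (auto split: if_splits)
    show "\<exists>\<iota>\<in>H. \<forall>x\<in>Sigma U ?A. (case x of (u, a) \<Rightarrow> (\<iota> u, a)) = x"
      using neutral by fastforce
    show "\<exists>\<rho>\<in>H. \<forall>x\<in>Sigma U ?A. (case x of (u, a) \<Rightarrow> (\<rho> u, a)) =
        (case case x of (u, a) \<Rightarrow> (\<tau> u, a) of (u, a) \<Rightarrow> (\<sigma> u, a))"
      if "\<sigma> \<in> H" "\<tau> \<in> H" for \<sigma> \<tau>
      using product[OF that] by fastforce
    show "\<exists>\<rho>\<in>H. \<forall>x\<in>Sigma U ?A. (case case x of (u, a) \<Rightarrow> (\<sigma> u, a) of (u, a) \<Rightarrow> (\<rho> u, a)) = x"
      if "\<sigma> \<in> H" for \<sigma>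
      using inverse[OF that] by fastforce
  qed
  have "(\<Sum>A\<in>inv_subsets Y H. orbit_prod H (\<lambda>\<sigma>. \<sigma>) U (\<lambda>u. if u \<in> A then -1 else 1)) =
      (\<Sum>g\<in>eqv_fam H (\<lambda>\<sigma>. \<sigma>) U ?A ?tr. orbit_prod H (\<lambda>\<sigma>. \<sigma>) U (\<lambda>u. if g u then -1 else 1))"
  proof (rule sum.reindex_bij_witness[where i = "\<lambda>g. {u\<in>U. g u}" and j = "\<lambda>A. \<lambda>u\<in>U. u \<in> A"])
    fix A assume A: "A \<in> inv_subsets Y H"
    then have AU: "A \<subseteq> U" using YU unfolding inv_subsets_def by auto
    show "{u\<in>U. (\<lambda>u\<in>U. u \<in> A) u} = A" using AU by auto
    show "(\<lambda>u\<in>U. u \<in> A) \<in> eqv_fam H (\<lambda>\<sigma>. \<sigma>) U ?A ?tr"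
      using A AU mem closed unfolding eqv_fam_def inv_subsets_def by auto
    show "orbit_prod H (\<lambda>\<sigma>. \<sigma>) U (\<lambda>u. if (\<lambda>u\<in>U. u \<in> A) u then -1 else 1) =
        orbit_prod H (\<lambda>\<sigma>. \<sigma>) U (\<lambda>u. if u \<in> A then -1 else 1)"
      by (rule orbit_prod_cong) (use group_acting_axioms in auto)
  next
    fix g assume g: "g \<in> eqv_fam H (\<lambda>\<sigma>. \<sigma>) U ?A ?tr"
    have gY: "u \<in> Y" if "u \<in> U" "g u" for u
    proof (rule ccontr)
      assume "u \<notin> Y"
      then have "g u \<in> {False}" using g that unfolding eqv_fam_def by (auto simp: PiE_iff split: if_splits)
      then show False using that by simp
    qed
    have ge: "g (\<sigma> u) = g u" if "\<sigma> \<in> H" "u \<in> U" for \<sigma> u using g that unfolding eqv_fam_def by auto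
    have "\<sigma> ` {u\<in>U. g u} = {u\<in>U. g u}" if s: "\<sigma> \<in> H" for \<sigma>
    proof
      show "\<sigma> ` {u\<in>U. g u} \<subseteq> {u\<in>U. g u}" using ge[OF s] closed[OF s] by auto
      show "{u\<in>U. g u} \<subseteq> \<sigma> ` {u\<in>U. g u}"
        using ge[OF s] group_onD(5)[OF H s] by (auto simp: image_iff) (metis imageE)
    qed
    then show "{u\<in>U. g u} \<in> inv_subsets Y H" using gY unfolding inv_subsets_def by auto
    show "(\<lambda>u\<in>U. u \<in> {u\<in>U. g u}) = g"
      using g unfolding eqv_fam_def by (auto simp: PiE_def extensional_def restrict_def fun_eq_iff)
  qed
  also have "\<dots> = orbit_prod H (\<lambda>\<sigma>. \<sigma>) U
      (\<lambda>u. \<Sum>b\<in>stab_fixed H (\<lambda>\<sigma>. \<sigma>) ?A ?tr u. if b then -1 else 1)"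
    by (rule sum_eqv_fam) (use group_onD(1)[OF H] in auto)
  also have "\<dots> = orbit_prod H (\<lambda>\<sigma>. \<sigma>) U (\<lambda>u. of_bool (u \<notin> Y))"
    by (rule orbit_prod_cong) (auto simp: group_acting_axioms stab_fixed_def UNIV_bool)
  also have "\<dots> = of_bool (Y = {})"
  proof (cases "Y = {}")
    case True then show ?thesis by (simp add: orbit_prod_one)
  next
    case False
    then obtain y where y: "y \<in> Y" by auto
    then obtain t \<sigma> where t: "t \<in> transv H (\<lambda>\<sigma>. \<sigma>) U" "\<sigma> \<in> H" "\<sigma> t = y"
      using transv YU unfolding transversal_def by (metis subsetD)
    then have "t \<in> Y" using mem[OF t(2) _ YU YH[OF t(2)]] transv_sub y by blast
    then show ?thesis
      using False t(1) finite_subset[OF transv_sub group_onD(1)[OF H]] unfolding orbit_prod_def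
      by (auto intro!: prod_zero)
  qed
  finally show ?thesis .
qed

text \<open>The equations express \<open>w Y\<close> by the values of \<open>w\<close> at smaller sets, and \<open>sum_orbit_signs\<close> shows
that the signs solve them.\<close>

lemma sign_unique:
  fixes w :: "label set \<Rightarrow> int"
  assumes H: "group_on U H" and Y: "Y \<in> inv_subsets U H"
    and w: "\<And>Y. Y \<in> inv_subsets U H \<Longrightarrow> sum w (inv_subsets Y H) = of_bool (Y = {}) * f"
  shows "w Y = f * orbit_prod H (\<lambda>\<sigma>. \<sigma>) U (\<lambda>u. if u \<in> Y then -1 else 1)"
  using Y
proof (induction "card Y" arbitrary: Y rule: less_induct)
  case less
  define e where "e A = orbit_prod H (\<lambda>\<sigma>. \<sigma>) U (\<lambda>u. if u \<in> A then -1 else 1)" for A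
  have Y: "finite Y" using less.prems group_onD(1)[OF H] finite_subset unfolding inv_subsets_def by auto
  have m: "Y \<in> inv_subsets Y H" using less.prems unfolding inv_subsets_def by auto
  have "w A = f * e A" if "A \<in> inv_subsets Y H - {Y}" for A
    unfolding e_def using that Y less.prems
    by (intro less.hyps) (auto simp: inv_subsets_def intro!: psubset_card_mono)
  then have "sum w (inv_subsets Y H - {Y}) = (\<Sum>A\<in>inv_subsets Y H - {Y}. f * e A)"
    by (rule sum.cong[OF refl])
  moreover have "sum w (inv_subsets Y H) = of_bool (Y = {}) * f" by (rule w[OF less.prems])
  moreover have "sum e (inv_subsets Y H) = of_bool (Y = {})"
    using sum_orbit_signs[OF H less.prems] unfolding e_def .
  ultimately show ?case
    using sum.remove[OF finite_inv_subsets[OF Y] m, of w] sum.remove[OF finite_inv_subsets[OF Y] m, of e]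
    unfolding e_def[symmetric]
    by (simp add: sum_distrib_left[symmetric]) (metis add_right_cancel distrib_left mult.commute)
qed

lemma is_species_comp: "is_species F \<Longrightarrow> is_species G \<Longrightarrow> is_species (sp_comp F G)"
  unfolding sp_comp_def by (rule is_species_comp_by) (auto simp: sort_invariant_def)

definition summand :: "'b + 'c \<Rightarrow> two_sorts" where
  "summand = case_sum (\<lambda>_. Sort_X) (\<lambda>_. Sort_Y)"

lemma summand_simps [simp]: "summand (Inl x) = Sort_X" "summand (Inr y) = Sort_Y"
  unfolding summand_def by auto

lemma sp_comp2_summand: "sp_comp2 W G H = sp_comp_by summand W (G +\<^sub>S H)"
  unfolding sp_comp2_def summand_def ..

lemma sort_invariant_summand: "sort_invariant summand (G +\<^sub>S H)"
  unfolding sort_invariant_def sp_add_def by (auto simp: summand_def)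

lemma is_species_comp2:
  "is_species W \<Longrightarrow> is_species G \<Longrightarrow> is_species H \<Longrightarrow> is_species (sp_comp2 W G H)"
  unfolding sp_comp2_summand
  by (intro is_species_comp_by is_species_add sort_invariant_summand)

lemma is_virtual_comp2:
  "is_virtual W \<Longrightarrow> is_species G \<Longrightarrow> is_species H \<Longrightarrow> is_virtual (virtual_comp2 W G H)"
  unfolding is_virtual_def virtual_comp2_def by (auto intro: is_species_comp2)

lemma is_virtual_virt: "is_species F \<Longrightarrow> is_virtual (virt F)"
  unfolding is_virtual_def virt_def by (auto intro: is_species_zero)

definition points :: "label set \<Rightarrow> label set set" where
  "points U = (\<lambda>u. {u}) ` U"

lemma points_inv_partition: "group_on U H \<Longrightarrow> points U \<in> inv_partitions U H"
  unfolding inv_partitions_def points_def using partition_on_singletons group_onD(5) by fastforce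

lemma partition_points:
  "partition_on U P \<Longrightarrow> (\<And>B. B \<in> P \<Longrightarrow> \<exists>u. B = {u}) \<Longrightarrow> P = points U"
  unfolding partition_on_def points_def by (auto simp: image_iff) (metis Union_iff insertI1 singletonD)+

lemma mark_points:
  assumes W: "is_species W" and H: "group_on U H" "keeps_sorts U c H"
    and d: "\<And>u. u \<in> U \<Longrightarrow> d (blk {u}) = c u"
  shows "mark W (blk ` points U) d (lift ` H) = mark W U c H"
proof (rule mark_conj[OF W _ H])
  have "inj_on (\<lambda>u. blk {u}) U"
    by (rule inj_onI) (metis finite.emptyI finite.insertI singleton_inject unblk_blk)
  then show "sorted_bij U c (\<lambda>u. blk {u}) (blk ` points U) d"
    unfolding sorted_bij_def bij_betw_def points_def using group_onD(1)[OF H(1)] d by auto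
qed auto

lemma sum_only: "finite S \<Longrightarrow> a \<in> S \<Longrightarrow> (\<And>x. x \<in> S \<Longrightarrow> x \<noteq> a \<Longrightarrow> f x = 0) \<Longrightarrow> sum f S = f a"
  for f :: "'x \<Rightarrow> int"
  by (metis (mono_tags, lifting) DiffD1 DiffD2 add.right_neutral singletonI sum.neutral sum.remove)

text \<open>If \<open>G\<close> lives on one-element sets then only the partition into points carries families of
\<open>G\<close>-structures.\<close>

lemma mark_comp_points:
  assumes W: "is_species W" and G: "is_species G"
    and H: "group_on U H" "keeps_sorts U c H"
    and pt: "\<And>B s. s \<in> structs G B c \<Longrightarrow> \<exists>u. B = {u}"
  shows "mark (sp_comp_by \<kappa> W G) U c H =
    (\<Sum>g\<in>block_fams G (points U) c H. mark W (blk ` points U) (block_sorts \<kappa> g) (lift ` H))"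
proof -
  have "block_fams G P c H = {}" if P: "P \<in> inv_partitions U H" and ne: "P \<noteq> points U" for P
  proof (rule ccontr)
    assume "block_fams G P c H \<noteq> {}"
    then obtain g where "g \<in> block_fams G P c H" by blast
    then have gB: "g B \<in> structs G B c" if "B \<in> P" for B using that unfolding eqv_fam_def by auto
    have "P = points U"
    proof (rule partition_points[OF inv_partitionsD(1)[OF P]])
      fix B assume "B \<in> P"
      then show "\<exists>u. B = {u}" by (rule pt[OF gB])
    qed
    then show False using ne by simp
  qed
  then show ?thesis
    unfolding mark_comp_by[OF W G H]
    by (intro sum_only finite_inv_partitions group_onD(1)[OF H(1)] points_inv_partition[OF H(1)]) auto
qed

lemma mark_comp_single_X:
  assumes F: "is_species F" and H: "group_on U H" "keeps_sorts U c H"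
  shows "mark (sp_comp F (sp_single Sort_X)) U c H = of_bool (Y_part U c = {}) * mark F U (\<lambda>_. ()) H"
proof -
  let ?G = "sp_single Sort_X"
  have "mark (sp_comp F ?G) U c H = (\<Sum>g\<in>block_fams ?G (points U) c H.
      mark F (blk ` points U) (block_sorts (\<lambda>_. ()) g) (lift ` H))"
    unfolding sp_comp_def
    by (rule mark_comp_points[OF F is_species_single H]) (auto simp: sp_single_def split: if_splits)
  also have "\<dots> = (\<Sum>g\<in>block_fams ?G (points U) c H. mark F U (\<lambda>_. ()) H)"
    by (intro sum.cong refl mark_points[OF F H(1)]) auto
  also have "block_fams ?G (points U) c H = (if Y_part U c = {} then {\<lambda>B\<in>points U. ()} else {})"
  proof (cases "Y_part U c = {}")
    case True
    then have "c u = Sort_X" if "u \<in> U" for u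
      using that unfolding Y_part_def by (cases "c u") auto
    then have "structs ?G B c = {()}" if "B \<in> points U" for B
      using that unfolding points_def sp_single_def by auto
    then show ?thesis using True unfolding eqv_fam_def
      by (auto simp: PiE_iff extensional_def fun_eq_iff) 
  next
    case False
    then obtain u where "u \<in> U" "c u = Sort_Y" unfolding Y_part_def by auto
    then have "{u} \<in> points U" "structs ?G {u} c = {}" unfolding points_def sp_single_def by auto
    then show ?thesis using False unfolding eqv_fam_def by (auto simp: PiE_iff)
  qed
  finally show ?thesis by simp
qed

definition Y_sort :: "label set \<Rightarrow> label \<Rightarrow> two_sorts" where
  "Y_sort A u = (if u \<in> A then Sort_Y else Sort_X)"

lemma keeps_Y_sort:
  assumes "group_on U H" "A \<in> inv_subsets U H"
  shows "keeps_sorts U (Y_sort A) H"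
proof -
  have "\<sigma> u \<in> A \<longleftrightarrow> u \<in> A" if "\<sigma> \<in> H" "u \<in> U" for \<sigma> u
    using that assms group_onD(4)[OF assms(1) that(1)] unfolding inv_subsets_def
    by (smt (verit, best) imageE imageI inj_onD mem_Collect_eq subsetD)
  then show ?thesis unfolding keeps_sorts_def Y_sort_def by auto
qed

lemma Y_part_inv: "group_on U H \<Longrightarrow> keeps_sorts U c H \<Longrightarrow> Y_part U c \<in> inv_subsets U H"
proof -
  assume H: "group_on U H" "keeps_sorts U c H"
  have "\<sigma> ` Y_part U c = Y_part U c" if s: "\<sigma> \<in> H" for \<sigma>
  proof
    show "\<sigma> ` Y_part U c \<subseteq> Y_part U c"
      using H(2) group_onD(5)[OF H(1) s] s unfolding keeps_sorts_def Y_part_def by auto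
    show "Y_part U c \<subseteq> \<sigma> ` Y_part U c"
    proof
      fix v assume v: "v \<in> Y_part U c"
      then obtain u where "u \<in> U" "v = \<sigma> u" using group_onD(5)[OF H(1) s] unfolding Y_part_def by blast
      then show "v \<in> \<sigma> ` Y_part U c"
        using v H(2) s unfolding keeps_sorts_def Y_part_def by auto
    qed
  qed
  then show ?thesis unfolding inv_subsets_def Y_part_def by auto
qed

text \<open>An element of sort \<open>Y\<close> may be used as the \<open>Y\<close> in \<open>X + Y\<close>, substituted for \<open>X\<close>, or as the
\<open>Y\<close> substituted for \<open>Y\<close>; one of sort \<open>X\<close> only in the first way.  The set \<open>A\<close> collects
the elements used in the last way.\<close>

lemma mark_comp2_X_Y:
  assumes W: "is_species W" and H: "group_on U H" "keeps_sorts U c H"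
  shows "mark (sp_comp2 W (sp_single Sort_X +\<^sub>S sp_single Sort_Y) (sp_single Sort_Y)) U c H =
    (\<Sum>A\<in>inv_subsets (Y_part U c) H. mark W U (Y_sort A) H)"
proof -
  let ?G = "(sp_single Sort_X +\<^sub>S sp_single Sort_Y) +\<^sub>S sp_single Sort_Y :: (two_sorts, (unit + unit) + unit) species"
  have G: "is_species ?G" by (intro is_species_add is_species_single)
  have st: "structs ?G B c = (if \<exists>u. B = {u} \<and> c u = Sort_X then {Inl (Inl ())} else {}) \<union>
      (if \<exists>u. B = {u} \<and> c u = Sort_Y then {Inl (Inr ()), Inr ()} else {})" for B c
    by (auto simp: sp_add_def sp_single_def)
  have tr: "transport ?G B c \<sigma> s = s" for B c \<sigma> s
    by (cases s; cases "projl s") (auto simp: sp_add_def sp_single_def)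
  have "mark (sp_comp2 W (sp_single Sort_X +\<^sub>S sp_single Sort_Y) (sp_single Sort_Y)) U c H =
    (\<Sum>g\<in>block_fams ?G (points U) c H. mark W (blk ` points U) (block_sorts summand g) (lift ` H))"
    unfolding sp_comp2_summand by (rule mark_comp_points[OF W G H]) (auto simp: st split: if_splits)
  also have "\<dots> = (\<Sum>A\<in>inv_subsets (Y_part U c) H. mark W U (Y_sort A) H)"
  proof (rule sum.reindex_bij_witness[symmetric,
        where i = "\<lambda>g. {u\<in>U. summand (g {u}) = Sort_Y}" and
        j = "\<lambda>A. \<lambda>B\<in>points U. if B \<subseteq> A then Inr () else if c (the_elem B) = Sort_X then Inl (Inl ()) else Inl (Inr ())"])
    fix A assume A: "A \<in> inv_subsets (Y_part U c) H"
    let ?g = "\<lambda>B\<in>points U. if B \<subseteq> A then Inr () else if c (the_elem B) = Sort_X then Inl (Inl ()) else Inl (Inr ())"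
    have AU: "A \<subseteq> U" "\<And>u. u \<in> A \<Longrightarrow> c u = Sort_Y" using A unfolding inv_subsets_def Y_part_def by auto
    have pt: "{u} \<in> points U" if "u \<in> U" for u using that unfolding points_def by auto
    show "{u\<in>U. summand (?g {u}) = Sort_Y} = A" using AU pt by auto
    have AI: "A \<in> inv_subsets U H" using A AU unfolding inv_subsets_def by auto
    have cA: "c (\<sigma> u) = c u \<and> (\<sigma> u \<in> A \<longleftrightarrow> u \<in> A) \<and> \<sigma> u \<in> U" if "\<sigma> \<in> H" "u \<in> U" for \<sigma> u
      using that H(2) keeps_Y_sort[OF H(1) AI] group_onD(5)[OF H(1) that(1)]
      unfolding keeps_sorts_def Y_sort_def by (auto split: if_splits)
    have "?g B \<in> structs ?G B c" if k: "B \<in> points U" for B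
    proof -
      obtain u where u: "u \<in> U" "B = {u}" using k unfolding points_def by auto
      show ?thesis using AU(2)[of u] k unfolding st u(2) by (cases "c u") auto
    qed
    moreover have "?g (\<sigma> ` B) = ?g B" if k: "\<sigma> \<in> H" "B \<in> points U" for \<sigma> B
    proof -
      obtain u where u: "u \<in> U" "B = {u}" using k(2) unfolding points_def by auto
      show ?thesis using cA[OF k(1) u(1)] pt u by simp
    qed
    ultimately show "?g \<in> block_fams ?G (points U) c H"
      unfolding eqv_fam_def tr by simp
    show "mark W (blk ` points U) (block_sorts summand ?g) (lift ` H) = mark W U (Y_sort A) H"
      by (rule mark_points[OF W H(1) keeps_Y_sort[OF H(1) AI]])
        (use pt in \<open>auto simp: block_sorts_def Y_sort_def\<close>)
  next
    fix g assume g: "g \<in> block_fams ?G (points U) c H"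
    let ?A = "{u\<in>U. summand (g {u}) = Sort_Y}"
    have gs: "g {u} \<in> structs ?G {u} c" if "u \<in> U" for u
      using g that unfolding eqv_fam_def points_def by auto
    have ge: "g {\<sigma> u} = g {u}" if "\<sigma> \<in> H" "u \<in> U" for \<sigma> u
    proof -
      have "{u} \<in> points U" using that unfolding points_def by blast
      then have "g (\<sigma> ` {u}) = transport ?G {u} c \<sigma> (g {u})"
        using g that(1) unfolding eqv_fam_def by blast
      then show ?thesis unfolding tr by simp
    qed
    have c: "keeps_sorts U (\<lambda>u. summand (g {u})) H" using ge unfolding keeps_sorts_def by auto
    have "?A \<in> inv_subsets U H" using Y_part_inv[OF H(1) c] unfolding Y_part_def .
    moreover have "?A \<subseteq> Y_part U c" using gs unfolding st Y_part_def by (fastforce split: if_splits)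
    ultimately show "?A \<in> inv_subsets (Y_part U c) H" unfolding inv_subsets_def by auto
    show "(\<lambda>B\<in>points U. if B \<subseteq> ?A then Inr () else if c (the_elem B) = Sort_X then Inl (Inl ()) else Inl (Inr ())) = g"
    proof (rule extensionalityI[of _ "points U"])
      show "g \<in> extensional (points U)" using g unfolding eqv_fam_def by (auto simp: PiE_def)
      fix B assume "B \<in> points U"
      then obtain u where "u \<in> U" "B = {u}" unfolding points_def by auto
      then show "(\<lambda>B\<in>points U. if B \<subseteq> ?A then Inr () else if c (the_elem B) = Sort_X then Inl (Inl ()) else Inl (Inr ())) B = g B"
        using gs[of u] unfolding st by (auto simp: points_def split: if_splits)
    qed auto
  qed
  finally show ?thesis .
qed

lemma vmark_comp2_X_Y:
  assumes W: "is_virtual W" and H: "group_on U H" "keeps_sorts U c H"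
  shows "vmark (virtual_comp2 W (sp_single Sort_X +\<^sub>S sp_single Sort_Y) (sp_single Sort_Y)) U c H =
    (\<Sum>A\<in>inv_subsets (Y_part U c) H. vmark W U (Y_sort A) H)"
  using W mark_comp2_X_Y[OF _ H, of "fst W"] mark_comp2_X_Y[OF _ H, of "snd W"]
  unfolding is_virtual_def vmark_def virtual_comp2_def by (simp add: sum_subtractf)

lemma vmark_virt: "vmark (virt F) U c H = mark F U c H"
  unfolding vmark_def virt_def by (simp add: mark_zero)

lemma Y_part_Y_sort: "A \<subseteq> U \<Longrightarrow> Y_part U (Y_sort A) = A"
  unfolding Y_part_def Y_sort_def by auto

text \<open>By \<open>sum_inv_flags\<close>, the signed flags cancel all terms of \<open>W(X + Y, Y)\<close> unless there are no
elements of sort \<open>Y\<close>.\<close>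

lemma at_X_minus_Y_exists:
  assumes F: "is_species F"
  shows "\<exists>W :: (two_sorts, label, label) virtual. is_virtual W \<and>
     virtual_comp2 W (sp_single Sort_X +\<^sub>S sp_single Sort_Y) (sp_single Sort_Y)
       =\<^sub>V virt (sp_comp F (sp_single Sort_X))"
proof -
  let ?W = "(relabelled (with_flag F True), relabelled (with_flag F False))"
  have s: "is_species (with_flag F p)" for p by (rule is_species_with_flag[OF F])
  have W: "is_virtual ?W" unfolding is_virtual_def using relabelled(1)[OF s] by simp
  have "virtual_comp2 ?W (sp_single Sort_X +\<^sub>S sp_single Sort_Y) (sp_single Sort_Y)
       =\<^sub>V virt (sp_comp F (sp_single Sort_X))"
  proof (subst virtual_eq_iff_vmark)
    show "is_virtual (virtual_comp2 ?W (sp_single Sort_X +\<^sub>S sp_single Sort_Y) (sp_single Sort_Y))"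
      by (intro is_virtual_comp2 W is_species_add is_species_single)
    show "is_virtual (virt (sp_comp F (sp_single Sort_X)))"
      by (intro is_virtual_virt is_species_comp F is_species_single)
    show "\<forall>U c H. group_on U H \<longrightarrow> keeps_sorts U c H \<longrightarrow>
      vmark (virtual_comp2 ?W (sp_single Sort_X +\<^sub>S sp_single Sort_Y) (sp_single Sort_Y)) U c H =
      vmark (virt (sp_comp F (sp_single Sort_X))) U c H"
    proof (intro allI impI)
      fix U H and c :: "label \<Rightarrow> two_sorts" assume H: "group_on U H" "keeps_sorts U c H"
      have Y: "finite (Y_part U c)" "Y_part U c \<in> inv_subsets (Y_part U c) H"
        using Y_part_inv[OF H] group_onD(1)[OF H(1)] unfolding inv_subsets_def Y_part_def by auto
      have "vmark ?W U (Y_sort A) H = mark F U (\<lambda>_. ()) H *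
          (int (card (inv_flags A H True)) - int (card (inv_flags A H False)))"
        if "A \<in> inv_subsets (Y_part U c) H" for A
      proof -
        have AU: "A \<subseteq> U" "A \<in> inv_subsets U H" using that unfolding inv_subsets_def Y_part_def by auto
        show ?thesis
          unfolding vmark_def fst_conv snd_conv relabelled(2)[OF s H(1) keeps_Y_sort[OF H(1) AU(2)]]
            mark_with_flag[OF H(1)] Y_part_Y_sort[OF AU(1)] by (simp add: algebra_simps)
      qed
      then have "vmark (virtual_comp2 ?W (sp_single Sort_X +\<^sub>S sp_single Sort_Y) (sp_single Sort_Y)) U c H =
          mark F U (\<lambda>_. ()) H * of_bool (Y_part U c = {})"
        unfolding vmark_comp2_X_Y[OF W H] sum_inv_flags[OF Y, symmetric] sum_distrib_left by simp
      then show "vmark (virtual_comp2 ?W (sp_single Sort_X +\<^sub>S sp_single Sort_Y) (sp_single Sort_Y)) U c H =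
          vmark (virt (sp_comp F (sp_single Sort_X))) U c H"
        unfolding vmark_virt mark_comp_single_X[OF F H] by simp
    qed
  qed
  then show ?thesis using W by blast
qed

lemma at_X_minus_Y:
  assumes F: "is_species F"
  shows "is_virtual (at_X_minus_Y F)"
    and "virtual_comp2 (at_X_minus_Y F) (sp_single Sort_X +\<^sub>S sp_single Sort_Y) (sp_single Sort_Y)
       =\<^sub>V virt (sp_comp F (sp_single Sort_X))"
  using someI_ex[OF at_X_minus_Y_exists[OF F]] unfolding at_X_minus_Y_def by blast+

text \<open>The defining equation determines the marks of every solution, so the choice made in
\<^const>\<open>at_X_minus_Y\<close> does not matter.\<close>

lemma vmark_at_X_minus_Y:
  assumes F: "is_species F" and H: "group_on U H" "keeps_sorts U c H"
  shows "vmark (at_X_minus_Y F) U c H =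
    mark F U (\<lambda>_. ()) H * orbit_prod H (\<lambda>\<sigma>. \<sigma>) U (\<lambda>u. if c u = Sort_Y then -1 else 1)"
proof -
  let ?W = "at_X_minus_Y F"
  have W: "is_virtual ?W" by (rule at_X_minus_Y[OF F])
  have sW: "is_species (fst ?W)" "is_species (snd ?W)" using W unfolding is_virtual_def by auto
  define w where "w A = vmark ?W U (Y_sort A) H" for A
  have "sum w (inv_subsets Y H) = of_bool (Y = {}) * mark F U (\<lambda>_. ()) H"
    if Y: "Y \<in> inv_subsets U H" for Y
  proof -
    have YU: "Y \<subseteq> U" using Y unfolding inv_subsets_def by auto
    note kY = keeps_Y_sort[OF H(1) Y]
    have "vmark (virtual_comp2 ?W (sp_single Sort_X +\<^sub>S sp_single Sort_Y) (sp_single Sort_Y)) U (Y_sort Y) H =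
        vmark (virt (sp_comp F (sp_single Sort_X))) U (Y_sort Y) H"
      using at_X_minus_Y(2)[OF F] H(1) kY
      by (subst (asm) virtual_eq_iff_vmark)
        (auto intro!: is_virtual_comp2 W is_species_add is_species_single is_virtual_virt is_species_comp F)
    then show ?thesis
      unfolding vmark_comp2_X_Y[OF W H(1) kY] vmark_virt mark_comp_single_X[OF F H(1) kY]
        Y_part_Y_sort[OF YU] w_def .
  qed
  then have *: "w (Y_part U c) = mark F U (\<lambda>_. ()) H *
      orbit_prod H (\<lambda>\<sigma>. \<sigma>) U (\<lambda>u. if u \<in> Y_part U c then -1 else 1)"
    by (rule sign_unique[OF H(1) Y_part_inv[OF H]])
  have c: "Y_sort (Y_part U c) u = c u" if "u \<in> U" for u
    using that unfolding Y_sort_def Y_part_def by (cases "c u") auto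
  have "mark W' U (Y_sort (Y_part U c)) H = mark W' U c H" if "is_species W'" for W' :: "(two_sorts, label) species"
    by (rule mark_conj[OF that sorted_bij_id' H])
      (use c group_onD(1)[OF H(1)] in auto)
  then have "vmark ?W U c H = w (Y_part U c)" unfolding w_def vmark_def using sW by simp
  also have "orbit_prod H (\<lambda>\<sigma>. \<sigma>) U (\<lambda>u. if u \<in> Y_part U c then -1 else 1) =
      orbit_prod H (\<lambda>\<sigma>. \<sigma>) U (\<lambda>u. if c u = Sort_Y then -1 else 1)"
    by (rule orbit_prod_cong[OF group_onD(2)[OF H(1)]]) (simp add: Y_part_def)
  ultimately show ?thesis using * by simp
qed

lemma orbit_prod_blocks:
  assumes H: "group_on U H" and P: "P \<in> inv_partitions U H"
    and v: "\<And>\<sigma> B. \<sigma> \<in> H \<Longrightarrow> B \<in> P \<Longrightarrow> v (blk (\<sigma> ` B)) = v (blk B)"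
  shows "orbit_prod (lift ` H) (\<lambda>\<sigma>. \<sigma>) (blk ` P) v = orbit_prod H (`) P (\<lambda>B. v (blk B))"
  using group_acting_blocks[OF H P]
    inj_on_blk[OF group_onD(1)[OF H] inv_partitionsD(1)[OF P]]
    inv_partitionsD(6)[OF P group_onD(1)[OF H]] v
  by (intro orbit_prod_image) auto

text \<open>The sign of \<open>vmark_at_X_minus_Y\<close> is itself a product over the orbits of blocks.  Distributing it
over the choices of \<open>G\<close>- and \<open>G'\<close>-structures turns the factor for \<open>B\<close> into a difference.\<close>

lemma vmark_comp2_at_X_minus_Y:
  fixes F :: "(unit, 'a) species" and G :: "('s, 'c) species" and G' :: "('s, 'd) species"
  assumes F: "is_species F" and G: "is_species G" "is_species G'"
    and H: "group_on U H" "keeps_sorts U c H"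
  shows "vmark (virtual_comp2 (at_X_minus_Y F) G G') U c H =
    (\<Sum>P\<in>inv_partitions U H. mark F (blk ` P) (\<lambda>_. ()) (lift ` H) *
       orbit_prod H (`) P (\<lambda>B. mark G B c (stab H B) - mark G' B c (stab H B)))"
proof -
  let ?W = "at_X_minus_Y F" and ?G = "G +\<^sub>S G'"
  have W: "is_species (fst ?W)" "is_species (snd ?W)"
    using at_X_minus_Y(1)[OF F] unfolding is_virtual_def by auto
  have sG: "is_species ?G" by (rule is_species_add[OF G])
  have U: "finite U" by (rule group_onD(1)[OF H(1)])
  define \<phi> :: "label set \<Rightarrow> 'c + 'd \<Rightarrow> int" where "\<phi> B s = (if summand s = Sort_Y then -1 else 1)" for B s
  have fam: "vmark ?W (blk ` P) (block_sorts summand g) (lift ` H) =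
      mark F (blk ` P) (\<lambda>_. ()) (lift ` H) * orbit_prod H (`) P (\<lambda>B. \<phi> B (g B))"
    if P: "P \<in> inv_partitions U H" and g: "g \<in> block_fams ?G P c H" for P g
  proof -
    note ks = block_sorts_keeps[OF sort_invariant_summand H P g]
    have "orbit_prod (lift ` H) (\<lambda>\<sigma>. \<sigma>) (blk ` P) (\<lambda>b. if block_sorts summand g b = Sort_Y then -1 else 1)
        = orbit_prod H (`) P (\<lambda>B. if block_sorts summand g (blk B) = Sort_Y then -1 else 1)"
    proof (rule orbit_prod_blocks[OF H(1) P])
      fix \<sigma> B assume "\<sigma> \<in> H" "B \<in> P"
      then have "block_sorts summand g (lift \<sigma> (blk B)) = block_sorts summand g (blk B)"
        using ks unfolding keeps_sorts_def by blast
      then show "(if block_sorts summand g (blk (\<sigma> ` B)) = Sort_Y then -1 else 1 :: int) =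
          (if block_sorts summand g (blk B) = Sort_Y then -1 else 1)"
        using inv_partitionsD(6)[OF P U \<open>B \<in> P\<close>] by simp
    qed
    also have "\<dots> = orbit_prod H (`) P (\<lambda>B. \<phi> B (g B))"
      by (rule orbit_prod_cong[OF group_acting_blocks[OF H(1) P]])
        (simp add: \<phi>_def block_sorts_def inv_partitionsD(6)[OF P U])
    finally show ?thesis
      unfolding vmark_at_X_minus_Y[OF F group_on_lift[OF H(1) P] ks] by simp
  qed
  have loc: "(\<Sum>s\<in>fixed_structs ?G B c (stab H B). \<phi> B s) = mark G B c (stab H B) - mark G' B c (stab H B)"
    if "finite B" for B
  proof -
    let ?A = "fixed_structs G B c (stab H B)" and ?A' = "fixed_structs G' B c (stab H B)"
    have "fixed_structs ?G B c (stab H B) = ?A <+> ?A'"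
      unfolding fixed_structs_def sp_add_def by auto
    then show ?thesis
      using finite_fixed[OF G(1) that] finite_fixed[OF G(2) that]
      by (simp add: sum.Plus \<phi>_def mark_def)
  qed
  have "vmark (virtual_comp2 ?W G G') U c H =
    (\<Sum>P\<in>inv_partitions U H. \<Sum>g\<in>block_fams ?G P c H. vmark ?W (blk ` P) (block_sorts summand g) (lift ` H))"
    unfolding vmark_def virtual_comp2_def fst_conv snd_conv sp_comp2_summand
      mark_comp_by[OF W(1) sG H] mark_comp_by[OF W(2) sG H] by (simp add: sum_subtractf)
  also have "\<dots> = (\<Sum>P\<in>inv_partitions U H. mark F (blk ` P) (\<lambda>_. ()) (lift ` H) *
      (\<Sum>g\<in>block_fams ?G P c H. orbit_prod H (`) P (\<lambda>B. \<phi> B (g B))))"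
    by (simp add: fam sum_distrib_left)
  also have "\<dots> = (\<Sum>P\<in>inv_partitions U H. mark F (blk ` P) (\<lambda>_. ()) (lift ` H) *
      orbit_prod H (`) P (\<lambda>B. \<Sum>s\<in>fixed_structs ?G B c (stab H B). \<phi> B s))"
    by (simp add: sum_block_fams[OF sG H])
  also have "\<dots> = (\<Sum>P\<in>inv_partitions U H. mark F (blk ` P) (\<lambda>_. ()) (lift ` H) *
       orbit_prod H (`) P (\<lambda>B. mark G B c (stab H B) - mark G' B c (stab H B)))"
    by (intro sum.cong refl arg_cong2[of _ _ _ _ "(*)"]
        orbit_prod_cong[OF group_acting_blocks[OF H(1)]] loc inv_partitionsD(6)[OF _ U])
  finally show ?thesis .
qed

section \<open>Composition of virtual species on marks\<close>

lemma is_virtual_add: "is_virtual V \<Longrightarrow> is_virtual W \<Longrightarrow> is_virtual (V +\<^sub>V W)"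
  and is_virtual_diff: "is_virtual V \<Longrightarrow> is_virtual W \<Longrightarrow> is_virtual (V -\<^sub>V W)"
  unfolding is_virtual_def virtual_add_def virtual_diff_def by (auto intro: is_species_add)

lemma vmark_add:
  "is_virtual V \<Longrightarrow> is_virtual W \<Longrightarrow> finite U \<Longrightarrow> vmark (V +\<^sub>V W) U c H = vmark V U c H + vmark W U c H"
  and vmark_diff:
  "is_virtual V \<Longrightarrow> is_virtual W \<Longrightarrow> finite U \<Longrightarrow> vmark (V -\<^sub>V W) U c H = vmark V U c H - vmark W U c H"
  unfolding is_virtual_def vmark_def virtual_add_def virtual_diff_def by (auto simp: mark_add)

definition umark :: "(unit, 'a, 'b) virtual \<Rightarrow> label set \<Rightarrow> (label \<Rightarrow> label) set \<Rightarrow> int" where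
  "umark V U H = vmark V U (\<lambda>_. ()) H"

text \<open>The marks of a composite as a function of the marks of its two parts.\<close>

definition plethysm where
  "plethysm f h U H = (\<Sum>P\<in>inv_partitions U H. f (blk ` P) (lift ` H) * orbit_prod H (`) P (\<lambda>B. h B (stab H B)))"

lemma is_virtual_comp:
  assumes F: "is_virtual F" and V: "is_virtual V"
  shows "is_virtual (F \<circ>\<^sub>V V)"
  using assms unfolding virtual_comp_def
  by (intro is_virtual_diff is_virtual_comp2 at_X_minus_Y(1)) (auto simp: is_virtual_def)

lemma umark_comp:
  assumes F: "is_virtual F" and V: "is_virtual V" and H: "group_on U H"
  shows "umark (F \<circ>\<^sub>V V) U H = plethysm (umark F) (umark V) U H"
proof -
  have s: "is_species (fst F)" "is_species (snd F)" "is_species (fst V)" "is_species (snd V)"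
    using F V unfolding is_virtual_def by auto
  have v: "is_virtual (virtual_comp2 (at_X_minus_Y (fst F)) (fst V) (snd V))"
    "is_virtual (virtual_comp2 (at_X_minus_Y (snd F)) (fst V) (snd V))"
    using s by (intro is_virtual_comp2 at_X_minus_Y(1); simp)+
  show ?thesis
    unfolding umark_def virtual_comp_def vmark_diff[OF v group_onD(1)[OF H]]
      vmark_comp2_at_X_minus_Y[OF s(1,3,4) H keeps_sorts_unit]
      vmark_comp2_at_X_minus_Y[OF s(2,3,4) H keeps_sorts_unit] plethysm_def
    by (simp add: vmark_def sum_subtractf left_diff_distrib)
qed

lemma virtual_eq_iff_umark:
  fixes V :: "(unit, 'a, 'b) virtual" and W :: "(unit, 'c, 'd) virtual"
  assumes "is_virtual V" "is_virtual W"
  shows "V =\<^sub>V W \<longleftrightarrow> (\<forall>U H. group_on U H \<longrightarrow> umark V U H = umark W U H)"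
proof -
  have "c = (\<lambda>_. ())" for c :: "label \<Rightarrow> unit" by (rule ext) simp
  then show ?thesis unfolding virtual_eq_iff_vmark[OF assms] umark_def by (metis keeps_sorts_unit)
qed

lemma stab_whole: "group_on U H \<Longrightarrow> stab H U = H"
  unfolding stab_def using group_onD(5)[of U H] by (intro set_eqI) auto

lemma whole_inv_partition: "group_on U H \<Longrightarrow> U \<noteq> {} \<Longrightarrow> {U} \<in> inv_partitions U H"
  unfolding inv_partitions_def using partition_on_space[of U] group_onD(5)[of U H] by simp

lemma orbit_prod_single:
  assumes "group_acting H act {x}"
  shows "orbit_prod H act {x} v = v x"
proof -
  interpret group_acting H act "{x}" by (rule assms)
  have "transv H act {x} = {x}"
    using transv transv_sub unfolding transversal_def by blast
  then show ?thesis unfolding orbit_prod_def by simp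
qed

lemma orbit_prod_whole:
  assumes "group_on U H" "U \<noteq> {}"
  shows "orbit_prod H (`) {U} (\<lambda>B. h B (stab H B)) = h U H"
  using orbit_prod_single[OF group_acting_blocks[OF assms(1) whole_inv_partition[OF assms]]]
    stab_whole[OF assms(1)] by simp

lemma block_card_less:
  assumes "finite U" "P \<in> inv_partitions U H" "P \<noteq> {U}" "B \<in> P"
  shows "card B < card U"
proof -
  have "B \<noteq> U"
  proof
    assume "B = U"
    have "C = U" if C: "C \<in> P" for C
    proof -
      obtain x where "x \<in> C" using inv_partitionsD(4)[OF assms(2) C] by blast
      then show ?thesis
        using inv_partitionsD(8)[OF assms(2) C assms(4), of x] inv_partitionsD(3)[OF assms(2) C] \<open>B = U\<close>
        by auto
    qed
    then have "P \<subseteq> {U}" by (intro subsetI) simp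
    moreover have "U \<in> P" using assms(4) \<open>B = U\<close> by simp
    ultimately show False using assms(3) by blast
  qed
  then show ?thesis using inv_partitionsD(3)[OF assms(2,4)] assms(1) by (simp add: psubset_card_mono psubset_eq)
qed

lemma inv_partitions_empty: "inv_partitions {} H = {{}}"
  unfolding inv_partitions_def partition_on_empty by auto

lemma plethysm_split_whole:
  assumes H: "group_on U H" and U: "U \<noteq> {}"
  shows "plethysm f h U H = f (blk ` {U}) (lift ` H) * h U H +
    (\<Sum>P\<in>inv_partitions U H - {{U}}. f (blk ` P) (lift ` H) * orbit_prod H (`) P (\<lambda>B. h B (stab H B)))"
  unfolding plethysm_def
    sum.remove[OF finite_inv_partitions[OF group_onD(1)[OF H]] whole_inv_partition[OF H U]]
    orbit_prod_whole[OF H U] ..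

abbreviation (input) one :: "label set \<Rightarrow> (label \<Rightarrow> label) set \<Rightarrow> int" where
  "one \<equiv> (\<lambda>_ _. 1)"

text \<open>The constant function 1 gives the marks of nonempty sets, so this is injectivity of
\<open>f \<mapsto> \<E>\<^sub>+ \<circ> f\<close>.  In the sum over partitions, \<open>f U\<close> itself occurs only for the partition with one
block, and with coefficient 1; all other blocks are smaller.\<close>

lemma plethysm_one_inject:
  assumes eq: "\<And>U H. group_on U H \<Longrightarrow> U \<noteq> {} \<Longrightarrow> plethysm one f U H = plethysm one h U H"
    and H: "group_on U H" and U: "U \<noteq> {}"
  shows "f U H = h U H"
  using H U
proof (induction "card U" arbitrary: U H rule: less_induct)
  case less
  note H = less.prems(1) and U = less.prems(2)
  have "orbit_prod H (`) P (\<lambda>B. f B (stab H B)) = orbit_prod H (`) P (\<lambda>B. h B (stab H B))"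
    if P: "P \<in> inv_partitions U H - {{U}}" for P
  proof (rule orbit_prod_cong)
    show "group_acting H (`) P" using group_acting_blocks[OF H] P by blast
    fix B assume B: "B \<in> P"
    have P': "P \<in> inv_partitions U H" "P \<noteq> {U}" using P by auto
    show "f B (stab H B) = h B (stab H B)"
      by (rule less.hyps[OF block_card_less[OF group_onD(1)[OF H] P' B]
            group_on_stab[OF H inv_partitionsD(3)[OF P'(1) B]] inv_partitionsD(4)[OF P'(1) B]])
  qed
  then show ?case
    using eq[OF H U] unfolding plethysm_split_whole[OF H U] by simp
qed

section \<open>The compositional inverse of nonempty sets\<close>

definition relabelled_virtual :: "('s, 'a, 'b) virtual \<Rightarrow> ('s, label, label) virtual" where
  "relabelled_virtual V = (relabelled (fst V), relabelled (snd V))"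

lemma relabelled_virtual:
  assumes "is_virtual V"
  shows "is_virtual (relabelled_virtual V)"
    and "group_on U H \<Longrightarrow> keeps_sorts U c H \<Longrightarrow> vmark (relabelled_virtual V) U c H = vmark V U c H"
proof -
  have s: "is_species (fst V)" "is_species (snd V)" using assms unfolding is_virtual_def by auto
  show "is_virtual (relabelled_virtual V)"
    unfolding is_virtual_def relabelled_virtual_def using relabelled(1)[OF s(1)] relabelled(1)[OF s(2)] by simp
  show "group_on U H \<Longrightarrow> keeps_sorts U c H \<Longrightarrow> vmark (relabelled_virtual V) U c H = vmark V U c H"
    unfolding relabelled_virtual_def vmark_def using relabelled(2)[OF s(1)] relabelled(2)[OF s(2)] by simp
qed

text \<open>The iteration \<open>L \<mapsto> L + X - \<E>\<^sub>+ \<circ> L\<close>, whose fixed points are the solutions of \<open>\<E>\<^sub>+ \<circ> L = X\<close>.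
The contribution of the one-block partition cancels the summand \<open>L\<close>, so the value on \<open>U\<close> after a
step depends only on earlier values on smaller sets.\<close>

primrec inverse_approx :: "nat \<Rightarrow> (unit, label, label) virtual" where
  "inverse_approx 0 = relabelled_virtual (virt sp_zero)"
| "inverse_approx (Suc n) = relabelled_virtual
     (inverse_approx n +\<^sub>V virt sp_X -\<^sub>V virt sp_E_plus \<circ>\<^sub>V inverse_approx n)"

lemma is_virtual_inverse_approx: "is_virtual (inverse_approx n)"
  by (induction n)
    (auto intro!: relabelled_virtual(1) is_virtual_virt is_species_zero is_virtual_diff is_virtual_add
      is_species_single is_virtual_comp is_species_E_plus)

lemma umark_virt: "umark (virt F) U H = mark F U (\<lambda>_. ()) H"
  unfolding umark_def vmark_virt ..

lemma umark_comp_E_plus: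
  assumes V: "is_virtual V" and H: "group_on U H"
  shows "umark (virt sp_E_plus \<circ>\<^sub>V V) U H = of_bool (U \<noteq> {}) * plethysm one (umark V) U H"
proof -
  have "P \<noteq> {} \<longleftrightarrow> U \<noteq> {}" if "P \<in> inv_partitions U H" for P
    using inv_partitionsD(4,7)[OF that] by auto
  then show ?thesis
    unfolding umark_comp[OF is_virtual_virt[OF is_species_E_plus] V H] plethysm_def umark_virt mark_E_plus
      sum_distrib_left by (intro sum.cong) auto
qed

lemma umark_inverse_approx_Suc:
  assumes H: "group_on U H" and U: "U \<noteq> {}"
  shows "umark (inverse_approx (Suc n)) U H = of_bool (\<exists>u. U = {u}) -
    (\<Sum>P\<in>inv_partitions U H - {{U}}. orbit_prod H (`) P (\<lambda>B. umark (inverse_approx n) B (stab H B)))"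
proof -
  let ?L = "inverse_approx n"
  have v: "is_virtual ?L" "is_virtual (virt sp_X)" "is_virtual (virt sp_E_plus \<circ>\<^sub>V ?L)"
    by (auto intro!: is_virtual_inverse_approx is_virtual_virt is_species_single is_virtual_comp is_species_E_plus)
  have "umark (inverse_approx (Suc n)) U H =
      umark ?L U H + of_bool (\<exists>u. U = {u}) - umark (virt sp_E_plus \<circ>\<^sub>V ?L) U H"
    using relabelled_virtual(2)[OF is_virtual_diff[OF is_virtual_add[OF v(1,2)] v(3)] H keeps_sorts_unit]
    unfolding umark_def
    by (simp add: vmark_diff[OF is_virtual_add[OF v(1,2)] v(3) group_onD(1)[OF H]]
        vmark_add[OF v(1,2) group_onD(1)[OF H]] vmark_virt mark_single)
  then show ?thesis
    unfolding umark_comp_E_plus[OF v(1) H] plethysm_split_whole[OF H U] using U by simp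
qed

lemma umark_inverse_approx_stable:
  "group_on U H \<Longrightarrow> U \<noteq> {} \<Longrightarrow> card U \<le> n \<Longrightarrow> card U \<le> m \<Longrightarrow>
    umark (inverse_approx n) U H = umark (inverse_approx m) U H"
proof (induction "card U" arbitrary: U H n m rule: less_induct)
  case less
  note H = less.prems(1) and U = less.prems(2)
  have "card U > 0" using U group_onD(1)[OF H] by (simp add: card_gt_0_iff)
  then obtain n' m' where nm: "n = Suc n'" "m = Suc m'"
    using less.prems(3,4) by (cases n; cases m) auto
  have "orbit_prod H (`) P (\<lambda>B. umark (inverse_approx n') B (stab H B)) =
      orbit_prod H (`) P (\<lambda>B. umark (inverse_approx m') B (stab H B))"
    if P: "P \<in> inv_partitions U H - {{U}}" for P
  proof (rule orbit_prod_cong)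
    show "group_acting H (`) P" using group_acting_blocks[OF H] P by blast
    fix B assume B: "B \<in> P"
    have P': "P \<in> inv_partitions U H" "P \<noteq> {U}" using P by auto
    note c = block_card_less[OF group_onD(1)[OF H] P' B]
    show "umark (inverse_approx n') B (stab H B) = umark (inverse_approx m') B (stab H B)"
      by (rule less.hyps[OF c group_on_stab[OF H inv_partitionsD(3)[OF P'(1) B]]
            inv_partitionsD(4)[OF P'(1) B]]) (use c less.prems(3,4) nm in auto)
  qed
  then show ?case unfolding nm umark_inverse_approx_Suc[OF H U] by simp
qed

text \<open>The limit of a sequence of species whose values on \<open>n\<close>-element sets are stationary from the
\<open>n\<close>-th term on.  There are no structures on the empty set, as required of \<open>(1 + X)\<^sup>c\<close>.\<close>

definition degreewise :: "(nat \<Rightarrow> ('s, 'a) species) \<Rightarrow> ('s, 'a) species" where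
  "degreewise F = \<lparr> structs = (\<lambda>U c. if U = {} then {} else structs (F (card U)) U c),
     transport = (\<lambda>U. transport (F (card U)) U) \<rparr>"

lemma is_species_degreewise:
  assumes F: "\<And>n. is_species (F n)"
  shows "is_species (degreewise F)"
proof -
  have D: "card V = card U" "V = {} \<longleftrightarrow> U = {}" if "sorted_bij U c \<sigma> V d"
    for U V d \<sigma> and c :: "label \<Rightarrow> 'a"
    using sorted_bijD[OF that] by (auto simp: card_image)
  show ?thesis
  proof (rule is_speciesI)
    fix U V c d \<sigma> s
    assume b: "sorted_bij U c \<sigma> V d" and "s \<in> structs (degreewise F) U c"
    then show "transport (degreewise F) U c \<sigma> s \<in> structs (degreewise F) V d"
      using D[OF b] is_speciesD(2)[OF F b] by (auto simp: degreewise_def split: if_splits)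
  next
    fix U V W c d e \<sigma> \<tau> s
    assume b: "sorted_bij U c \<sigma> V d" "sorted_bij V d \<tau> W e" and "s \<in> structs (degreewise F) U c"
    then show "transport (degreewise F) U c (\<tau> \<circ> \<sigma>) s =
        transport (degreewise F) V d \<tau> (transport (degreewise F) U c \<sigma> s)"
      using D[OF b(1)] is_speciesD(4)[OF F b] by (auto simp: degreewise_def split: if_splits)
  next
    fix U V c d \<sigma> \<sigma>' s
    assume b: "sorted_bij U c \<sigma> V d" "\<And>u. u \<in> U \<Longrightarrow> \<sigma> u = \<sigma>' u" "s \<in> structs (degreewise F) U c"
    then show "transport (degreewise F) U c \<sigma> s = transport (degreewise F) U c \<sigma>' s"
      using is_speciesD(5)[OF F b(1,2)] by (auto simp: degreewise_def split: if_splits)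
  next
    fix U c s
    assume "finite U" "s \<in> structs (degreewise F) U c"
    then show "transport (degreewise F) U c id s = s"
      using is_speciesD(3)[OF F] by (auto simp: degreewise_def split: if_splits)
  qed (auto simp: degreewise_def is_speciesD(1)[OF F])
qed

lemma one_plus_X_c_exists: "\<exists>L :: (unit, label, label) virtual.
  is_virtual L \<and> no_empty L \<and> virt sp_E_plus \<circ>\<^sub>V L =\<^sub>V virt sp_X"
proof -
  let ?L = "(degreewise (\<lambda>n. fst (inverse_approx n)), degreewise (\<lambda>n. snd (inverse_approx n)))"
  have L: "is_virtual ?L"
    using is_virtual_inverse_approx unfolding is_virtual_def by (auto intro: is_species_degreewise)
  have ne: "no_empty ?L" unfolding no_empty_def degreewise_def by simp
  have um: "umark ?L U H = umark (inverse_approx (card U)) U H" if "U \<noteq> {}" for U H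
    using that unfolding umark_def vmark_def mark_def fixed_structs_def degreewise_def by simp
  have "umark (virt sp_E_plus \<circ>\<^sub>V ?L) U H = umark (virt sp_X) U H" if H: "group_on U H" for U H
  proof (cases "U = {}")
    case True then show ?thesis
      unfolding umark_comp_E_plus[OF L H] umark_virt mark_single by simp
  next
    case U: False
    then obtain n where n: "card U = Suc n"
      using group_onD(1)[OF H] by (metis card_0_eq not0_implies_Suc)
    have "orbit_prod H (`) P (\<lambda>B. umark ?L B (stab H B)) =
        orbit_prod H (`) P (\<lambda>B. umark (inverse_approx n) B (stab H B))"
      if P: "P \<in> inv_partitions U H - {{U}}" for P
    proof (rule orbit_prod_cong)
      show "group_acting H (`) P" using group_acting_blocks[OF H] P by blast
      fix B assume B: "B \<in> P"
      have P': "P \<in> inv_partitions U H" "P \<noteq> {U}" using P by auto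
      have "card B \<le> n" using block_card_less[OF group_onD(1)[OF H] P' B] n by simp
      then show "umark ?L B (stab H B) = umark (inverse_approx n) B (stab H B)"
        unfolding um[OF inv_partitionsD(4)[OF P'(1) B]]
        by (intro umark_inverse_approx_stable group_on_stab[OF H inv_partitionsD(3)[OF P'(1) B]]
            inv_partitionsD(4)[OF P'(1) B]) auto
    qed
    then show ?thesis
      unfolding umark_comp_E_plus[OF L H] plethysm_split_whole[OF H U] um[OF U] n
        umark_inverse_approx_Suc[OF H U] umark_virt mark_single using U by simp
  qed
  then have "virt sp_E_plus \<circ>\<^sub>V ?L =\<^sub>V virt sp_X"
    by (subst virtual_eq_iff_umark)
      (auto intro!: is_virtual_comp is_virtual_virt is_species_E_plus L is_species_single)
  then show ?thesis using L ne by blast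
qed

lemma one_plus_X_c:
  shows "is_virtual one_plus_X_c"
    and "group_on U H \<Longrightarrow> U \<noteq> {} \<Longrightarrow> plethysm one (umark one_plus_X_c) U H = of_bool (\<exists>u. U = {u})"
    and "umark one_plus_X_c {} H = 0"
proof -
  have L: "is_virtual one_plus_X_c" "no_empty one_plus_X_c"
    "virt sp_E_plus \<circ>\<^sub>V one_plus_X_c =\<^sub>V virt sp_X"
    using someI_ex[OF one_plus_X_c_exists] unfolding one_plus_X_c_def by blast+
  show "is_virtual one_plus_X_c" by (rule L)
  show "umark one_plus_X_c {} H = 0"
    using L(2) unfolding no_empty_def umark_def vmark_def mark_def fixed_structs_def by simp
  assume H: "group_on U H" and U: "U \<noteq> {}"
  have "umark (virt sp_E_plus \<circ>\<^sub>V one_plus_X_c) U H = umark (virt sp_X) U H"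
    using L(3) H by (subst (asm) virtual_eq_iff_umark)
      (auto intro!: is_virtual_comp is_virtual_virt is_species_E_plus L is_species_single)
  then show "plethysm one (umark one_plus_X_c) U H = of_bool (\<exists>u. U = {u})"
    unfolding umark_comp_E_plus[OF L(1) H] umark_virt mark_single using U by simp
qed

section \<open>Associativity of plethysm\<close>

text \<open>The property of marks stated in \<open>mark_conj\<close>, for a single sort.\<close>

definition invariant :: "(label set \<Rightarrow> (label \<Rightarrow> label) set \<Rightarrow> int) \<Rightarrow> bool" where
  "invariant f \<longleftrightarrow> (\<forall>U H V K j. group_on U H \<longrightarrow> bij_betw j U V \<longrightarrow>
     (\<forall>\<sigma>\<in>H. \<exists>\<tau>\<in>K. \<forall>u\<in>U. \<tau> (j u) = j (\<sigma> u)) \<longrightarrow>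
     (\<forall>\<tau>\<in>K. \<exists>\<sigma>\<in>H. \<forall>u\<in>U. \<tau> (j u) = j (\<sigma> u)) \<longrightarrow> f V K = f U H)"

lemma invariant_umark:
  assumes "is_virtual V"
  shows "invariant (umark V)"
proof -
  have s: "is_species (fst V)" "is_species (snd V)" using assms unfolding is_virtual_def by auto
  have "umark V W K = umark V U H"
    if "group_on U H" "bij_betw j U W" "\<forall>\<sigma>\<in>H. \<exists>\<tau>\<in>K. \<forall>u\<in>U. \<tau> (j u) = j (\<sigma> u)"
      "\<forall>\<tau>\<in>K. \<exists>\<sigma>\<in>H. \<forall>u\<in>U. \<tau> (j u) = j (\<sigma> u)" for U H W K j
  proof -
    have b: "sorted_bij U (\<lambda>_. ()) j W (\<lambda>_. ())"
      using that(2) group_onD(1)[OF that(1)] by (simp add: sorted_bij_unit)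
    show ?thesis
      unfolding umark_def vmark_def
      using mark_conj[OF s(1) b that(1), of K] mark_conj[OF s(2) b that(1), of K] that(3,4) by simp
  qed
  then show ?thesis unfolding invariant_def by simp
qed

lemma stab_conj:
  assumes H: "group_on U H" and s: "\<sigma> \<in> H" and B: "B \<subseteq> U"
  shows "\<forall>k\<in>stab H B. \<exists>\<tau>\<in>stab H (\<sigma> ` B). \<forall>u\<in>B. \<tau> (\<sigma> u) = \<sigma> (k u)"
    and "\<forall>\<tau>\<in>stab H (\<sigma> ` B). \<exists>k\<in>stab H B. \<forall>u\<in>B. \<tau> (\<sigma> u) = \<sigma> (k u)"
proof -
  interpret group_acting H "\<lambda>\<sigma>. \<sigma>" U using group_onD(2)[OF H] .
  obtain \<rho> where r: "\<rho> \<in> H" "\<forall>x\<in>U. \<rho> (\<sigma> x) = x" "\<forall>x\<in>U. \<sigma> (\<rho> x) = x"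
    using inverse_both[OF s] by blast
  show "\<forall>k\<in>stab H B. \<exists>\<tau>\<in>stab H (\<sigma> ` B). \<forall>u\<in>B. \<tau> (\<sigma> u) = \<sigma> (k u)"
  proof
    fix k assume k: "k \<in> stab H B"
    then have kH: "k \<in> H" "k ` B = B" unfolding stab_def by auto
    obtain \<pi> where p: "\<pi> \<in> H" "\<forall>x\<in>U. \<pi> x = k (\<rho> x)" using product[OF kH(1) r(1)] by blast
    obtain \<tau> where t: "\<tau> \<in> H" "\<forall>x\<in>U. \<tau> x = \<sigma> (\<pi> x)" using product[OF s p(1)] by blast
    have e: "\<tau> (\<sigma> u) = \<sigma> (k u)" if "u \<in> B" for u
    proof -
      have u: "u \<in> U" using that B by blast
      show ?thesis using t(2) p(2) r(2) closed[OF s u] u by simp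
    qed
    have "\<tau> ` \<sigma> ` B = \<sigma> ` k ` B" unfolding image_image using e by (intro image_cong) auto
    then have "\<tau> \<in> stab H (\<sigma> ` B)" using t(1) kH(2) unfolding stab_def by simp
    then show "\<exists>\<tau>\<in>stab H (\<sigma> ` B). \<forall>u\<in>B. \<tau> (\<sigma> u) = \<sigma> (k u)" using e by blast
  qed
  show "\<forall>\<tau>\<in>stab H (\<sigma> ` B). \<exists>k\<in>stab H B. \<forall>u\<in>B. \<tau> (\<sigma> u) = \<sigma> (k u)"
  proof
    fix \<tau> assume t: "\<tau> \<in> stab H (\<sigma> ` B)"
    then have tH: "\<tau> \<in> H" "\<tau> ` \<sigma> ` B = \<sigma> ` B" unfolding stab_def by auto
    obtain \<pi> where p: "\<pi> \<in> H" "\<forall>x\<in>U. \<pi> x = \<tau> (\<sigma> x)" using product[OF tH(1) s] by blast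
    obtain k where k: "k \<in> H" "\<forall>x\<in>U. k x = \<rho> (\<pi> x)" using product[OF r(1) p(1)] by blast
    have e: "\<tau> (\<sigma> u) = \<sigma> (k u)" if "u \<in> B" for u
    proof -
      have u: "u \<in> U" using that B by blast
      show ?thesis using k(2) p(2) r(3) closed[OF p(1) u] u by simp
    qed
    have "k ` B = \<rho> ` \<tau> ` \<sigma> ` B"
      unfolding image_image using B k(2) p(2) by (intro image_cong) auto
    also have "\<dots> = \<rho> ` \<sigma> ` B" unfolding tH(2) ..
    also have "\<dots> = (\<lambda>u. u) ` B" unfolding image_image using r(2) B by (intro image_cong) auto
    also have "\<dots> = B" by simp
    finally have "k \<in> stab H B" using k(1) unfolding stab_def by simp
    then show "\<exists>k\<in>stab H B. \<forall>u\<in>B. \<tau> (\<sigma> u) = \<sigma> (k u)" using e by blast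
  qed
qed

lemma invariant_stab:
  assumes h: "invariant h" and H: "group_on U H" and s: "\<sigma> \<in> H" and B: "B \<subseteq> U"
  shows "h (\<sigma> ` B) (stab H (\<sigma> ` B)) = h B (stab H B)"
proof -
  have "bij_betw \<sigma> B (\<sigma> ` B)"
    using group_onD(4)[OF H s] B unfolding bij_betw_def by (auto intro: inj_on_subset)
  then show ?thesis
    using h group_on_stab[OF H B] stab_conj[OF H s B] unfolding invariant_def by blast
qed

definition refines :: "'x set set \<Rightarrow> 'x set set \<Rightarrow> bool" where
  "refines R P \<longleftrightarrow> (\<forall>C\<in>R. \<exists>B\<in>P. C \<subseteq> B)"

definition below :: "'x set set \<Rightarrow> 'x set \<Rightarrow> 'x set set" where
  "below R B = {C\<in>R. C \<subseteq> B}"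

locale refinement =
  fixes U :: "label set" and H R P
  assumes H: "group_on U H" and R: "R \<in> inv_partitions U H" and P: "P \<in> inv_partitions U H"
    and RP: "refines R P"
begin

lemma unique_above: "C \<in> R \<Longrightarrow> B \<in> P \<Longrightarrow> x \<in> C \<Longrightarrow> x \<in> B \<Longrightarrow> C \<subseteq> B"
  using RP inv_partitionsD(8)[OF P] unfolding refines_def by blast

lemma Union_below: "B \<in> P \<Longrightarrow> \<Union>(below R B) = B"
proof
  show "B \<in> P \<Longrightarrow> \<Union>(below R B) \<subseteq> B" unfolding below_def by blast
  show "B \<subseteq> \<Union>(below R B)" if B: "B \<in> P"
  proof
    fix x assume x: "x \<in> B"
    then have "x \<in> U" using inv_partitionsD(3)[OF P B] by blast
    then obtain C where "C \<in> R" "x \<in> C" using inv_partitionsD(7)[OF R] by blast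
    then show "x \<in> \<Union>(below R B)" using unique_above[OF _ B _ x] unfolding below_def by blast
  qed
qed

lemma stab_mono: "B \<in> P \<Longrightarrow> C \<in> below R B \<Longrightarrow> stab H C \<subseteq> stab H B"
proof
  fix \<sigma> assume B: "B \<in> P" and C: "C \<in> below R B" and "\<sigma> \<in> stab H C"
  then have s: "\<sigma> \<in> H" "\<sigma> ` C = C" unfolding stab_def by auto
  have C': "C \<in> R" "C \<subseteq> B" using C unfolding below_def by auto
  obtain x where x: "x \<in> C" using inv_partitionsD(4)[OF R C'(1)] by blast
  have "x \<in> \<sigma> ` B" using x s(2) C'(2) by blast
  then have "\<sigma> ` B = B"
    using inv_partitionsD(8)[OF P inv_partitionsD(2)[OF P s(1) B] B] x C'(2) by blast
  then show "\<sigma> \<in> stab H B" using s(1) unfolding stab_def by simp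
qed

lemma stab_stab_below: "B \<in> P \<Longrightarrow> C \<in> below R B \<Longrightarrow> stab (stab H B) C = stab H C"
  using stab_stab stab_mono unfolding below_def by blast

lemma below_inv_partition:
  assumes B: "B \<in> P"
  shows "below R B \<in> inv_partitions B (stab H B)"
proof -
  have "partition_on B (below R B)"
  proof (rule partition_onI)
    show "\<Union>(below R B) = B" by (rule Union_below[OF B])
    show "{} \<notin> below R B" using inv_partitionsD(4)[OF R] unfolding below_def by blast
    fix C D assume "C \<in> below R B" "D \<in> below R B" "C \<noteq> D"
    then show "disjnt C D"
      using inv_partitionsD(8)[OF R, of C D] unfolding below_def disjnt_def by blast
  qed
  moreover have "\<sigma> ` C \<in> below R B" if "\<sigma> \<in> stab H B" "C \<in> below R B" for \<sigma> C
    using that inv_partitionsD(2)[OF R, of \<sigma> C] image_mono[of C B \<sigma>] unfolding below_def stab_def by auto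
  ultimately show ?thesis unfolding inv_partitions_def by blast
qed

lemma below_image:
  assumes s: "\<sigma> \<in> H" and B: "B \<in> P"
  shows "below R (\<sigma> ` B) = (`) \<sigma> ` below R B"
proof
  interpret group_acting H "\<lambda>\<sigma>. \<sigma>" U using group_onD(2)[OF H] .
  show "(`) \<sigma> ` below R B \<subseteq> below R (\<sigma> ` B)"
    using inv_partitionsD(2)[OF R s] unfolding below_def by auto
  obtain \<rho> where r: "\<rho> \<in> H" "\<forall>x\<in>U. \<rho> (\<sigma> x) = x" "\<forall>x\<in>U. \<sigma> (\<rho> x) = x"
    using inverse_both[OF s] by blast
  show "below R (\<sigma> ` B) \<subseteq> (`) \<sigma> ` below R B"
  proof
    fix C assume "C \<in> below R (\<sigma> ` B)"
    then have C: "C \<in> R" "C \<subseteq> \<sigma> ` B" unfolding below_def by auto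
    have "C = \<sigma> ` \<rho> ` C"
    proof -
      have "(\<lambda>x. \<sigma> (\<rho> x)) ` C = (\<lambda>x. x) ` C"
        using r(3) inv_partitionsD(3)[OF R C(1)] by (intro image_cong) auto
      then show ?thesis by (simp add: image_image)
    qed
    moreover have "\<rho> x \<in> B" if x: "x \<in> C" for x
    proof -
      obtain y where "y \<in> B" "x = \<sigma> y" using C(2) x by blast
      then show ?thesis using r(2) inv_partitionsD(3)[OF P B] by auto
    qed
    then have "\<rho> ` C \<subseteq> B" by blast
    then have "\<rho> ` C \<in> below R B" using inv_partitionsD(2)[OF R r(1) C(1)] unfolding below_def by simp
    ultimately show "C \<in> (`) \<sigma> ` below R B" by (metis image_eqI)
  qed
qed

lemma UN_below: "(\<Union>B\<in>P. below R B) = R"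
  using RP unfolding below_def refines_def by auto

text \<open>A transversal of the blocks of \<open>R\<close> is obtained by taking a transversal of the blocks of \<open>P\<close> and,
inside each block \<open>B\<close> in it, a transversal for the stabilizer of \<open>B\<close>.\<close>

lemma orbit_prod_refinement:
  assumes v: "\<And>\<sigma> C. \<sigma> \<in> H \<Longrightarrow> C \<in> R \<Longrightarrow> v (\<sigma> ` C) = v C"
  shows "orbit_prod H (`) P (\<lambda>B. orbit_prod (stab H B) (`) (below R B) v) = orbit_prod H (`) R v"
proof -
  interpret P: group_acting H "(`)" P by (rule group_acting_blocks[OF H P])
  interpret R: group_acting H "(`)" R by (rule group_acting_blocks[OF H R])
  have fin: "finite P" "finite R" using inv_partitionsD(5) group_onD(1)[OF H] P R by blast+
  let ?T = "transv H (`) P"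
  define S where "S B = transv (stab H B) (`) (below R B)" for B
  have TP: "?T \<subseteq> P" by (rule P.transv_sub)
  have gb: "group_acting (stab H B) (`) (below R B)" if B: "B \<in> P" for B
    by (rule group_acting_blocks[OF group_on_stab[OF H inv_partitionsD(3)[OF P B]] below_inv_partition[OF B]])
  have Ssub: "S B \<subseteq> below R B" if "B \<in> P" for B
    unfolding S_def by (rule group_acting.transv_sub[OF gb[OF that]])
  have Str: "transversal (stab H B) (`) (below R B) (S B)" if "B \<in> P" for B
    unfolding S_def by (rule group_acting.transv[OF gb[OF that]])
  have only: "B = B'" if "C \<in> below R B" "C \<in> below R B'" "B \<in> P" "B' \<in> P" for B B' C
  proof -
    have "C \<in> R" "C \<subseteq> B" "C \<subseteq> B'" using that unfolding below_def by auto
    moreover from this obtain x where "x \<in> C" using inv_partitionsD(4)[OF R] by blast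
    ultimately show ?thesis using inv_partitionsD(8)[OF P that(3,4), of x] by blast
  qed
  have tr: "transversal H (`) R (\<Union>B\<in>?T. S B)"
    unfolding transversal_def
  proof (intro conjI ballI)
    show "(\<Union>B\<in>?T. S B) \<subseteq> R" using Ssub TP unfolding below_def by blast
    fix C assume C: "C \<in> R"
    then obtain B where B: "B \<in> P" "C \<in> below R B" using UN_below by blast
    obtain t \<sigma> where t: "t \<in> ?T" "\<sigma> \<in> H" "\<sigma> ` t = B"
      using P.transv B(1) unfolding transversal_def by metis
    have tP: "t \<in> P" using TP t(1) by blast
    have "C \<in> (`) \<sigma> ` below R t" using B(2) below_image[OF t(2) tP] t(3) by simp
    then obtain D where D: "D \<in> below R t" "\<sigma> ` D = C" by auto
    obtain E \<tau> where E: "E \<in> S t" "\<tau> \<in> stab H t" "\<tau> ` E = D"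
      using Str[OF tP] D(1) unfolding transversal_def by metis
    have ER: "E \<in> R" using Ssub[OF tP] E(1) unfolding below_def by blast
    have tau: "\<tau> \<in> H" using E(2) unfolding stab_def by simp
    obtain \<pi> where p: "\<pi> \<in> H" "\<forall>x\<in>R. \<pi> ` x = \<sigma> ` \<tau> ` x" using R.product[OF t(2) tau] by blast
    have piE: "\<pi> ` E = C" using p(2) ER E(3) D(2) by simp
    show "\<exists>!E. E \<in> (\<Union>B\<in>?T. S B) \<and> (\<exists>\<sigma>\<in>H. \<sigma> ` E = C)"
    proof (rule ex1I[of _ E])
      show "E \<in> (\<Union>B\<in>?T. S B) \<and> (\<exists>\<sigma>\<in>H. \<sigma> ` E = C)" using E(1) t(1) p(1) piE by blast
    next
      fix E' assume "E' \<in> (\<Union>B\<in>?T. S B) \<and> (\<exists>\<sigma>\<in>H. \<sigma> ` E' = C)"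
      then obtain t' \<sigma>' where t': "t' \<in> ?T" "E' \<in> S t'" "\<sigma>' \<in> H" "\<sigma>' ` E' = C" by blast
      have t'P: "t' \<in> P" using TP t'(1) by blast
      have E'b: "E' \<in> below R t'" using Ssub[OF t'P] t'(2) by blast
      have "C \<in> below R (\<sigma>' ` t')" unfolding below_image[OF t'(3) t'P] using E'b t'(4) by blast
      then have "\<sigma>' ` t' = B" using only[OF _ B(2) inv_partitionsD(2)[OF P t'(3) t'P] B(1)] by blast
      then have tt: "t' = t" using P.transv B(1) t t'(1,3) unfolding transversal_def by metis
      obtain \<rho> where r: "\<rho> \<in> H" "\<forall>x\<in>R. \<rho> ` \<pi> ` x = x" using R.inverse[OF p(1)] by blast
      obtain \<kappa> where k: "\<kappa> \<in> H" "\<forall>x\<in>R. \<kappa> ` x = \<rho> ` \<sigma>' ` x" using R.product[OF r(1) t'(3)] by blast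
      have E'R: "E' \<in> R" using E'b unfolding below_def by blast
      have kE: "\<kappa> ` E' = E"
        using bspec[OF k(2) E'R] bspec[OF r(2) ER] unfolding t'(4) piE by simp
      have Eb: "E \<in> below R t" using Ssub[OF tP] E(1) by blast
      have "E \<in> below R (\<kappa> ` t)" unfolding below_image[OF k(1) tP] using E'b kE tt by blast
      then have "\<kappa> ` t = t" using only[OF _ Eb inv_partitionsD(2)[OF P k(1) tP] tP] by blast
      then have ks: "\<kappa> \<in> stab H t" using k(1) unfolding stab_def by simp
      obtain \<iota> where "\<iota> \<in> stab H t" "\<forall>x\<in>below R t. \<iota> ` x = x"
        using group_acting.neutral[OF gb[OF tP]] by (elim bexE)
      then have i: "\<iota> ` E = E" "\<iota> \<in> stab H t" using Eb by simp_all
      have "\<exists>!s. s \<in> S t \<and> (\<exists>\<sigma>\<in>stab H t. \<sigma> ` s = E)"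
        using Str[OF tP] Eb unfolding transversal_def by simp
      moreover have "E' \<in> S t \<and> (\<exists>\<sigma>\<in>stab H t. \<sigma> ` E' = E)"
        using t'(2) ks kE unfolding tt by (intro conjI bexI[of _ \<kappa>])
      moreover have "E \<in> S t \<and> (\<exists>\<sigma>\<in>stab H t. \<sigma> ` E = E)"
        using E(1) i by (intro conjI bexI[of _ \<iota>])
      ultimately show "E' = E" by (elim ex1E) metis
    qed
  qed
  have "orbit_prod H (`) R v = prod v (\<Union>B\<in>?T. S B)"
    by (rule R.orbit_prod_eq[OF tr v])
  also have "\<dots> = (\<Prod>B\<in>?T. prod v (S B))"
  proof (rule prod.UNION_disjoint)
    show "finite ?T" using TP fin(1) finite_subset by blast
    show "\<forall>B\<in>?T. finite (S B)"
    proof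
      fix B assume "B \<in> ?T"
      then have "S B \<subseteq> below R B" using Ssub TP by (simp add: subsetD)
      then show "finite (S B)" by (rule finite_subset) (simp add: below_def fin(2))
    qed
    show "\<forall>B\<in>?T. \<forall>B'\<in>?T. B \<noteq> B' \<longrightarrow> S B \<inter> S B' = {}"
    proof (intro ballI impI equals0I)
      fix B B' C assume BB: "B \<in> ?T" "B' \<in> ?T" "B \<noteq> B'" and "C \<in> S B \<inter> S B'"
      then have C: "C \<in> S B" "C \<in> S B'" by simp_all
      have BP: "B \<in> P" "B' \<in> P" using BB(1,2) TP by (simp_all add: subsetD)
      show False using only[OF subsetD[OF Ssub[OF BP(1)] C(1)] subsetD[OF Ssub[OF BP(2)] C(2)] BP] BB(3) by simp
    qed
  qed
  finally show ?thesis unfolding orbit_prod_def S_def by simp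
qed

end

lemma bundle_acting_set_systems:
  fixes A :: "label set \<Rightarrow> label set set set"
  assumes H: "group_on U H" and P: "P \<in> inv_partitions U H"
    and A: "\<And>B Q. B \<in> P \<Longrightarrow> Q \<in> A B \<Longrightarrow> Q \<subseteq> Pow U"
    and cl: "\<And>\<sigma> B Q. \<sigma> \<in> H \<Longrightarrow> B \<in> P \<Longrightarrow> Q \<in> A B \<Longrightarrow> (`) \<sigma> ` Q \<in> A (\<sigma> ` B)"
  shows "bundle_acting H (`) P A (\<lambda>\<sigma> B Q. (`) \<sigma> ` Q)"
proof -
  interpret P: group_acting H "(`)" P by (rule group_acting_blocks[OF H P])
  have g1: "group_acting H (`) (Pow U)" by (rule group_acting_Pow[OF group_onD(2)[OF H]])
  interpret U: group_acting H "\<lambda>\<sigma>. \<sigma>" U by (rule group_onD(2)[OF H])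
  note sub = A
  have img: "(`) \<rho> ` Q = Q'" if "\<And>C. C \<subseteq> U \<Longrightarrow> \<rho> ` C = \<phi> C" "Q' = \<phi> ` Q" "Q \<subseteq> Pow U" for \<rho> \<phi> Q Q'
    using that by (auto intro!: image_cong)
  show ?thesis
  proof
    show "(case x of (B, a) \<Rightarrow> (\<sigma> ` B, (`) \<sigma> ` a)) \<in> Sigma P A"
      if s: "\<sigma> \<in> H" and x: "x \<in> Sigma P A" for \<sigma> x
    proof -
      obtain B Q where BQ: "x = (B, Q)" "B \<in> P" "Q \<in> A B" using x by auto
      show ?thesis using cl[OF s BQ(2,3)] P.closed[OF s BQ(2)] BQ(1) by simp
    qed
    show "\<exists>\<iota>\<in>H. \<forall>x\<in>Sigma P A. (case x of (B, a) \<Rightarrow> (\<iota> ` B, (`) \<iota> ` a)) = x"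
    proof -
      obtain \<iota> where i: "\<iota> \<in> H" "\<forall>C\<in>Pow U. \<iota> ` C = C" using group_acting.neutral[OF g1] by blast
      have "\<iota> ` B = B \<and> (`) \<iota> ` Q = Q" if "B \<in> P" "Q \<in> A B" for B Q
        using i(2) inv_partitionsD(3)[OF P that(1)] img[of \<iota> id Q Q] sub[OF that] by auto
      then show ?thesis by (intro bexI[OF _ i(1)]) auto
    qed
    show "\<exists>\<rho>\<in>H. \<forall>x\<in>Sigma P A. (case x of (B, a) \<Rightarrow> (\<rho> ` B, (`) \<rho> ` a)) =
        (case case x of (B, a) \<Rightarrow> (\<tau> ` B, (`) \<tau> ` a) of (B, a) \<Rightarrow> (\<sigma> ` B, (`) \<sigma> ` a))"
      if k: "\<sigma> \<in> H" "\<tau> \<in> H" for \<sigma> \<tau>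
    proof -
      obtain \<rho> where i: "\<rho> \<in> H" "\<forall>C\<in>Pow U. \<rho> ` C = \<sigma> ` \<tau> ` C"
        using group_acting.product[OF g1 k] by blast
      have "\<rho> ` B = \<sigma> ` \<tau> ` B \<and> (`) \<rho> ` Q = (`) \<sigma> ` (`) \<tau> ` Q" if "B \<in> P" "Q \<in> A B" for B Q
      proof
        show "\<rho> ` B = \<sigma> ` \<tau> ` B" using i(2) inv_partitionsD(3)[OF P that(1)] by simp
        show "(`) \<rho> ` Q = (`) \<sigma> ` (`) \<tau> ` Q"
        proof (rule img)
          show "(`) \<sigma> ` (`) \<tau> ` Q = (\<lambda>C. \<sigma> ` \<tau> ` C) ` Q" by (rule image_image)
        qed (use i(2) sub[OF that] in simp_all)
      qed
      then show ?thesis by (intro bexI[OF _ i(1)]) auto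
    qed
    show "\<exists>\<rho>\<in>H. \<forall>x\<in>Sigma P A.
        (case case x of (B, a) \<Rightarrow> (\<sigma> ` B, (`) \<sigma> ` a) of (B, a) \<Rightarrow> (\<rho> ` B, (`) \<rho> ` a)) = x"
      if k: "\<sigma> \<in> H" for \<sigma>
    proof -
      obtain \<rho> where i: "\<rho> \<in> H" "\<forall>C\<in>Pow U. \<rho> ` \<sigma> ` C = C"
        using group_acting.inverse[OF g1 k] by blast
      have "\<rho> ` \<sigma> ` B = B \<and> (`) \<rho> ` (`) \<sigma> ` Q = Q" if "B \<in> P" "Q \<in> A B" for B Q
      proof -
        have "(\<lambda>C. \<rho> ` \<sigma> ` C) ` Q = (\<lambda>C. C) ` Q"
          using i(2) sub[OF that] by (intro image_cong) auto
        then show ?thesis using i(2) inv_partitionsD(3)[OF P that(1)] by (simp add: image_image)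
      qed
      then show ?thesis by (intro bexI[OF _ i(1)]) auto
    qed
  qed
qed

lemma bundle_acting_partitions:
  assumes H: "group_on U H" and P: "P \<in> inv_partitions U H"
  shows "bundle_acting H (`) P (\<lambda>B. {Q. partition_on B Q}) (\<lambda>\<sigma> B Q. (`) \<sigma> ` Q)"
proof (rule bundle_acting_set_systems[OF H P])
  fix B Q assume B: "B \<in> P" and "Q \<in> {Q. partition_on B Q}"
  then have Q: "partition_on B Q" by simp
  show "Q \<subseteq> Pow U" using partition_block(1)[OF Q] inv_partitionsD(3)[OF P B] by blast
  fix \<sigma> assume s: "\<sigma> \<in> H"
  have "inj_on \<sigma> B" using group_onD(4)[OF H s] inv_partitionsD(3)[OF P B] by (rule inj_on_subset)
  then show "(`) \<sigma> ` Q \<in> {Q. partition_on (\<sigma> ` B) Q}" using partition_image[OF Q] by simp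
qed

text \<open>A partition finer than \<open>P\<close> is a family of partitions of the blocks of \<open>P\<close>; it is invariant iff
the family is equivariant.\<close>

lemma sum_partition_families:
  assumes H: "group_on U H" and P: "P \<in> inv_partitions U H"
  shows "(\<Sum>R | R \<in> inv_partitions U H \<and> refines R P. orbit_prod H (`) P (\<lambda>B. \<phi> B (below R B))) =
    orbit_prod H (`) P (\<lambda>B. \<Sum>Q\<in>inv_partitions B (stab H B). \<phi> B Q)"
proof -
  let ?A = "\<lambda>B. {Q :: label set set. partition_on B Q}" and ?tr = "\<lambda>\<sigma> (B :: label set) Q. (`) \<sigma> ` Q"
  let ?E = "eqv_fam H (`) P ?A ?tr"
  have U: "finite U" by (rule group_onD(1)[OF H])
  have fixed: "stab_fixed H (`) ?A ?tr B = inv_partitions B (stab H B)" if B: "B \<in> P" for B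
  proof -
    have BU: "B \<subseteq> U" by (rule inv_partitionsD(3)[OF P B])
    have "(`) \<sigma> ` Q = Q \<longleftrightarrow> (\<forall>C\<in>Q. \<sigma> ` C \<in> Q)"
      if s: "\<sigma> \<in> H" and Q: "partition_on B Q" for \<sigma> Q
    proof
      assume "\<forall>C\<in>Q. \<sigma> ` C \<in> Q"
      moreover have "inj_on ((`) \<sigma>) Q"
        using inj_on_image[of \<sigma> Q] Q inj_on_subset[OF group_onD(4)[OF H s] BU]
        unfolding partition_on_def by simp
      moreover have "finite Q" using finite_elements[OF finite_subset[OF BU U] Q] .
      ultimately show "(`) \<sigma> ` Q = Q" by (simp add: endo_inj_surj image_subset_iff)
    qed auto
    then have "{Q. partition_on B Q \<and> (\<forall>\<sigma>\<in>H. \<sigma> ` B = B \<longrightarrow> (`) \<sigma> ` Q = Q)} =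
        {Q. partition_on B Q \<and> (\<forall>\<sigma>\<in>H. \<sigma> ` B = B \<longrightarrow> (\<forall>C\<in>Q. \<sigma> ` C \<in> Q))}"
      by (intro Collect_cong conj_cong ball_cong imp_cong refl) auto
    then show ?thesis unfolding stab_fixed_def inv_partitions_def stab_def by (simp add: Ball_def imp_conjL)
  qed
  have "(\<Sum>R | R \<in> inv_partitions U H \<and> refines R P. orbit_prod H (`) P (\<lambda>B. \<phi> B (below R B))) =
      (\<Sum>g\<in>?E. orbit_prod H (`) P (\<lambda>B. \<phi> B (g B)))"
  proof (rule sum.reindex_bij_witness[where i = "\<lambda>g. \<Union>B\<in>P. g B" and j = "\<lambda>R. \<lambda>B\<in>P. below R B"])
    fix R assume "R \<in> {R. R \<in> inv_partitions U H \<and> refines R P}"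
    then interpret refinement U H R P using H P by unfold_locales auto
    show "(\<Union>B\<in>P. (\<lambda>B\<in>P. below R B) B) = R" using UN_below by simp
    show "(\<lambda>B\<in>P. below R B) \<in> ?E"
      unfolding eqv_fam_def
      using below_image inv_partitionsD(1)[OF below_inv_partition] inv_partitionsD(2)[OF P] by auto
    show "orbit_prod H (`) P (\<lambda>B. \<phi> B ((\<lambda>B\<in>P. below R B) B)) = orbit_prod H (`) P (\<lambda>B. \<phi> B (below R B))"
      by (rule orbit_prod_cong[OF group_acting_blocks[OF H P]]) simp
  next
    fix g assume g: "g \<in> ?E"
    let ?R = "\<Union>B\<in>P. g B"
    have gp: "partition_on B (g B)" if "B \<in> P" for B using g that unfolding eqv_fam_def by auto
    have ge: "g (\<sigma> ` B) = (`) \<sigma> ` g B" if "\<sigma> \<in> H" "B \<in> P" for \<sigma> B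
      using g that unfolding eqv_fam_def by auto
    have same: "B = B'" if "B \<in> P" "B' \<in> P" "C \<in> g B" "D \<in> g B'" "x \<in> C" "x \<in> D" for B B' C D x
      using inv_partitionsD(8)[OF P that(1,2), of x] partition_block(1)[OF gp[OF that(1)] that(3)]
        partition_block(1)[OF gp[OF that(2)] that(4)] that(5,6) by blast
    have pR: "partition_on U ?R"
    proof (rule partition_onI)
      have "\<Union>?R = (\<Union>B\<in>P. \<Union>(g B))" by blast
      also have "\<dots> = (\<Union>B\<in>P. B)" using partition_onD1[OF gp] by (intro SUP_cong) auto
      finally show "\<Union>?R = U" using inv_partitionsD(7)[OF P] by simp
      show "{} \<notin> ?R" using partition_block(2)[OF gp] by blast
      fix C D assume "C \<in> ?R" "D \<in> ?R" "C \<noteq> D"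
      then obtain B B' where B: "B \<in> P" "B' \<in> P" "C \<in> g B" "D \<in> g B'" by blast
      show "disjnt C D"
      proof (cases "B = B'")
        case True
        then show ?thesis
          using B \<open>C \<noteq> D\<close> partition_onD2[OF gp[OF B(1)]] unfolding disjoint_def disjnt_def by auto
      next
        case False
        then show ?thesis using same[OF B] unfolding disjnt_def by blast
      qed
    qed
    have inv: "\<sigma> ` C \<in> ?R" if s: "\<sigma> \<in> H" "C \<in> ?R" for \<sigma> C
    proof -
      obtain B where B: "B \<in> P" "C \<in> g B" using s(2) by blast
      then have "\<sigma> ` C \<in> g (\<sigma> ` B)" using ge[OF s(1) B(1)] by simp
      then show ?thesis using inv_partitionsD(2)[OF P s(1) B(1)] by blast
    qed
    have ref: "refines ?R P" unfolding refines_def using partition_block(1)[OF gp] by blast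
    show "?R \<in> {R. R \<in> inv_partitions U H \<and> refines R P}"
      using pR inv ref unfolding inv_partitions_def by blast
    show "(\<lambda>B\<in>P. below ?R B) = g"
    proof (rule extensionalityI[of _ P])
      show "g \<in> extensional P" using g unfolding eqv_fam_def by (auto simp: PiE_def)
      fix B assume B: "B \<in> P"
      have "below ?R B = g B"
      proof
        show "g B \<subseteq> below ?R B" unfolding below_def using B partition_block(1)[OF gp[OF B]] by blast
        show "below ?R B \<subseteq> g B"
        proof
          fix C assume "C \<in> below ?R B"
          then obtain B' where B': "B' \<in> P" "C \<in> g B'" "C \<subseteq> B" unfolding below_def by blast
          obtain x where "x \<in> C" using partition_block(2)[OF gp[OF B'(1)] B'(2)] by blast
          then have "B' = B"
            using inv_partitionsD(8)[OF P B'(1) B, of x] partition_block(1)[OF gp[OF B'(1)] B'(2)] B'(3) by blast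
          then show "C \<in> g B" using B'(2) by simp
        qed
      qed
      then show "(\<lambda>B\<in>P. below ?R B) B = g B" using B by simp
    qed auto
  qed
  also have "\<dots> = orbit_prod H (`) P (\<lambda>B. \<Sum>Q\<in>stab_fixed H (`) ?A ?tr B. \<phi> B Q)"
    by (rule bundle_acting.sum_eqv_fam[OF bundle_acting_partitions[OF H P]])
      (use inv_partitionsD(5,6)[OF P U] finitely_many_partition_on in auto)
  also have "\<dots> = orbit_prod H (`) P (\<lambda>B. \<Sum>Q\<in>inv_partitions B (stab H B). \<phi> B Q)"
    by (rule orbit_prod_cong[OF group_acting_blocks[OF H P]]) (simp add: fixed)
  finally show ?thesis .
qed

lemma orbit_prod_mult: "orbit_prod H act S (\<lambda>x. v x * w x) = orbit_prod H act S v * orbit_prod H act S w"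
  unfolding orbit_prod_def by (rule prod.distrib)

lemma orbit_prod_plethysm:
  assumes H: "group_on U H" and P: "P \<in> inv_partitions U H" and h: "invariant h"
  shows "orbit_prod H (`) P (\<lambda>B. plethysm f h B (stab H B)) =
    (\<Sum>R | R \<in> inv_partitions U H \<and> refines R P.
       orbit_prod H (`) P (\<lambda>B. f (blk ` below R B) (lift ` stab H B)) *
       orbit_prod H (`) R (\<lambda>C. h C (stab H C)))"
proof -
  define \<phi> where "\<phi> B Q = f (blk ` Q) (lift ` stab H B) *
      orbit_prod (stab H B) (`) Q (\<lambda>C. h C (stab (stab H B) C))" for B Q
  have "orbit_prod H (`) P (\<lambda>B. \<phi> B (below R B)) =
      orbit_prod H (`) P (\<lambda>B. f (blk ` below R B) (lift ` stab H B)) *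
       orbit_prod H (`) R (\<lambda>C. h C (stab H C))"
    if R: "R \<in> inv_partitions U H" "refines R P" for R
  proof -
    interpret refinement U H R P using H P R by unfold_locales auto
    have "orbit_prod H (`) P (\<lambda>B. orbit_prod (stab H B) (`) (below R B) (\<lambda>C. h C (stab (stab H B) C))) =
        orbit_prod H (`) P (\<lambda>B. orbit_prod (stab H B) (`) (below R B) (\<lambda>C. h C (stab H C)))"
    proof (rule orbit_prod_cong[OF group_acting_blocks[OF H P]])
      fix B assume B: "B \<in> P"
      show "orbit_prod (stab H B) (`) (below R B) (\<lambda>C. h C (stab (stab H B) C)) =
          orbit_prod (stab H B) (`) (below R B) (\<lambda>C. h C (stab H C))"
        by (rule orbit_prod_cong[OF group_acting_blocks[OF
              group_on_stab[OF H inv_partitionsD(3)[OF P B]] below_inv_partition[OF B]]])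
          (simp add: stab_stab_below[OF B])
    qed
    also have "\<dots> = orbit_prod H (`) R (\<lambda>C. h C (stab H C))"
      by (rule orbit_prod_refinement) (rule invariant_stab[OF h H _ inv_partitionsD(3)[OF R(1)]])
    finally show ?thesis unfolding \<phi>_def orbit_prod_mult by simp
  qed
  then show ?thesis
    unfolding plethysm_def \<phi>_def[symmetric] sum_partition_families[OF H P, symmetric] by (intro sum.cong) auto
qed

text \<open>A partition coarser than \<open>R\<close> is a partition of the set of blocks of \<open>R\<close>.\<close>

lemma sum_coarsenings:
  assumes H: "group_on U H" and R: "R \<in> inv_partitions U H" and f: "invariant f"
  shows "(\<Sum>P | P \<in> inv_partitions U H \<and> refines R P.
       orbit_prod H (`) P (\<lambda>B. f (blk ` below R B) (lift ` stab H B))) =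
     plethysm one f (blk ` R) (lift ` H)"
proof -
  have U: "finite U" by (rule group_onD(1)[OF H])
  have finR: "finite C" if "C \<in> R" for C using inv_partitionsD(6)[OF R U that] .
  note L = group_on_lift[OF H R]
  have ublk: "unblk ` blk ` X = X" if "X \<subseteq> R" for X
  proof -
    have "(\<lambda>C. unblk (blk C)) ` X = (\<lambda>C. C) ` X" using finR that by (intro image_cong) auto
    then show ?thesis by (simp add: image_image)
  qed
  have bR: "below R B \<subseteq> R" for B unfolding below_def by auto
  have "(\<Sum>P | P \<in> inv_partitions U H \<and> refines R P.
       orbit_prod H (`) P (\<lambda>B. f (blk ` below R B) (lift ` stab H B))) =
    (\<Sum>Q\<in>inv_partitions (blk ` R) (lift ` H). orbit_prod (lift ` H) (`) Q (\<lambda>B. f B (stab (lift ` H) B)))"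
  proof (rule sum.reindex_bij_witness[where j = "\<lambda>P. (\<lambda>B. blk ` below R B) ` P" and i = "\<lambda>Q. (\<lambda>X. \<Union>(unblk ` X)) ` Q"])
    fix P assume "P \<in> {P. P \<in> inv_partitions U H \<and> refines R P}"
    then have P: "P \<in> inv_partitions U H" and RP: "refines R P" by auto
    interpret refinement U H R P using H P R RP by unfold_locales auto
    have un: "\<Union>(unblk ` blk ` below R B) = B" if "B \<in> P" for B
      using ublk[OF bR] Union_below[OF that] by simp
    show "(\<lambda>X. \<Union>(unblk ` X)) ` (\<lambda>B. blk ` below R B) ` P = P"
      using un by (simp add: image_image)
    have inj: "inj_on (\<lambda>B. blk ` below R B) P" 
      by (rule inj_on_inverseI[where g = "\<lambda>X. \<Union>(unblk ` X)"]) (rule un)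
    have lb: "lift \<sigma> ` blk ` below R B = blk ` below R (\<sigma> ` B)" if "\<sigma> \<in> H" "B \<in> P" for \<sigma> B
    proof -
      have "(\<lambda>C. lift \<sigma> (blk C)) ` below R B = (\<lambda>C. blk (\<sigma> ` C)) ` below R B"
        using lift_blk[OF finR[OF subsetD[OF bR]]] by (intro image_cong) auto
      then show ?thesis unfolding below_image[OF that] by (simp add: image_image)
    qed
    show Q: "(\<lambda>B. blk ` below R B) ` P \<in> inv_partitions (blk ` R) (lift ` H)"
    proof -
      have "partition_on (blk ` R) ((\<lambda>B. blk ` below R B) ` P)"
      proof (rule partition_onI)
        have "\<Union>((\<lambda>B. blk ` below R B) ` P) = blk ` (\<Union>B\<in>P. below R B)" by blast
        then show "\<Union>((\<lambda>B. blk ` below R B) ` P) = blk ` R" unfolding UN_below .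
        have "below R B \<noteq> {}" if "B \<in> P" for B
          using Union_below[OF that] inv_partitionsD(4)[OF P that] by auto
        then show "{} \<notin> (\<lambda>B. blk ` below R B) ` P" by auto
        fix X Y assume "X \<in> (\<lambda>B. blk ` below R B) ` P" "Y \<in> (\<lambda>B. blk ` below R B) ` P" "X \<noteq> Y"
        then obtain A B where AB: "A \<in> P" "B \<in> P" "X = blk ` below R A" "Y = blk ` below R B" "A \<noteq> B" by auto
        show "disjnt X Y"
          unfolding disjnt_iff AB(3,4)
        proof (intro allI notI)
          fix b assume "b \<in> blk ` below R A \<and> b \<in> blk ` below R B"
          then obtain C D where CD: "C \<in> below R A" "D \<in> below R B" "blk C = blk D" by auto
          then have "C = D" using finR bR by (metis subsetD unblk_blk)
          obtain x where "x \<in> C" using CD(1) inv_partitionsD(4)[OF R] bR by blast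
          then have "A = B"
            using inv_partitionsD(8)[OF P AB(1,2), of x] CD(1,2) \<open>C = D\<close> unfolding below_def by blast
          then show False using AB(5) by simp
        qed
      qed
      moreover have "\<tau> ` X \<in> (\<lambda>B. blk ` below R B) ` P" if t: "\<tau> \<in> lift ` H" "X \<in> (\<lambda>B. blk ` below R B) ` P" for \<tau> X
      proof -
        obtain \<sigma> B where "\<sigma> \<in> H" "\<tau> = lift \<sigma>" "B \<in> P" "X = blk ` below R B" using t by auto
        then show ?thesis using lb inv_partitionsD(2)[OF P] by auto
      qed
      ultimately show ?thesis unfolding inv_partitions_def by blast
    qed
    have st: "stab (lift ` H) (blk ` below R B) = lift ` stab H B" if B: "B \<in> P" for B
    proof -
      have "lift \<sigma> ` blk ` below R B = blk ` below R B \<longleftrightarrow> \<sigma> ` B = B" if s: "\<sigma> \<in> H" for \<sigma>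
        unfolding lb[OF s B] using inj_onD[OF inj _ inv_partitionsD(2)[OF P s B] B] by auto
      then have "{\<sigma>\<in>H. lift \<sigma> ` blk ` below R B = blk ` below R B} = {\<sigma>\<in>H. \<sigma> ` B = B}"
        by (intro Collect_cong conj_cong refl) simp
      then show ?thesis unfolding stab_def Compr_image_eq by simp
    qed
    have "orbit_prod (lift ` H) (`) ((\<lambda>B. blk ` below R B) ` P) (\<lambda>B. f B (stab (lift ` H) B)) =
        orbit_prod H (`) P (\<lambda>B. f (blk ` below R B) (stab (lift ` H) (blk ` below R B)))"
    proof (rule orbit_prod_image[OF group_acting_blocks[OF H P] inj])
      show "lift \<sigma> ` blk ` below R B = blk ` below R (\<sigma> ` B)" if "\<sigma> \<in> H" "B \<in> P" for \<sigma> B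
        using lb[OF that] .
      fix \<sigma> B assume s: "\<sigma> \<in> H" and B: "B \<in> P"
      have "blk ` below R B \<subseteq> blk ` R" using bR by blast
      then show "f (blk ` below R (\<sigma> ` B)) (stab (lift ` H) (blk ` below R (\<sigma> ` B))) =
          f (blk ` below R B) (stab (lift ` H) (blk ` below R B))"
        using invariant_stab[OF f L, of "lift \<sigma>" "blk ` below R B"] s unfolding lb[OF s B] by auto
    qed
    also have "\<dots> = orbit_prod H (`) P (\<lambda>B. f (blk ` below R B) (lift ` stab H B))"
      by (rule orbit_prod_cong[OF group_acting_blocks[OF H P]]) (simp add: st)
    finally show "orbit_prod (lift ` H) (`) ((\<lambda>B. blk ` below R B) ` P) (\<lambda>B. f B (stab (lift ` H) B)) =
        orbit_prod H (`) P (\<lambda>B. f (blk ` below R B) (lift ` stab H B))" .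
  next
    fix Q assume Q: "Q \<in> inv_partitions (blk ` R) (lift ` H)"
    let ?u = "\<lambda>X. \<Union>(unblk ` X)"
    have sub: "\<exists>D. D \<subseteq> R \<and> X = blk ` D \<and> unblk ` X = D" if "X \<in> Q" for X
    proof -
      have "X \<subseteq> blk ` R" using inv_partitionsD(3)[OF Q that] .
      then obtain D where D: "D \<subseteq> R" "X = blk ` D" by (rule subset_imageE)
      then show ?thesis using ublk[OF D(1)] by (intro exI[of _ D]) simp
    qed
    have mem: "C \<subseteq> ?u X \<longleftrightarrow> blk C \<in> X" if X: "X \<in> Q" and C: "C \<in> R" for X C
    proof -
      obtain D where D: "D \<subseteq> R" "X = blk ` D" "unblk ` X = D" using sub[OF X] by blast
      have "C \<subseteq> \<Union>D \<longleftrightarrow> C \<in> D"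
      proof
        assume c: "C \<subseteq> \<Union>D"
        obtain x where x: "x \<in> C" using inv_partitionsD(4)[OF R C] by blast
        then obtain C' where "C' \<in> D" "x \<in> C'" using c by blast
        then show "C \<in> D" using inv_partitionsD(8)[OF R C, of C' x] x D(1) by blast
      qed auto
      moreover have "blk C \<in> blk ` D \<longleftrightarrow> C \<in> D"
        using finR[OF C] finR D(1) by (metis image_iff subsetD unblk_blk)
      ultimately show ?thesis using D by simp
    qed
    have ub: "blk ` below R (?u X) = X" if X: "X \<in> Q" for X
    proof
      show "blk ` below R (?u X) \<subseteq> X" unfolding below_def using mem[OF X] by auto
      show "X \<subseteq> blk ` below R (?u X)"
      proof
        fix b assume b: "b \<in> X"
        then obtain C where "C \<in> R" "b = blk C" using inv_partitionsD(3)[OF Q X] by blast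
        then show "b \<in> blk ` below R (?u X)" unfolding below_def using mem[OF X] b by blast
      qed
    qed
    show "(\<lambda>B. blk ` below R B) ` ?u ` Q = Q" using ub by (simp add: image_image)
    have RQ: "refines R (?u ` Q)"
      unfolding refines_def
    proof
      fix C assume C: "C \<in> R"
      then obtain X where "X \<in> Q" "blk C \<in> X" using inv_partitionsD(7)[OF Q] by blast
      then show "\<exists>B\<in>?u ` Q. C \<subseteq> B" using mem[OF _ C] by blast
    qed
    have "partition_on U (?u ` Q)"
    proof (rule partition_onI)
      show "\<Union>(?u ` Q) = U"
      proof
        show "\<Union>(?u ` Q) \<subseteq> U"
        proof
          fix x assume "x \<in> \<Union>(?u ` Q)"
          then obtain X b where X: "X \<in> Q" "b \<in> X" "x \<in> unblk b" by blast
          then obtain D where "D \<subseteq> R" "unblk ` X = D" using sub by blast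
          then show "x \<in> U" using X inv_partitionsD(3)[OF R] by blast
        qed
        show "U \<subseteq> \<Union>(?u ` Q)"
        proof
          fix x assume "x \<in> U"
          then obtain C where C: "C \<in> R" "x \<in> C" using inv_partitionsD(7)[OF R] by blast
          obtain B where B: "B \<in> ?u ` Q" "C \<subseteq> B"
            using bspec[OF RQ[unfolded refines_def] C(1)] by (elim bexE)
          show "x \<in> \<Union>(?u ` Q)" by (rule UnionI[OF B(1) subsetD[OF B(2) C(2)]])
        qed
      qed
      show "{} \<notin> ?u ` Q"
      proof
        assume "{} \<in> ?u ` Q"
        then obtain X where X: "X \<in> Q" "?u X = {}" by auto
        obtain D where D: "D \<subseteq> R" "X = blk ` D" "unblk ` X = D" using sub[OF X(1)] by blast
        then obtain C where C: "C \<in> D" using inv_partitionsD(4)[OF Q X(1)] by blast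
        then have "C \<noteq> {}" using D(1) inv_partitionsD(4)[OF R] by blast
        then show False using C X(2) unfolding D(3) by blast
      qed
      fix A B assume "A \<in> ?u ` Q" "B \<in> ?u ` Q" "A \<noteq> B"
      then obtain X Y where XY: "X \<in> Q" "Y \<in> Q" "A = ?u X" "B = ?u Y" "X \<noteq> Y" by blast
      obtain D where D: "D \<subseteq> R" "X = blk ` D" "unblk ` X = D" using sub[OF XY(1)] by blast
      obtain E where E: "E \<subseteq> R" "Y = blk ` E" "unblk ` Y = E" using sub[OF XY(2)] by blast
      have "False" if x: "x \<in> A" "x \<in> B" for x
      proof -
        obtain C C' where C: "C \<in> D" "C' \<in> E" "x \<in> C" "x \<in> C'" using x XY(3,4) D(3) E(3) by blast
        then have "C = C'" using inv_partitionsD(8)[OF R, of C C' x] D(1) E(1) by blast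
        then have "blk C \<in> X" "blk C \<in> Y" using C D(2) E(2) by auto
        then show False using inv_partitionsD(8)[OF Q XY(1,2)] XY(5) by blast
      qed
      then show "disjnt A B" unfolding disjnt_iff by blast
    qed
    moreover have "\<sigma> ` ?u X \<in> ?u ` Q" if s: "\<sigma> \<in> H" and X: "X \<in> Q" for \<sigma> X
    proof -
      obtain D where D: "D \<subseteq> R" "X = blk ` D" "unblk ` X = D" using sub[OF X] by blast
      have "lift \<sigma> ` X \<in> Q" using inv_partitionsD(2)[OF Q _ X] s by blast
      moreover have "unblk ` lift \<sigma> ` X = (`) \<sigma> ` D"
        unfolding D(2) image_image using D(1) finR by (intro image_cong) auto
      then have "?u (lift \<sigma> ` X) = \<sigma> ` ?u X" unfolding D(3) by (simp add: image_Union)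
      ultimately show ?thesis using image_eqI[of "\<sigma> ` ?u X" ?u "lift \<sigma> ` X" Q] by simp
    qed
    then have "\<forall>\<sigma>\<in>H. \<forall>B\<in>?u ` Q. \<sigma> ` B \<in> ?u ` Q" by (intro ballI) (elim imageE, simp)
    ultimately show "?u ` Q \<in> {P. P \<in> inv_partitions U H \<and> refines R P}"
      using RQ unfolding inv_partitions_def by simp
  qed
  then show ?thesis unfolding plethysm_def by simp
qed

text \<open>Associativity for \<open>\<E>\<^sub>+ \<circ> f \<circ> h\<close>.  Both sides are sums over pairs of invariant partitions \<open>R\<close>
and \<open>P\<close> with \<open>R\<close> finer than \<open>P\<close>, where \<open>h\<close> is evaluated on the blocks of \<open>R\<close>, and \<open>f\<close> on the sets
of those blocks of \<open>R\<close> that lie in a common block of \<open>P\<close>.\<close>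

lemma plethysm_assoc:
  assumes H: "group_on U H" and f: "invariant f" and h: "invariant h"
  shows "plethysm one (plethysm f h) U H = plethysm (plethysm one f) h U H"
proof -
  let ?I = "inv_partitions U H"
  have fin: "finite ?I" by (rule finite_inv_partitions[OF group_onD(1)[OF H]])
  define a where "a P R = orbit_prod H (`) P (\<lambda>B. f (blk ` below R B) (lift ` stab H B))" for P R
  define b where "b R = orbit_prod H (`) R (\<lambda>C. h C (stab H C))" for R
  have "plethysm one (plethysm f h) U H = (\<Sum>P\<in>?I. \<Sum>R | R \<in> ?I \<and> refines R P. a P R * b R)"
    unfolding plethysm_def[of one] a_def b_def
    by (intro sum.cong refl) (simp add: orbit_prod_plethysm[OF H _ h])
  also have "\<dots> = (\<Sum>R\<in>?I. \<Sum>P | P \<in> ?I \<and> refines R P. a P R * b R)"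
    by (rule sum.swap_restrict[OF fin fin])
  also have "\<dots> = (\<Sum>R\<in>?I. plethysm one f (blk ` R) (lift ` H) * b R)"
    unfolding sum_distrib_right[symmetric]
    by (intro sum.cong refl) (simp add: a_def sum_coarsenings[OF H _ f])
  also have "\<dots> = plethysm (plethysm one f) h U H" unfolding plethysm_def b_def ..
  finally show ?thesis .
qed

section \<open>Graphs and their fixed edge sets\<close>

definition pairs :: "label set \<Rightarrow> label set set" where
  "pairs U = {{u, v} | u v. u \<in> U \<and> v \<in> U \<and> u \<noteq> v}"

definition conn :: "label set set \<Rightarrow> (label \<times> label) set" where
  "conn E = {(a, b). {a, b} \<in> E}\<^sup>*"

text \<open>Adjacent and nonadjacent twins are treated alike: the former have the same neighbours in the
complement, the latter in the graph itself.\<close>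

definition twins :: "label set \<Rightarrow> label set set \<Rightarrow> label \<Rightarrow> label \<Rightarrow> bool" where
  "twins U E u v \<longleftrightarrow> (\<forall>w\<in>U. w \<noteq> u \<longrightarrow> w \<noteq> v \<longrightarrow> {u, w} \<in> E \<longleftrightarrow> {v, w} \<in> E)"

definition inv_edges :: "label set \<Rightarrow> (label \<Rightarrow> label) set \<Rightarrow> label set set set" where
  "inv_edges U H = {E. E \<subseteq> pairs U \<and> (\<forall>\<sigma>\<in>H. (`) \<sigma> ` E = E)}"

lemma is_graph_iff: "is_graph (U, E) \<longleftrightarrow> finite U \<and> E \<subseteq> pairs U"
  unfolding is_graph_def pairs_def by simp

lemma pairs_iff [simp]: "{u, v} \<in> pairs U \<longleftrightarrow> u \<in> U \<and> v \<in> U \<and> u \<noteq> v"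
  unfolding pairs_def by (auto simp: doubleton_eq_iff)

lemma singleton_not_pair [simp]: "{u} \<notin> pairs U"
  using pairs_iff[of u u U] by simp

lemma pairsE: "e \<in> pairs U \<Longrightarrow> (\<And>u v. u \<in> U \<Longrightarrow> v \<in> U \<Longrightarrow> u \<noteq> v \<Longrightarrow> e = {u, v} \<Longrightarrow> thesis) \<Longrightarrow> thesis"
  unfolding pairs_def by blast

lemma pairs_Pow: "pairs U \<subseteq> Pow U"
  unfolding pairs_def by blast

lemma finite_pairs: "finite U \<Longrightarrow> finite (pairs U)"
  by (rule finite_subset[OF pairs_Pow]) simp

lemma pairs_image: "inj_on \<sigma> U \<Longrightarrow> (`) \<sigma> ` pairs U = pairs (\<sigma> ` U)"
proof
  assume i: "inj_on \<sigma> U"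
  show "(`) \<sigma> ` pairs U \<subseteq> pairs (\<sigma> ` U)"
    using inj_onD[OF i] by (auto elim!: pairsE)
  show "pairs (\<sigma> ` U) \<subseteq> (`) \<sigma> ` pairs U"
  proof
    fix e assume "e \<in> pairs (\<sigma> ` U)"
    then obtain u v where "u \<in> U" "v \<in> U" "\<sigma> u \<noteq> \<sigma> v" "e = {\<sigma> u, \<sigma> v}" by (auto elim!: pairsE)
    then show "e \<in> (`) \<sigma> ` pairs U" by (intro image_eqI[of _ _ "{u, v}"]) auto
  qed
qed

lemma edges_eqI:
  assumes "E \<subseteq> pairs U" "E' \<subseteq> pairs U"
    and "\<And>u v. u \<in> U \<Longrightarrow> v \<in> U \<Longrightarrow> u \<noteq> v \<Longrightarrow> {u, v} \<in> E \<longleftrightarrow> {u, v} \<in> E'"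
  shows "E = E'"
proof (rule set_eqI)
  fix e
  show "e \<in> E \<longleftrightarrow> e \<in> E'"
  proof (cases "e \<in> pairs U")
    case True then show ?thesis using assms(3) by (auto elim!: pairsE)
  next
    case False then show ?thesis using assms(1,2) by blast
  qed
qed

lemma edge_image:
  assumes E: "E \<subseteq> pairs U" and i: "inj_on \<sigma> U" and u: "u \<in> U" "v \<in> U"
  shows "{\<sigma> u, \<sigma> v} \<in> (`) \<sigma> ` E \<longleftrightarrow> {u, v} \<in> E"
proof
  assume "{\<sigma> u, \<sigma> v} \<in> (`) \<sigma> ` E"
  then obtain e where e: "e \<in> E" "\<sigma> ` e = \<sigma> ` {u, v}" by auto
  have "e \<subseteq> U" using e(1) E pairs_Pow by blast
  then have "e = {u, v}" using inj_on_image_eq_iff[OF i, of e "{u, v}"] e(2) u by auto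
  then show "{u, v} \<in> E" using e(1) by simp
next
  assume "{u, v} \<in> E"
  then show "{\<sigma> u, \<sigma> v} \<in> (`) \<sigma> ` E" by (intro image_eqI[of _ _ "{u, v}"]) auto
qed

lemma inv_edgesD:
  assumes H: "group_on U H" and E: "E \<in> inv_edges U H"
  shows "E \<subseteq> pairs U"
    and "\<sigma> \<in> H \<Longrightarrow> u \<in> U \<Longrightarrow> v \<in> U \<Longrightarrow> {\<sigma> u, \<sigma> v} \<in> E \<longleftrightarrow> {u, v} \<in> E"
proof -
  show EU: "E \<subseteq> pairs U" using E unfolding inv_edges_def by simp
  show "{\<sigma> u, \<sigma> v} \<in> E \<longleftrightarrow> {u, v} \<in> E" if "\<sigma> \<in> H" "u \<in> U" "v \<in> U"
  proof -
    have "(`) \<sigma> ` E = E" using E that(1) unfolding inv_edges_def by simp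
    then show ?thesis using edge_image[OF EU group_onD(4)[OF H that(1)] that(2,3)] by simp
  qed
qed

lemma inv_edgesI:
  assumes H: "group_on U H" and E: "E \<subseteq> pairs U"
    and inv: "\<And>\<sigma> u v. \<sigma> \<in> H \<Longrightarrow> u \<in> U \<Longrightarrow> v \<in> U \<Longrightarrow> u \<noteq> v \<Longrightarrow> {u, v} \<in> E \<Longrightarrow> {\<sigma> u, \<sigma> v} \<in> E"
  shows "E \<in> inv_edges U H"
proof -
  have "(`) \<sigma> ` E = E" if s: "\<sigma> \<in> H" for \<sigma>
  proof (rule endo_inj_surj)
    show "finite E" using finite_subset[OF E finite_pairs[OF group_onD(1)[OF H]]] .
    show "(`) \<sigma> ` E \<subseteq> E"
    proof
      fix e assume "e \<in> (`) \<sigma> ` E"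
      then obtain e' where e: "e' \<in> E" "e = \<sigma> ` e'" by auto
      then show "e \<in> E" using E inv[OF s] by (auto elim!: pairsE dest!: subsetD)
    qed
    have "E \<subseteq> Pow U" using E pairs_Pow by blast
    then show "inj_on ((`) \<sigma>) E"
      using inj_on_image_Pow[OF group_onD(4)[OF H s]] by (rule inj_on_subset[rotated])
  qed
  then show ?thesis unfolding inv_edges_def using E by simp
qed

lemma finite_inv_edges: "finite U \<Longrightarrow> finite (inv_edges U H)"
  unfolding inv_edges_def using finite_pairs by (rule rev_finite_subset[OF finite_Pow_iff[THEN iffD2]]) auto

definition graph_invariant :: "(graph \<Rightarrow> bool) \<Rightarrow> bool" where
  "graph_invariant Q \<longleftrightarrow> (\<forall>U E \<sigma>. E \<subseteq> pairs U \<longrightarrow> inj_on \<sigma> U \<longrightarrow> Q (U, E) \<longrightarrow> Q (\<sigma> ` U, (`) \<sigma> ` E))"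

lemma is_species_graph:
  assumes Q: "graph_invariant Q"
  shows "is_species (graph_species Q)"
proof (rule is_speciesI)
  fix U :: "label set" and c :: "label \<Rightarrow> unit" assume U: "finite U"
  have "structs (graph_species Q) U c \<subseteq> {U} \<times> Pow (pairs U)"
    unfolding graph_species_def by (auto simp: is_graph_iff)
  then show "finite (structs (graph_species Q) U c)"
    by (rule finite_subset) (use finite_pairs[OF U] in auto)
next
  fix U V \<sigma> s and c d :: "label \<Rightarrow> unit"
  assume b: "sorted_bij U c \<sigma> V d" and s: "s \<in> structs (graph_species Q) U c"
  obtain E where E: "s = (U, E)" "E \<subseteq> pairs U" "Q (U, E)"
    using s unfolding graph_species_def by (cases s) (auto simp: is_graph_iff)
  note D = sorted_bijD[OF b]
  have "(`) \<sigma> ` E \<subseteq> pairs V" using image_mono[OF E(2), of "(`) \<sigma>"] pairs_image[OF D(4)] D(5) by simp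
  moreover have "Q (V, (`) \<sigma> ` E)" using Q E D(4,5) unfolding graph_invariant_def by blast
  ultimately show "transport (graph_species Q) U c \<sigma> s \<in> structs (graph_species Q) V d"
    unfolding E(1) graph_species_def using D(2,5) by (simp add: is_graph_iff)
next
  fix U V W \<sigma> \<tau> s and c d e :: "label \<Rightarrow> unit"
  show "transport (graph_species Q) U c (\<tau> \<circ> \<sigma>) s =
      transport (graph_species Q) V d \<tau> (transport (graph_species Q) U c \<sigma> s)"
    unfolding graph_species_def by (cases s) (auto simp: image_image image_comp)
next
  fix U V s and \<sigma> \<sigma>' :: "label \<Rightarrow> label" and c d :: "label \<Rightarrow> unit"
  assume eq: "\<And>u. u \<in> U \<Longrightarrow> \<sigma> u = \<sigma>' u" and s: "s \<in> structs (graph_species Q) U c"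
  obtain E where E: "s = (U, E)" "E \<subseteq> pairs U"
    using s unfolding graph_species_def by (cases s) (auto simp: is_graph_iff)
  have "\<sigma> ` U = \<sigma>' ` U" using eq by (intro image_cong) auto
  moreover have "\<sigma> ` e = \<sigma>' ` e" if "e \<in> E" for e
    using subsetD[OF E(2) that] eq by (auto elim!: pairsE)
  then have "(`) \<sigma> ` E = (`) \<sigma>' ` E" by (rule image_cong[OF refl])
  ultimately show "transport (graph_species Q) U c \<sigma> s = transport (graph_species Q) U c \<sigma>' s"
    unfolding E(1) graph_species_def by simp
qed (auto simp: graph_species_def)

lemma mark_graph:
  assumes H: "group_on U H"
  shows "mark (graph_species Q) U c H = int (card {E\<in>inv_edges U H. Q (U, E)})"
proof -
  have "(\<forall>\<sigma>\<in>H. (\<sigma> ` U, (`) \<sigma> ` E) = (U, E)) \<longleftrightarrow> (\<forall>\<sigma>\<in>H. (`) \<sigma> ` E = E)" for E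
    using group_onD(5)[OF H] by simp
  then have "g \<in> fixed_structs (graph_species Q) U c H \<longleftrightarrow> fst g = U \<and> snd g \<in> {E\<in>inv_edges U H. Q (U, E)}" for g
    unfolding fixed_structs_def graph_species_def inv_edges_def
    using group_onD(1)[OF H] by (cases g; cases "fst g = U") (simp_all add: is_graph_iff conj_ac)
  then have "fixed_structs (graph_species Q) U c H = Pair U ` {E\<in>inv_edges U H. Q (U, E)}"
    by (auto simp: image_iff)
  then show ?thesis unfolding mark_def by (simp add: card_image inj_on_def)
qed

lemma connected_iff: "connected_graph (U, E) \<longleftrightarrow> U \<noteq> {} \<and> (\<forall>u\<in>U. \<forall>v\<in>U. (u, v) \<in> conn E)"
  unfolding connected_graph_def conn_def by simp

lemma conn_refl: "(u, u) \<in> conn E"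
  and conn_edge: "{u, v} \<in> E \<Longrightarrow> (u, v) \<in> conn E"
  and conn_trans: "(u, v) \<in> conn E \<Longrightarrow> (v, w) \<in> conn E \<Longrightarrow> (u, w) \<in> conn E"
  unfolding conn_def by auto

lemma conn_sym: "(u, v) \<in> conn E \<Longrightarrow> (v, u) \<in> conn E"
proof -
  have "sym {(a, b). {a, b} \<in> E}" by (rule symI) (simp add: insert_commute)
  then show "(u, v) \<in> conn E \<Longrightarrow> (v, u) \<in> conn E" unfolding conn_def by (meson sym_rtrancl symD)
qed

lemma conn_induct [consumes 1, case_names refl step]:
  assumes "(u, v) \<in> conn E" "Q u" "\<And>v w. (u, v) \<in> conn E \<Longrightarrow> {v, w} \<in> E \<Longrightarrow> Q v \<Longrightarrow> Q w"
  shows "Q v"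
  using assms(1) unfolding conn_def
  by (induction rule: rtrancl_induct) (use assms(2,3) in \<open>auto simp: conn_def\<close>)

lemma conn_map:
  assumes "(u, v) \<in> conn E" "\<And>a b. {a, b} \<in> E \<Longrightarrow> (\<phi> a, \<phi> b) \<in> conn E'"
  shows "(\<phi> u, \<phi> v) \<in> conn E'"
  using assms(1) by (induction rule: conn_induct) (auto intro: conn_refl conn_trans assms(2))

lemma graph_invariant_connected: "graph_invariant connected_graph"
  unfolding graph_invariant_def
proof (intro allI impI)
  fix U E and \<sigma> :: "label \<Rightarrow> label" assume c: "connected_graph (U, E)"
  have "(\<sigma> u, \<sigma> v) \<in> conn ((`) \<sigma> ` E)" if "(u, v) \<in> conn E" for u v
    using that
  proof (rule conn_map)
    fix a b assume "{a, b} \<in> E"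
    then have "\<sigma> ` {a, b} \<in> (`) \<sigma> ` E" by (rule imageI)
    then show "(\<sigma> a, \<sigma> b) \<in> conn ((`) \<sigma> ` E)" by (intro conn_edge) simp
  qed
  then show "connected_graph (\<sigma> ` U, (`) \<sigma> ` E)" using c unfolding connected_iff by auto
qed

lemma no_loop: "E \<subseteq> pairs U \<Longrightarrow> {u, u} \<notin> E"
  using pairs_iff by blast

lemma bi_point_determining_iff:
  assumes E: "E \<subseteq> pairs U"
  shows "bi_point_determining (U, E) \<longleftrightarrow> (\<forall>u\<in>U. \<forall>v\<in>U. twins U E u v \<longrightarrow> u = v)"
proof -
  have nl: "{u} \<notin> E" for u using no_loop[OF E, of u] by simp
  have 1: "nbhd (U, E) u = nbhd (U, E) v \<longleftrightarrow> twins U E u v \<and> {u, v} \<notin> E"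
    if "u \<in> U" "v \<in> U" "u \<noteq> v" for u v
  proof
    assume "nbhd (U, E) u = nbhd (U, E) v"
    then have m: "w \<in> nbhd (U, E) u \<longleftrightarrow> w \<in> nbhd (U, E) v" for w by simp
    have n: "{u, w} \<in> E \<longleftrightarrow> {v, w} \<in> E" if "w \<in> U" for w
      using m[of w] that unfolding nbhd_def by simp
    then show "twins U E u v \<and> {u, v} \<notin> E" using n[OF that(2)] nl unfolding twins_def by simp
  next
    assume t: "twins U E u v \<and> {u, v} \<notin> E"
    then have "{v, u} \<notin> E" by (simp add: insert_commute)
    then have "{u, w} \<in> E \<longleftrightarrow> {v, w} \<in> E" if "w \<in> U" for w
      using t that nl unfolding twins_def by (cases "w = u"; cases "w = v") simp_all
    then show "nbhd (U, E) u = nbhd (U, E) v"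
      unfolding nbhd_def prod.case by (intro Collect_cong conj_cong refl)
  qed
  have c: "complement (U, E) = (U, pairs U - E)" unfolding complement_def pairs_def by simp
  have 2: "nbhd (U, pairs U - E) u = nbhd (U, pairs U - E) v \<longleftrightarrow> twins U E u v \<and> {u, v} \<in> E"
    if uv: "u \<in> U" "v \<in> U" "u \<noteq> v" for u v
  proof
    assume "nbhd (U, pairs U - E) u = nbhd (U, pairs U - E) v"
    then have m: "w \<in> nbhd (U, pairs U - E) u \<longleftrightarrow> w \<in> nbhd (U, pairs U - E) v" for w by simp
    have n: "{u, w} \<in> pairs U - E \<longleftrightarrow> {v, w} \<in> pairs U - E" if "w \<in> U" for w
      using m[of w] that unfolding nbhd_def by simp
    have "{u, w} \<in> E \<longleftrightarrow> {v, w} \<in> E" if "w \<in> U" "w \<noteq> u" "w \<noteq> v" for w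
      using n[OF that(1)] uv that by simp
    moreover have "{u, v} \<in> E" using n[OF uv(2)] uv by simp
    ultimately show "twins U E u v \<and> {u, v} \<in> E" unfolding twins_def by simp
  next
    assume t: "twins U E u v \<and> {u, v} \<in> E"
    then have "{v, u} \<in> E" by (simp add: insert_commute)
    then have "{u, w} \<in> pairs U - E \<longleftrightarrow> {v, w} \<in> pairs U - E" if "w \<in> U" for w
      using t that uv unfolding twins_def by (cases "w = u"; cases "w = v") simp_all
    then show "nbhd (U, pairs U - E) u = nbhd (U, pairs U - E) v"
      unfolding nbhd_def prod.case by (intro Collect_cong conj_cong refl)
  qed
  show ?thesis
  proof -
    have "bi_point_determining (U, E) \<longleftrightarrow> (\<forall>u\<in>U. \<forall>v\<in>U. u \<noteq> v \<longrightarrow>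
        nbhd (U, E) u \<noteq> nbhd (U, E) v \<and> nbhd (U, pairs U - E) u \<noteq> nbhd (U, pairs U - E) v)"
      unfolding bi_point_determining_def point_determining_def c fst_conv by blast
    also have "\<dots> \<longleftrightarrow> (\<forall>u\<in>U. \<forall>v\<in>U. u \<noteq> v \<longrightarrow> \<not> twins U E u v)"
      by (intro ball_cong imp_cong refl) (auto simp: 1 2)
    finally show ?thesis by blast
  qed
qed

lemma graph_invariant_bi_point_determining: "graph_invariant bi_point_determining"
  unfolding graph_invariant_def
proof (intro allI impI)
  fix U E and \<sigma> :: "label \<Rightarrow> label" assume E: "E \<subseteq> pairs U" and i: "inj_on \<sigma> U" and b: "bi_point_determining (U, E)"
  have E': "(`) \<sigma> ` E \<subseteq> pairs (\<sigma> ` U)" using image_mono[OF E, of "(`) \<sigma>"] pairs_image[OF i] by simp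
  have "u = v" if uv: "u \<in> U" "v \<in> U" and t: "twins (\<sigma> ` U) ((`) \<sigma> ` E) (\<sigma> u) (\<sigma> v)" for u v
  proof -
    have "{u, w} \<in> E \<longleftrightarrow> {v, w} \<in> E" if w: "w \<in> U" "w \<noteq> u" "w \<noteq> v" for w
    proof -
      have "\<sigma> w \<noteq> \<sigma> u" "\<sigma> w \<noteq> \<sigma> v" using inj_onD[OF i] uv w by blast+
      then have "{\<sigma> u, \<sigma> w} \<in> (`) \<sigma> ` E \<longleftrightarrow> {\<sigma> v, \<sigma> w} \<in> (`) \<sigma> ` E"
        using t w(1) unfolding twins_def by blast
      then show ?thesis unfolding edge_image[OF E i uv(1) w(1)] edge_image[OF E i uv(2) w(1)] .
    qed
    then have "twins U E u v" unfolding twins_def by blast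
    then show ?thesis using b uv unfolding bi_point_determining_iff[OF E] by blast
  qed
  then show "bi_point_determining (\<sigma> ` U, (`) \<sigma> ` E)"
    unfolding bi_point_determining_iff[OF E'] by blast
qed

lemma is_species_graphs:
  shows "is_species sp_Gc" "is_species sp_B_plus" "is_species sp_Bc"
proof -
  show "is_species sp_Gc" unfolding sp_Gc_def by (rule is_species_graph[OF graph_invariant_connected])
  show "is_species sp_B_plus" unfolding sp_B_plus_def
    by (rule is_species_graph) (use graph_invariant_bi_point_determining in \<open>auto simp: graph_invariant_def\<close>)
  show "is_species sp_Bc" unfolding sp_Bc_def
    by (rule is_species_graph)
      (use graph_invariant_bi_point_determining graph_invariant_connected in \<open>auto simp: graph_invariant_def\<close>)
qed

section \<open>Connected components\<close>

definition component :: "label set \<Rightarrow> label set set \<Rightarrow> label \<Rightarrow> label set" where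
  "component U E u = {v\<in>U. (u, v) \<in> conn E}"

lemma component_eq: "(u, v) \<in> conn E \<Longrightarrow> component U E u = component U E v"
  unfolding component_def using conn_trans conn_sym by blast

lemma partition_components: "partition_on U (component U E ` U)"
proof (rule partition_onI)
  show "\<Union>(component U E ` U) = U" unfolding component_def using conn_refl by blast
  show "{} \<notin> component U E ` U" unfolding component_def using conn_refl by blast
  fix A B assume "A \<in> component U E ` U" "B \<in> component U E ` U" "A \<noteq> B"
  then obtain u v where uv: "A = component U E u" "B = component U E v" by auto
  have "False" if "x \<in> A" "x \<in> B" for x
    using that component_eq[of u x E U] component_eq[of v x E U] uv \<open>A \<noteq> B\<close>
    unfolding component_def by auto
  then show "disjnt A B" unfolding disjnt_iff by blast
qed

lemma component_image:
  assumes H: "group_on U H" and E: "E \<in> inv_edges U H" and s: "\<sigma> \<in> H" and u: "u \<in> U"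
  shows "\<sigma> ` component U E u = component U E (\<sigma> u)"
proof -
  interpret group_acting H "\<lambda>\<sigma>. \<sigma>" U by (rule group_onD(2)[OF H])
  have m: "(\<tau> a, \<tau> b) \<in> conn E" if ab: "(a, b) \<in> conn E" and t: "\<tau> \<in> H" for \<tau> a b
    using ab
  proof (rule conn_map)
    fix a b assume ab: "{a, b} \<in> E"
    then have "a \<in> U" "b \<in> U" using inv_edgesD(1)[OF H E] pairs_iff by blast+
    then show "(\<tau> a, \<tau> b) \<in> conn E" using inv_edgesD(2)[OF H E t] ab conn_edge by blast
  qed
  obtain \<rho> where r: "\<rho> \<in> H" "\<forall>x\<in>U. \<rho> (\<sigma> x) = x" "\<forall>x\<in>U. \<sigma> (\<rho> x) = x"
    using inverse_both[OF s] by blast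
  show ?thesis
  proof
    show "\<sigma> ` component U E u \<subseteq> component U E (\<sigma> u)"
      unfolding component_def using m s closed[OF s] by blast
    show "component U E (\<sigma> u) \<subseteq> \<sigma> ` component U E u"
    proof
      fix v assume "v \<in> component U E (\<sigma> u)"
      then have v: "v \<in> U" "(\<sigma> u, v) \<in> conn E" unfolding component_def by auto
      have "(u, \<rho> v) \<in> conn E" using m[OF v(2) r(1)] r(2) u by simp
      then have "\<rho> v \<in> component U E u" using closed[OF r(1) v(1)] unfolding component_def by simp
      then show "v \<in> \<sigma> ` component U E u" using r(3) v(1) by (metis image_eqI)
    qed
  qed
qed

lemma component_connected:
  assumes "E \<subseteq> pairs U" "u \<in> U"
  shows "connected_graph (component U E u, E \<inter> Pow (component U E u))"
proof -
  let ?B = "component U E u"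
  have 1: "(u, v) \<in> conn (E \<inter> Pow ?B)" if "(u, v) \<in> conn E" for v
    using that
  proof (induction rule: conn_induct)
    case (step v w)
    have "v \<in> U" "w \<in> U" using subsetD[OF assms(1) step(2)] by auto
    then have "{v, w} \<subseteq> ?B"
      using step(1) conn_trans[OF step(1) conn_edge[OF step(2)]] unfolding component_def by simp
    then show ?case using step(2,3) conn_edge[of v w "E \<inter> Pow ?B"] conn_trans by blast
  qed (rule conn_refl)
  have "u \<in> ?B" using assms(2) conn_refl unfolding component_def by simp
  moreover have "(v, w) \<in> conn (E \<inter> Pow ?B)" if "v \<in> ?B" "w \<in> ?B" for v w
    using conn_trans[OF conn_sym[OF 1] 1] that unfolding component_def by simp
  ultimately show ?thesis unfolding connected_iff by blast
qed

lemma structs_Gc: "structs sp_Gc B c = Pair B ` {E. finite B \<and> E \<subseteq> pairs B \<and> connected_graph (B, E)}"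
  unfolding sp_Gc_def graph_species_def by (auto simp: is_graph_iff)

lemma transport_Gc: "transport sp_Gc B c \<sigma> (V, E) = (\<sigma> ` V, (`) \<sigma> ` E)"
  unfolding sp_Gc_def graph_species_def by simp

text \<open>Edges of the union do not leave a block, and each block is connected.\<close>

lemma components_of_union:
  assumes P: "partition_on U P" and E: "\<And>B. B \<in> P \<Longrightarrow> E B \<subseteq> pairs B \<and> connected_graph (B, E B)"
  shows "component U (\<Union>B\<in>P. E B) ` U = P" and "B \<in> P \<Longrightarrow> (\<Union>B\<in>P. E B) \<inter> Pow B = E B"
proof -
  let ?E = "\<Union>B\<in>P. E B"
  have same: "B = B'" if "B \<in> P" "B' \<in> P" "x \<in> B" "x \<in> B'" for B B' x
    using P that unfolding partition_on_def disjoint_def by auto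
  have edge: "v \<in> B \<and> w \<in> B" if k: "B \<in> P" "v \<in> B" "{v, w} \<in> ?E" for B v w
  proof -
    obtain B' where B': "B' \<in> P" "{v, w} \<in> E B'" using k(3) by blast
    then have vw: "v \<in> B'" "w \<in> B'" using E[OF B'(1)] pairs_iff by blast+
    then show ?thesis using same[OF k(1) B'(1) k(2) vw(1)] k(2) by simp
  qed
  have comp: "component U ?E u = B" if B: "B \<in> P" and u: "u \<in> B" for B u
  proof
    show "component U ?E u \<subseteq> B"
    proof
      fix v assume "v \<in> component U ?E u"
      then have "(u, v) \<in> conn ?E" unfolding component_def by simp
      then show "v \<in> B" by (induction rule: conn_induct) (use u edge[OF B] in auto)
    qed
    show "B \<subseteq> component U ?E u"
    proof
      fix v assume v: "v \<in> B"
      have "(u, v) \<in> conn (E B)" using E[OF B] u v unfolding connected_iff by blast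
      then have "(u, v) \<in> conn ?E" using conn_map[of u v "E B" "\<lambda>x. x" ?E] conn_edge B by blast
      then show "v \<in> component U ?E u" using v partition_block(1)[OF P B] unfolding component_def by auto
    qed
  qed
  show "component U ?E ` U = P"
  proof
    show "component U ?E ` U \<subseteq> P" using comp partition_onD1[OF P] by auto
    show "P \<subseteq> component U ?E ` U"
    proof
      fix B assume B: "B \<in> P"
      obtain u where u: "u \<in> B" using partition_block(2)[OF P B] by blast
      then show "B \<in> component U ?E ` U" using comp[OF B u] partition_block(1)[OF P B] by blast
    qed
  qed
  show "?E \<inter> Pow B = E B" if B: "B \<in> P"
  proof
    show "E B \<subseteq> ?E \<inter> Pow B" using E[OF B] pairs_Pow B by blast
    show "?E \<inter> Pow B \<subseteq> E B"
    proof
      fix e assume "e \<in> ?E \<inter> Pow B"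
      then obtain B' where B': "B' \<in> P" "e \<in> E B'" "e \<subseteq> B" by blast
      then obtain u v where "e = {u, v}" "u \<in> B'" using E[OF B'(1)] by (blast elim: pairsE)
      then show "e \<in> E B" using same[OF B B'(1), of u] B' by simp
    qed
  qed
qed

text \<open>A graph is the same as a partition of its vertex set with a connected graph on each block.\<close>

lemma plethysm_connected:
  assumes H: "group_on U H"
  shows "plethysm one (umark (virt sp_Gc)) U H = int (card (inv_edges U H))"
proof -
  have U: "finite U" by (rule group_onD(1)[OF H])
  have ks: "keeps_sorts U (\<lambda>_. ()) H" by simp
  let ?f = "\<lambda>P. block_fams sp_Gc P (\<lambda>_. ()) H"
  have "plethysm one (umark (virt sp_Gc)) U H = (\<Sum>P\<in>inv_partitions U H. int (card (?f P)))"
    unfolding plethysm_def umark_virt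
    by (intro sum.cong refl) (simp add: card_block_fams[OF is_species_graphs(1) H ks])
  also have "\<dots> = int (card (Sigma (inv_partitions U H) ?f))"
    using finite_inv_partitions[OF U] finite_block_fams[OF is_species_graphs(1) U]
    by (simp add: card_SigmaI)
  also have "card (Sigma (inv_partitions U H) ?f) = card (inv_edges U H)"
  proof (rule bij_betw_same_card, rule bij_betw_byWitness[where
        f = "\<lambda>(P, g). \<Union>B\<in>P. snd (g B)" and
        f' = "\<lambda>E. (component U E ` U, \<lambda>B\<in>component U E ` U. (B, E \<inter> Pow B))"])
    have fam: "g B = (B, snd (g B))" "snd (g B) \<subseteq> pairs B \<and> connected_graph (B, snd (g B))"
      if "g \<in> ?f P" "B \<in> P" for P g B
    proof -
      have "g B \<in> structs sp_Gc B (\<lambda>_. ())" using that unfolding eqv_fam_def by auto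
      then show "g B = (B, snd (g B))" "snd (g B) \<subseteq> pairs B \<and> connected_graph (B, snd (g B))"
        unfolding structs_Gc by auto
    qed
    show "\<forall>x\<in>Sigma (inv_partitions U H) ?f.
        (\<lambda>E. (component U E ` U, \<lambda>B\<in>component U E ` U. (B, E \<inter> Pow B)))
          ((\<lambda>(P, g). \<Union>B\<in>P. snd (g B)) x) = x"
    proof
      fix x assume "x \<in> Sigma (inv_partitions U H) ?f"
      then obtain P g where x: "x = (P, g)" "P \<in> inv_partitions U H" "g \<in> ?f P" by auto
      note c = components_of_union[OF inv_partitionsD(1)[OF x(2)], of "\<lambda>B. snd (g B)"]
      have "(\<lambda>B\<in>P. (B, (\<Union>B\<in>P. snd (g B)) \<inter> Pow B)) = g"
      proof (rule extensionalityI[of _ P])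
        show "g \<in> extensional P" using x(3) unfolding eqv_fam_def by (auto simp: PiE_def)
        fix B assume B: "B \<in> P"
        show "(\<lambda>B\<in>P. (B, (\<Union>B\<in>P. snd (g B)) \<inter> Pow B)) B = g B"
          using fam(1)[OF x(3) B] c(2)[OF fam(2)[OF x(3)] B] B by simp
      qed simp
      then show "(\<lambda>E. (component U E ` U, \<lambda>B\<in>component U E ` U. (B, E \<inter> Pow B)))
          ((\<lambda>(P, g). \<Union>B\<in>P. snd (g B)) x) = x"
        unfolding x(1) using c(1)[OF fam(2)[OF x(3)]] by simp
    qed
    show "\<forall>E\<in>inv_edges U H. (\<lambda>(P, g). \<Union>B\<in>P. snd (g B))
        (component U E ` U, \<lambda>B\<in>component U E ` U. (B, E \<inter> Pow B)) = E"
    proof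
      fix E assume "E \<in> inv_edges U H"
      then have EU: "E \<subseteq> pairs U" by (rule inv_edgesD(1)[OF H])
      have "(\<Union>B\<in>component U E ` U. E \<inter> Pow B) = E"
      proof
        show "E \<subseteq> (\<Union>B\<in>component U E ` U. E \<inter> Pow B)"
        proof
          fix e assume e: "e \<in> E"
          then obtain u v where uv: "u \<in> U" "v \<in> U" "e = {u, v}" using EU by (blast elim: pairsE)
          then have "e \<subseteq> component U E u"
            using conn_refl conn_edge[of u v E] e unfolding component_def by simp
          then show "e \<in> (\<Union>B\<in>component U E ` U. E \<inter> Pow B)" using e uv(1) by blast
        qed
      qed blast
      then show "(\<lambda>(P, g). \<Union>B\<in>P. snd (g B))
        (component U E ` U, \<lambda>B\<in>component U E ` U. (B, E \<inter> Pow B)) = E" by simp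
    qed
    show "(\<lambda>(P, g). \<Union>B\<in>P. snd (g B)) ` Sigma (inv_partitions U H) ?f \<subseteq> inv_edges U H"
    proof (rule image_subsetI)
      fix x assume "x \<in> Sigma (inv_partitions U H) ?f"
      then obtain P g where x: "x = (P, g)" "P \<in> inv_partitions U H" "g \<in> ?f P" by auto
      have "(\<Union>B\<in>P. snd (g B)) \<in> inv_edges U H"
      proof (rule inv_edgesI[OF H])
        show "(\<Union>B\<in>P. snd (g B)) \<subseteq> pairs U"
        proof
          fix e assume "e \<in> (\<Union>B\<in>P. snd (g B))"
          then obtain B where B: "B \<in> P" "e \<in> pairs B" using fam(2)[OF x(3)] by blast
          then show "e \<in> pairs U" using inv_partitionsD(3)[OF x(2) B(1)] by (auto elim!: pairsE)
        qed
        fix \<sigma> u v assume s: "\<sigma> \<in> H" and "{u, v} \<in> (\<Union>B\<in>P. snd (g B))"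
        then obtain B where B: "B \<in> P" "{u, v} \<in> snd (g B)" by blast
        have "g (\<sigma> ` B) = transport sp_Gc B (\<lambda>_. ()) \<sigma> (g B)"
          using x(3) s B(1) unfolding eqv_fam_def by auto
        also have "\<dots> = (\<sigma> ` B, (`) \<sigma> ` snd (g B))"
          using fam(1)[OF x(3) B(1)] transport_Gc by metis
        finally have "snd (g (\<sigma> ` B)) = (`) \<sigma> ` snd (g B)" by simp
        moreover have "{\<sigma> u, \<sigma> v} \<in> (`) \<sigma> ` snd (g B)"
          using B(2) by (intro image_eqI[of _ _ "{u, v}"]) auto
        ultimately show "{\<sigma> u, \<sigma> v} \<in> (\<Union>B\<in>P. snd (g B))"
          using inv_partitionsD(2)[OF x(2) s B(1)] by blast
      qed
      then show "(\<lambda>(P, g). \<Union>B\<in>P. snd (g B)) x \<in> inv_edges U H" unfolding x(1) by simp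
    qed
    show "(\<lambda>E. (component U E ` U, \<lambda>B\<in>component U E ` U. (B, E \<inter> Pow B))) ` inv_edges U H
        \<subseteq> Sigma (inv_partitions U H) ?f"
    proof (rule image_subsetI)
      fix E assume E: "E \<in> inv_edges U H"
      note EU = inv_edgesD(1)[OF H E]
      let ?P = "component U E ` U"
      have mem: "\<sigma> ` B \<in> ?P" if s: "\<sigma> \<in> H" and B: "B \<in> ?P" for \<sigma> B
      proof -
        obtain u where u: "u \<in> U" "B = component U E u" using B by auto
        have "\<sigma> u \<in> U" using group_onD(5)[OF H s] u(1) by blast
        then show ?thesis using component_image[OF H E s u(1)] u(2) by simp
      qed
      then have P: "?P \<in> inv_partitions U H"
        unfolding inv_partitions_def using partition_components by blast
      have "(B, E \<inter> Pow B) \<in> structs sp_Gc B (\<lambda>_. ())" if B: "B \<in> ?P" for B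
      proof -
        have "E \<inter> Pow B \<subseteq> pairs B"
        proof
          fix e assume e: "e \<in> E \<inter> Pow B"
          then have "e \<in> pairs U" using EU by blast
          then obtain u v where "u \<noteq> v" "e = {u, v}" by (rule pairsE)
          then show "e \<in> pairs B" using e by simp
        qed
        moreover have "connected_graph (B, E \<inter> Pow B)" using component_connected[OF EU] B by blast
        ultimately show ?thesis
          unfolding structs_Gc using inv_partitionsD(6)[OF P U B] by blast
      qed
      moreover have "(\<sigma> ` B, E \<inter> Pow (\<sigma> ` B)) = transport sp_Gc B (\<lambda>_. ()) \<sigma> (B, E \<inter> Pow B)"
        if s: "\<sigma> \<in> H" and B: "B \<in> ?P" for \<sigma> B
      proof -
        have BU: "B \<subseteq> U" by (rule inv_partitionsD(3)[OF P B])
        have i: "inj_on \<sigma> U" by (rule group_onD(4)[OF H s])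
        have "E \<inter> Pow (\<sigma> ` B) = (`) \<sigma> ` (E \<inter> Pow B)"
        proof
          show "(`) \<sigma> ` (E \<inter> Pow B) \<subseteq> E \<inter> Pow (\<sigma> ` B)"
            using E s unfolding inv_edges_def by blast
          show "E \<inter> Pow (\<sigma> ` B) \<subseteq> (`) \<sigma> ` (E \<inter> Pow B)"
          proof
            fix e assume e: "e \<in> E \<inter> Pow (\<sigma> ` B)"
            have "(`) \<sigma> ` E = E" using E s unfolding inv_edges_def by simp
            then obtain e' where e': "e' \<in> E" "e = \<sigma> ` e'" using e by blast
            have "e' \<subseteq> U" using e'(1) EU pairs_Pow by blast
            have "x \<in> B" if x: "x \<in> e'" for x
            proof -
              obtain b where "b \<in> B" "\<sigma> x = \<sigma> b" using e e'(2) x by auto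
              then show ?thesis using inj_onD[OF i, of x b] BU \<open>e' \<subseteq> U\<close> x by auto
            qed
            then have "e' \<subseteq> B" by blast
            then show "e \<in> (`) \<sigma> ` (E \<inter> Pow B)" using e' by blast
          qed
        qed
        then show ?thesis unfolding transport_Gc by simp
      qed
      ultimately have "(\<lambda>B\<in>?P. (B, E \<inter> Pow B)) \<in> ?f ?P"
        unfolding eqv_fam_def using mem by simp
      then show "(?P, \<lambda>B\<in>?P. (B, E \<inter> Pow B)) \<in> Sigma (inv_partitions U H) ?f" using P by blast
    qed
  qed
  finally show ?thesis .
qed

section \<open>Twins, quotients and blow-ups\<close>

text \<open>Each block consists of pairwise twins.  Then two different blocks are joined by all possible
edges or by none.\<close>

definition homogeneous :: "label set \<Rightarrow> label set set \<Rightarrow> label set set \<Rightarrow> bool" where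
  "homogeneous U E P \<longleftrightarrow> (\<forall>B\<in>P. \<forall>u\<in>B. \<forall>v\<in>B. twins U E u v)"

definition quotient_edges :: "label set set \<Rightarrow> label set set \<Rightarrow> label set set" where
  "quotient_edges P E =
     {{blk A, blk B} | A B. A \<in> P \<and> B \<in> P \<and> A \<noteq> B \<and> (\<exists>u\<in>A. \<exists>v\<in>B. {u, v} \<in> E)}"

text \<open>The graph with quotient \<open>h\<close> and with the edge set \<open>\<kappa> B\<close> inside each block \<open>B\<close>.\<close>

definition blow_up :: "label set set \<Rightarrow> label set set \<Rightarrow> (label set \<Rightarrow> label set set) \<Rightarrow> label set set" where
  "blow_up P h \<kappa> = (\<Union>B\<in>P. \<kappa> B) \<union>
     {{u, v} | u v A B. A \<in> P \<and> B \<in> P \<and> A \<noteq> B \<and> u \<in> A \<and> v \<in> B \<and> {blk A, blk B} \<in> h}"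

abbreviation colours :: "label set \<Rightarrow> label set set set" where
  "colours B \<equiv> {{}, pairs B}"

lemma twins_sym: "twins U E u v \<Longrightarrow> twins U E v u"
  unfolding twins_def by blast

lemma twins_refl: "twins U E u u"
  unfolding twins_def by blast

text \<open>The only third vertex not covered by composing the two hypotheses is \<open>v\<close> itself; there each
hypothesis is applied to the vertex that the other one relates to \<open>v\<close>.\<close>

lemma twins_trans:
  assumes "twins U E u v" "twins U E v w" "u \<in> U" "v \<in> U" "w \<in> U"
  shows "twins U E u w"
  unfolding twins_def
proof (intro ballI impI)
  fix x assume x: "x \<in> U" "x \<noteq> u" "x \<noteq> w"
  show "{u, x} \<in> E \<longleftrightarrow> {w, x} \<in> E"
  proof (cases "x = v \<and> u \<noteq> w")
    case True
    then have "{u, w} \<in> E \<longleftrightarrow> {v, w} \<in> E" "{v, u} \<in> E \<longleftrightarrow> {w, u} \<in> E"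
      using assms x unfolding twins_def by auto
    then show ?thesis using True by (simp add: insert_commute)
  next
    case False then show ?thesis using assms x unfolding twins_def by auto
  qed
qed

locale invariant_partition =
  fixes U H P
  assumes H: "group_on U H" and P: "P \<in> inv_partitions U H"
begin

lemma finite_U: "finite U"
  by (rule group_onD(1)[OF H])

lemma block_eq: "A \<in> P \<Longrightarrow> B \<in> P \<Longrightarrow> x \<in> A \<Longrightarrow> x \<in> B \<Longrightarrow> A = B"
  by (rule inv_partitionsD(8)[OF P])

lemma block_of: "u \<in> U \<Longrightarrow> \<exists>B\<in>P. u \<in> B"
  using inv_partitionsD(7)[OF P] by blast

lemma blk_eq: "A \<in> P \<Longrightarrow> B \<in> P \<Longrightarrow> blk A = blk B \<longleftrightarrow> A = B"
  using inv_partitionsD(6)[OF P finite_U] by (metis unblk_blk)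

lemma quotient_iff:
  assumes AB: "A \<in> P" "B \<in> P"
  shows "{blk A, blk B} \<in> quotient_edges P E \<longleftrightarrow> A \<noteq> B \<and> (\<exists>u\<in>A. \<exists>v\<in>B. {u, v} \<in> E)"
proof
  assume "{blk A, blk B} \<in> quotient_edges P E"
  then obtain A' B' u v where h: "{blk A, blk B} = {blk A', blk B'}" "A' \<in> P" "B' \<in> P" "A' \<noteq> B'"
      "u \<in> A'" "v \<in> B'" "{u, v} \<in> E" unfolding quotient_edges_def by blast
  then consider "A = A'" "B = B'" | "A = B'" "B = A'"
    using AB by (auto simp: doubleton_eq_iff blk_eq)
  then show "A \<noteq> B \<and> (\<exists>u\<in>A. \<exists>v\<in>B. {u, v} \<in> E)"
  proof cases
    case 1 then show ?thesis using h by blast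
  next
    case 2
    have "{v, u} \<in> E" using h(7) by (simp add: insert_commute)
    then show ?thesis using 2 h by blast
  qed
next
  show "A \<noteq> B \<and> (\<exists>u\<in>A. \<exists>v\<in>B. {u, v} \<in> E) \<Longrightarrow> {blk A, blk B} \<in> quotient_edges P E"
    unfolding quotient_edges_def using AB by blast
qed

lemma quotient_pairs: "quotient_edges P E \<subseteq> pairs (blk ` P)"
  unfolding quotient_edges_def by (auto simp: blk_eq)

lemma blow_up_iff:
  assumes \<kappa>: "\<forall>B\<in>P. \<kappa> B \<subseteq> pairs B" and AB: "A \<in> P" "B \<in> P" "u \<in> A" "v \<in> B"
  shows "{u, v} \<in> blow_up P h \<kappa> \<longleftrightarrow> (if A = B then {u, v} \<in> \<kappa> A else {blk A, blk B} \<in> h)"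
proof
  assume "{u, v} \<in> blow_up P h \<kappa>"
  then consider C where "C \<in> P" "{u, v} \<in> \<kappa> C"
    | u' v' A' B' where "{u, v} = {u', v'}" "A' \<in> P" "B' \<in> P" "A' \<noteq> B'" "u' \<in> A'" "v' \<in> B'"
        "{blk A', blk B'} \<in> h"
    unfolding blow_up_def by blast
  then show "if A = B then {u, v} \<in> \<kappa> A else {blk A, blk B} \<in> h"
  proof cases
    case (1 C)
    then have "{u, v} \<in> pairs C" using \<kappa> by blast
    then have "u \<in> C" "v \<in> C" by simp_all
    then have "A = C" "B = C" using AB 1(1) block_eq by blast+
    then show ?thesis using 1 by simp
  next
    case (2 u' v' A' B')
    from 2(1) consider "u = u'" "v = v'" | "u = v'" "v = u'" by (auto simp: doubleton_eq_iff)
    then show ?thesis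
    proof cases
      case 1
      then have "A = A'" "B = B'" using AB 2 block_eq by blast+
      then show ?thesis using 2 by simp
    next
      case swapped: 2
      then have "A = B'" "B = A'" using AB 2 block_eq by blast+
      then show ?thesis using 2 by (simp add: insert_commute)
    qed
  qed
next
  assume a: "if A = B then {u, v} \<in> \<kappa> A else {blk A, blk B} \<in> h"
  show "{u, v} \<in> blow_up P h \<kappa>"
  proof (cases "A = B")
    case True then show ?thesis using a AB(1) unfolding blow_up_def by auto
  next
    case False then show ?thesis using a AB unfolding blow_up_def by auto
  qed
qed

lemma blow_up_pairs:
  assumes \<kappa>: "\<forall>B\<in>P. \<kappa> B \<subseteq> pairs B"
  shows "blow_up P h \<kappa> \<subseteq> pairs U"
proof
  fix e assume "e \<in> blow_up P h \<kappa>"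
  then consider C where "C \<in> P" "e \<in> \<kappa> C"
    | u v A B where "e = {u, v}" "A \<in> P" "B \<in> P" "A \<noteq> B" "u \<in> A" "v \<in> B"
    unfolding blow_up_def by blast
  then show "e \<in> pairs U"
  proof cases
    case (1 C)
    then have "e \<in> pairs C" using \<kappa> by blast
    then obtain u v where "u \<in> C" "v \<in> C" "u \<noteq> v" "e = {u, v}" by (rule pairsE)
    then show ?thesis using inv_partitionsD(3)[OF P 1(1)] by auto
  next
    case (2 u v A B)
    have "u \<noteq> v" using 2 block_eq by blast
    then show ?thesis using 2 inv_partitionsD(3)[OF P] by auto
  qed
qed

lemma homogeneous_across:
  assumes h: "homogeneous U E P" and AB: "A \<in> P" "B \<in> P" "A \<noteq> B"
    and uv: "u \<in> A" "u' \<in> A" "v \<in> B" "v' \<in> B" and e: "{u, v} \<in> E"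
  shows "{u', v'} \<in> E"
proof -
  have U: "u \<in> U" "u' \<in> U" "v \<in> U" "v' \<in> U" using AB uv inv_partitionsD(3)[OF P] by blast+
  have ne: "u \<noteq> v" "u' \<noteq> v" "u' \<noteq> v'" using block_eq AB uv by blast+
  have "twins U E u u'" "twins U E v v'" using h AB uv unfolding homogeneous_def by blast+
  then have "{u', v} \<in> E" using e U ne unfolding twins_def by auto
  then have "{v, u'} \<in> E" by (simp add: insert_commute)
  then have "{v', u'} \<in> E" using \<open>twins U E v v'\<close> U ne unfolding twins_def by auto
  then show ?thesis by (simp add: insert_commute)
qed

text \<open>If there is an edge inside the block then moving its ends one at a time to twins yields any other
pair of vertices of the block.\<close>

lemma homogeneous_within:
  assumes h: "homogeneous U E P" and E: "E \<subseteq> pairs U" and B: "B \<in> P"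
  shows "E \<inter> Pow B \<in> colours B"
proof (cases "E \<inter> Pow B = {}")
  case False
  have BU: "B \<subseteq> U" by (rule inv_partitionsD(3)[OF P B])
  obtain e where e: "e \<in> E" "e \<subseteq> B" using False by blast
  have "e \<in> pairs U" using e(1) E by blast
  then obtain a b where ab: "a \<noteq> b" "e = {a, b}" by (rule pairsE)
  have abB: "a \<in> B" "b \<in> B" using e(2) ab by auto
  have tw: "{u, w} \<in> E \<longleftrightarrow> {v, w} \<in> E" if "u \<in> B" "v \<in> B" "w \<in> B" "w \<noteq> u" "w \<noteq> v" for u v w
    using h B that BU unfolding homogeneous_def twins_def by blast
  have "{x, y} \<in> E" if xy: "x \<in> B" "y \<in> B" "x \<noteq> y" for x y
  proof (cases "x = b")
    case True
    have "{a, b} \<in> E \<longleftrightarrow> {y, b} \<in> E" by (rule tw) (use xy abB ab True in auto)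
    then show ?thesis using e(1) ab True by (simp add: insert_commute)
  next
    case False
    have "{a, b} \<in> E \<longleftrightarrow> {x, b} \<in> E" by (rule tw) (use xy abB ab False in auto)
    then have "{b, x} \<in> E" using e(1) ab by (simp add: insert_commute)
    moreover have "{b, x} \<in> E \<longleftrightarrow> {y, x} \<in> E" by (rule tw) (use xy abB ab False in auto)
    ultimately show ?thesis by (simp add: insert_commute)
  qed
  then have "pairs B \<subseteq> E" by (auto elim!: pairsE)
  moreover have "E \<inter> Pow B \<subseteq> pairs B"
  proof
    fix d assume d: "d \<in> E \<inter> Pow B"
    then have "d \<in> pairs U" using E by blast
    then obtain u v where "u \<noteq> v" "d = {u, v}" by (rule pairsE)
    then show "d \<in> pairs B" using d by simp
  qed
  ultimately have "E \<inter> Pow B = pairs B" using pairs_Pow[of B] by blast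
  then show ?thesis by simp
qed simp

lemma homogeneous_blow_up:
  assumes \<kappa>: "\<And>B. B \<in> P \<Longrightarrow> \<kappa> B \<in> colours B"
  shows "homogeneous U (blow_up P h \<kappa>) P"
  unfolding homogeneous_def twins_def
proof (intro ballI impI)
  fix B u v w assume B: "B \<in> P" and uv: "u \<in> B" "v \<in> B" and w: "w \<in> U" "w \<noteq> u" "w \<noteq> v"
  obtain C where C: "C \<in> P" "w \<in> C" using block_of[OF w(1)] by blast
  have k: "\<forall>B\<in>P. \<kappa> B \<subseteq> pairs B" using \<kappa> by auto
  show "{u, w} \<in> blow_up P h \<kappa> \<longleftrightarrow> {v, w} \<in> blow_up P h \<kappa>"
    unfolding blow_up_iff[OF k B C(1) uv(1) C(2)] blow_up_iff[OF k B C(1) uv(2) C(2)]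
  proof (cases "B = C")
    case True
    have "\<kappa> B = {} \<or> \<kappa> B = pairs B" using \<kappa>[OF B] by simp
    then show "(if B = C then {u, w} \<in> \<kappa> B else {blk B, blk C} \<in> h) \<longleftrightarrow>
        (if B = C then {v, w} \<in> \<kappa> B else {blk B, blk C} \<in> h)"
      using True uv w C by (elim disjE) simp_all
  qed simp
qed

abbreviation colourings where
  "colourings \<equiv> eqv_fam H (`) P colours (\<lambda>\<sigma> B a. (`) \<sigma> ` a)"

lemma colourings_iff:
  "\<kappa> \<in> colourings \<longleftrightarrow> \<kappa> \<in> Pi\<^sub>E P colours \<and> (\<forall>\<sigma>\<in>H. \<forall>B\<in>P. \<kappa> (\<sigma> ` B) = (`) \<sigma> ` \<kappa> B)"
  unfolding eqv_fam_def by simp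

lemma inj_block: "\<sigma> \<in> H \<Longrightarrow> B \<in> P \<Longrightarrow> inj_on \<sigma> B"
  using group_onD(4)[OF H] inv_partitionsD(3)[OF P] by (rule inj_on_subset)

text \<open>A colouring makes each block a clique or an independent set, consistently along orbits.  The
stabilizer of a block fixes both choices, so each orbit contributes the number of choices.\<close>

lemma sum_colourings:
  "orbit_prod H (`) P (\<lambda>B. int (card (colours B)) * f B) = int (card colourings) * orbit_prod H (`) P f"
proof -
  have b: "bundle_acting H (`) P colours (\<lambda>\<sigma> B a. (`) \<sigma> ` a)"
  proof (rule bundle_acting_set_systems[OF H P])
    fix B a assume B: "B \<in> P" and a: "a \<in> colours B"
    show "a \<subseteq> Pow U" using a pairs_Pow[of B] inv_partitionsD(3)[OF P B] by auto
    show "(`) \<sigma> ` a \<in> colours (\<sigma> ` B)" if "\<sigma> \<in> H" for \<sigma>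
      using a pairs_image[OF inj_block[OF that B]] by auto
  qed
  have fx: "stab_fixed H (`) colours (\<lambda>\<sigma> B a. (`) \<sigma> ` a) B = colours B" if B: "B \<in> P" for B
  proof -
    have "(`) \<sigma> ` a = a" if "a \<in> colours B" "\<sigma> \<in> H" "\<sigma> ` B = B" for a \<sigma>
      using that pairs_image[OF inj_block[OF that(2) B]] by auto
    then show ?thesis unfolding stab_fixed_def by auto
  qed
  have "int (card colourings) * orbit_prod H (`) P f = (\<Sum>\<kappa>\<in>colourings. orbit_prod H (`) P (\<lambda>B. f B))"
    by simp
  also have "\<dots> = orbit_prod H (`) P
      (\<lambda>B. \<Sum>a\<in>stab_fixed H (`) colours (\<lambda>\<sigma> B a. (`) \<sigma> ` a) B. f B)"
    by (rule bundle_acting.sum_eqv_fam[OF b]) (use inv_partitionsD(5)[OF P finite_U] in auto)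
  also have "\<dots> = orbit_prod H (`) P (\<lambda>B. int (card (colours B)) * f B)"
    by (rule orbit_prod_cong[OF group_acting_blocks[OF H P]]) (simp only: fx sum_constant of_nat_id)
  finally show ?thesis by simp
qed

text \<open>Taking the quotient and the graphs induced on the blocks is inverse to blowing up.\<close>

lemma card_blow_ups:
  "card {h\<in>inv_edges (blk ` P) (lift ` H). Q h} * card colourings =
   card {E\<in>inv_edges U H. homogeneous U E P \<and> Q (quotient_edges P E)}"
proof -
  let ?L = "{h\<in>inv_edges (blk ` P) (lift ` H). Q h} \<times> colourings"
  let ?R = "{E\<in>inv_edges U H. homogeneous U E P \<and> Q (quotient_edges P E)}"
  note gl = group_on_lift[OF H P]
  have kc: "\<kappa> B \<in> colours B" if "\<kappa> \<in> colourings" "B \<in> P" for \<kappa> B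
    using that unfolding colourings_iff by (auto simp: PiE_iff)
  have kp: "\<forall>B\<in>P. \<kappa> B \<subseteq> pairs B" if "\<kappa> \<in> colourings" for \<kappa>
    using kc[OF that] by auto
  have "card ?L = card ?R"
  proof (rule bij_betw_same_card, rule bij_betw_byWitness[where f = "\<lambda>(h, \<kappa>). blow_up P h \<kappa>"
        and f' = "\<lambda>E. (quotient_edges P E, \<lambda>B\<in>P. E \<inter> Pow B)"])
    have q: "quotient_edges P (blow_up P h \<kappa>) = h"
      if h: "h \<in> inv_edges (blk ` P) (lift ` H)" and k: "\<kappa> \<in> colourings" for h \<kappa>
    proof (rule edges_eqI[OF quotient_pairs])
      show "h \<subseteq> pairs (blk ` P)" by (rule inv_edgesD(1)[OF gl h])
      fix a b assume "a \<in> blk ` P" "b \<in> blk ` P" "a \<noteq> b"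
      then obtain A B where AB: "A \<in> P" "B \<in> P" "a = blk A" "b = blk B" "A \<noteq> B" by auto
      obtain u v where "u \<in> A" "v \<in> B" using inv_partitionsD(4)[OF P] AB(1,2) by blast
      then show "{a, b} \<in> quotient_edges P (blow_up P h \<kappa>) \<longleftrightarrow> {a, b} \<in> h"
        unfolding AB(3,4) quotient_iff[OF AB(1,2)]
        using blow_up_iff[OF kp[OF k] AB(1,2)] AB(5) by auto
    qed
    have c: "blow_up P h \<kappa> \<inter> Pow B = \<kappa> B" if k: "\<kappa> \<in> colourings" and B: "B \<in> P" for h \<kappa> B
    proof (rule edges_eqI[of _ B])
      show "\<kappa> B \<subseteq> pairs B" using kp[OF k] B by simp
      show "blow_up P h \<kappa> \<inter> Pow B \<subseteq> pairs B"
      proof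
        fix d assume d: "d \<in> blow_up P h \<kappa> \<inter> Pow B"
        then have "d \<in> pairs U" using blow_up_pairs[OF kp[OF k]] by blast
        then obtain u v where "u \<noteq> v" "d = {u, v}" by (rule pairsE)
        then show "d \<in> pairs B" using d by simp
      qed
      fix u v assume uv: "u \<in> B" "v \<in> B"
      then show "{u, v} \<in> blow_up P h \<kappa> \<inter> Pow B \<longleftrightarrow> {u, v} \<in> \<kappa> B"
        using blow_up_iff[OF kp[OF k] B B uv] by simp
    qed
    show "\<forall>x\<in>?L. (\<lambda>E. (quotient_edges P E, \<lambda>B\<in>P. E \<inter> Pow B)) ((\<lambda>(h, \<kappa>). blow_up P h \<kappa>) x) = x"
    proof
      fix x assume "x \<in> ?L"
      then obtain h \<kappa> where x: "x = (h, \<kappa>)" "h \<in> inv_edges (blk ` P) (lift ` H)" "\<kappa> \<in> colourings" by auto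
      have "(\<lambda>B\<in>P. blow_up P h \<kappa> \<inter> Pow B) = \<kappa>"
      proof (rule extensionalityI[of _ P])
        show "\<kappa> \<in> extensional P" using x(3) unfolding colourings_iff by (auto simp: PiE_def)
      qed (use c[OF x(3)] in auto)
      then show "(\<lambda>E. (quotient_edges P E, \<lambda>B\<in>P. E \<inter> Pow B)) ((\<lambda>(h, \<kappa>). blow_up P h \<kappa>) x) = x"
        unfolding x(1) using q[OF x(2,3)] by simp
    qed
    show "\<forall>E\<in>?R. (\<lambda>(h, \<kappa>). blow_up P h \<kappa>) (quotient_edges P E, \<lambda>B\<in>P. E \<inter> Pow B) = E"
    proof
      fix E assume "E \<in> ?R"
      then have E: "E \<in> inv_edges U H" and hom: "homogeneous U E P" by auto
      note EU = inv_edgesD(1)[OF H E]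
      have k: "\<forall>B\<in>P. (\<lambda>B\<in>P. E \<inter> Pow B) B \<subseteq> pairs B"
        using homogeneous_within[OF hom EU] by auto
      have "blow_up P (quotient_edges P E) (\<lambda>B\<in>P. E \<inter> Pow B) = E"
      proof (rule edges_eqI[OF blow_up_pairs[OF k] EU])
        fix u v assume uv: "u \<in> U" "v \<in> U" "u \<noteq> v"
        obtain A B where AB: "A \<in> P" "B \<in> P" "u \<in> A" "v \<in> B" using block_of uv by blast
        show "{u, v} \<in> blow_up P (quotient_edges P E) (\<lambda>B\<in>P. E \<inter> Pow B) \<longleftrightarrow> {u, v} \<in> E"
          unfolding blow_up_iff[OF k AB] quotient_iff[OF AB(1,2)]
        proof (cases "A = B")
          case True
          then show "(if A = B then {u, v} \<in> (\<lambda>B\<in>P. E \<inter> Pow B) A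
              else A \<noteq> B \<and> (\<exists>u\<in>A. \<exists>v\<in>B. {u, v} \<in> E)) \<longleftrightarrow> {u, v} \<in> E"
            using AB by simp
        next
          case False
          have "(\<exists>u\<in>A. \<exists>v\<in>B. {u, v} \<in> E) \<longleftrightarrow> {u, v} \<in> E"
          proof
            assume "\<exists>u\<in>A. \<exists>v\<in>B. {u, v} \<in> E"
            then obtain u' v' where "u' \<in> A" "v' \<in> B" "{u', v'} \<in> E" by (elim bexE)
            then show "{u, v} \<in> E"
              using homogeneous_across[OF hom AB(1,2) False _ AB(3) _ AB(4)] by simp
          qed (intro bexI[OF bexI[OF _ AB(4)] AB(3)])
          then show "(if A = B then {u, v} \<in> (\<lambda>B\<in>P. E \<inter> Pow B) A
              else A \<noteq> B \<and> (\<exists>u\<in>A. \<exists>v\<in>B. {u, v} \<in> E)) \<longleftrightarrow> {u, v} \<in> E"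
            using False by simp
        qed
      qed
      then show "(\<lambda>(h, \<kappa>). blow_up P h \<kappa>) (quotient_edges P E, \<lambda>B\<in>P. E \<inter> Pow B) = E" by simp
    qed
    show "(\<lambda>(h, \<kappa>). blow_up P h \<kappa>) ` ?L \<subseteq> ?R"
    proof (rule image_subsetI)
      fix x assume "x \<in> ?L"
      then obtain h \<kappa> where x: "x = (h, \<kappa>)" "h \<in> inv_edges (blk ` P) (lift ` H)" "\<kappa> \<in> colourings" "Q h" by auto
      have "blow_up P h \<kappa> \<in> inv_edges U H"
      proof (rule inv_edgesI[OF H blow_up_pairs[OF kp[OF x(3)]]])
        fix \<sigma> u v assume s: "\<sigma> \<in> H" and uv: "u \<in> U" "v \<in> U" and e: "{u, v} \<in> blow_up P h \<kappa>"
        obtain A B where AB: "A \<in> P" "B \<in> P" "u \<in> A" "v \<in> B" using block_of uv by blast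
        have s': "\<sigma> ` A \<in> P" "\<sigma> ` B \<in> P" "\<sigma> u \<in> \<sigma> ` A" "\<sigma> v \<in> \<sigma> ` B"
          using inv_partitionsD(2)[OF P s] AB by auto
        have "\<sigma> ` A = \<sigma> ` B \<longleftrightarrow> A = B"
          using inj_on_image_eq_iff[OF group_onD(4)[OF H s]] inv_partitionsD(3)[OF P] AB(1,2) by blast
        moreover have "{\<sigma> u, \<sigma> v} \<in> \<kappa> (\<sigma> ` A)" if "{u, v} \<in> \<kappa> A"
        proof -
          have "\<kappa> (\<sigma> ` A) = (`) \<sigma> ` \<kappa> A" using x(3) s AB(1) unfolding colourings_iff by blast
          then show ?thesis using imageI[OF that, of "(`) \<sigma>"] by simp
        qed
        moreover have "{blk (\<sigma> ` A), blk (\<sigma> ` B)} \<in> h" if "{blk A, blk B} \<in> h"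
        proof -
          have "{lift \<sigma> (blk A), lift \<sigma> (blk B)} \<in> h"
            using inv_edgesD(2)[OF gl x(2), of "lift \<sigma>" "blk A" "blk B"] s AB(1,2) that by blast
          then show ?thesis using inv_partitionsD(6)[OF P finite_U] AB(1,2) by simp
        qed
        ultimately show "{\<sigma> u, \<sigma> v} \<in> blow_up P h \<kappa>"
          using e unfolding blow_up_iff[OF kp[OF x(3)] AB] blow_up_iff[OF kp[OF x(3)] s']
          by (auto split: if_splits)
      qed
      moreover have "homogeneous U (blow_up P h \<kappa>) P"
        by (rule homogeneous_blow_up) (rule kc[OF x(3)])
      ultimately show "(\<lambda>(h, \<kappa>). blow_up P h \<kappa>) x \<in> ?R"
        unfolding x(1) using q[OF x(2,3)] x(4) by simp
    qed
    show "(\<lambda>E. (quotient_edges P E, \<lambda>B\<in>P. E \<inter> Pow B)) ` ?R \<subseteq> ?L"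
    proof (rule image_subsetI)
      fix E assume "E \<in> ?R"
      then have E: "E \<in> inv_edges U H" and hom: "homogeneous U E P" and QE: "Q (quotient_edges P E)" by auto
      note EU = inv_edgesD(1)[OF H E]
      have "quotient_edges P E \<in> inv_edges (blk ` P) (lift ` H)"
      proof (rule inv_edgesI[OF gl quotient_pairs])
        fix \<tau> a b assume "\<tau> \<in> lift ` H" "a \<in> blk ` P" "b \<in> blk ` P" and e: "{a, b} \<in> quotient_edges P E"
        then obtain \<sigma> A B where s: "\<sigma> \<in> H" "\<tau> = lift \<sigma>" and AB: "A \<in> P" "B \<in> P" "a = blk A" "b = blk B" by auto
        obtain u v where uv: "u \<in> A" "v \<in> B" "{u, v} \<in> E" "A \<noteq> B"
          using e unfolding AB(3,4) quotient_iff[OF AB(1,2)] by blast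
        have s': "\<sigma> ` A \<in> P" "\<sigma> ` B \<in> P" using inv_partitionsD(2)[OF P s(1)] AB by auto
        have "u \<in> U" "v \<in> U" using uv(1,2) AB(1,2) inv_partitionsD(3)[OF P] by blast+
        then have "{\<sigma> u, \<sigma> v} \<in> E" using inv_edgesD(2)[OF H E s(1)] uv(3) by blast
        moreover have "\<sigma> ` A \<noteq> \<sigma> ` B"
          using inj_on_image_eq_iff[OF group_onD(4)[OF H s(1)]] inv_partitionsD(3)[OF P] AB(1,2) uv(4) by blast
        ultimately have "{blk (\<sigma> ` A), blk (\<sigma> ` B)} \<in> quotient_edges P E"
          unfolding quotient_iff[OF s'] using uv(1,2) by blast
        then show "{\<tau> a, \<tau> b} \<in> quotient_edges P E"
          unfolding s(2) AB(3,4) using inv_partitionsD(6)[OF P finite_U] AB(1,2) by simp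
      qed
      moreover have "(\<lambda>B\<in>P. E \<inter> Pow B) \<in> colourings"
        unfolding colourings_iff
      proof (intro conjI ballI)
        show "(\<lambda>B\<in>P. E \<inter> Pow B) \<in> Pi\<^sub>E P colours"
          using homogeneous_within[OF hom EU] by (intro restrict_PiE_iff[THEN iffD2] ballI)
        fix \<sigma> B assume s: "\<sigma> \<in> H" and B: "B \<in> P"
        have e: "(`) \<sigma> ` E = E" using E s unfolding inv_edges_def by simp
        have "(`) \<sigma> ` (E \<inter> Pow B) = (`) \<sigma> ` E \<inter> (`) \<sigma> ` Pow B"
        proof (rule inj_on_image_Int[OF inj_on_image_Pow[OF group_onD(4)[OF H s]]])
          show "E \<subseteq> Pow U" using EU pairs_Pow by blast
          show "Pow B \<subseteq> Pow U" using inv_partitionsD(3)[OF P B] by blast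
        qed
        also have "\<dots> = E \<inter> Pow (\<sigma> ` B)" unfolding e image_Pow_surj[OF refl] ..
        finally show "(\<lambda>B\<in>P. E \<inter> Pow B) (\<sigma> ` B) = (`) \<sigma> ` (\<lambda>B\<in>P. E \<inter> Pow B) B"
          using B inv_partitionsD(2)[OF P s B] by simp
      qed
      ultimately show "(quotient_edges P E, \<lambda>B\<in>P. E \<inter> Pow B) \<in> ?L" using QE by simp
    qed
  qed
  then show ?thesis by (simp add: card_cartesian_product)
qed

text \<open>A path in the graph induces one in the quotient.  Conversely, adjacent blocks are completely joined,
so paths lift with arbitrary end points; two vertices of one block are joined through a vertex of
another block, which exists as \<open>P \<noteq> {U}\<close>.\<close>

lemma connected_quotient_iff:
  assumes E: "E \<subseteq> pairs U" and hom: "homogeneous U E P" and PU: "P \<noteq> {U}" and ne: "U \<noteq> {}"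
  shows "connected_graph (blk ` P, quotient_edges P E) \<longleftrightarrow> connected_graph (U, E)"
proof -
  let ?h = "quotient_edges P E"
  have Pne: "P \<noteq> {}" using ne inv_partitionsD(7)[OF P] by auto
  show ?thesis
  proof
    assume c: "connected_graph (U, E)"
    define \<phi> where "\<phi> u = blk (THE B. B \<in> P \<and> u \<in> B)" for u
    have phi: "\<phi> u = blk B" if "B \<in> P" "u \<in> B" for u B
    proof -
      have "(THE B. B \<in> P \<and> u \<in> B) = B" using that block_eq by (intro the_equality) auto
      then show ?thesis unfolding \<phi>_def by simp
    qed
    have st: "(\<phi> a, \<phi> b) \<in> conn ?h" if e: "{a, b} \<in> E" for a b
    proof -
      have ab: "a \<in> U" "b \<in> U" using subsetD[OF E e] by simp_all
      obtain A B where AB: "A \<in> P" "B \<in> P" "a \<in> A" "b \<in> B" using block_of ab by blast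
      show ?thesis
      proof (cases "A = B")
        case True then show ?thesis using phi AB conn_refl by metis
      next
        case False
        then have "{blk A, blk B} \<in> ?h" unfolding quotient_iff[OF AB(1,2)] using AB(3,4) e by blast
        then show ?thesis unfolding phi[OF AB(1,3)] phi[OF AB(2,4)] by (rule conn_edge)
      qed
    qed
    have "(blk A, blk B) \<in> conn ?h" if AB: "A \<in> P" "B \<in> P" for A B
    proof -
      obtain u v where uv: "u \<in> A" "v \<in> B" using AB inv_partitionsD(4)[OF P] by blast
      have "u \<in> U" "v \<in> U" using AB uv inv_partitionsD(3)[OF P] by blast+
      then have "(u, v) \<in> conn E" using c unfolding connected_iff by blast
      then have "(\<phi> u, \<phi> v) \<in> conn ?h" by (rule conn_map) (rule st)
      then show ?thesis unfolding phi[OF AB(1) uv(1)] phi[OF AB(2) uv(2)] .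
    qed
    then show "connected_graph (blk ` P, ?h)" unfolding connected_iff using Pne by blast
  next
    assume c: "connected_graph (blk ` P, ?h)"
    have reach: "\<forall>u\<in>A. \<forall>v\<in>B. A \<noteq> B \<longrightarrow> (u, v) \<in> conn E" if AB: "A \<in> P" "B \<in> P" for A B
    proof -
      have "(blk A, blk B) \<in> conn ?h" using c AB unfolding connected_iff by blast
      then have "\<forall>B\<in>P. blk B = b \<longrightarrow> (\<forall>u\<in>A. \<forall>v\<in>B. A = B \<or> (u, v) \<in> conn E)"
        if "b = blk B" for b
        unfolding that
      proof (induction rule: conn_induct)
        case refl then show ?case using AB(1) blk_eq by blast
      next
        case (step x y)
        show ?case
        proof (intro ballI impI)
          fix C u v assume C: "C \<in> P" "blk C = y" and u: "u \<in> A" and v: "v \<in> C"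
          have "x \<in> blk ` P" using subsetD[OF quotient_pairs step(2)] by simp
          then obtain D where D: "D \<in> P" "x = blk D" by blast
          have "{blk D, blk C} \<in> ?h" using step(2) D C by simp
          then obtain d v' where dv: "d \<in> D" "v' \<in> C" "{d, v'} \<in> E" "D \<noteq> C"
            unfolding quotient_iff[OF D(1) C(1)] by blast
          show "A = C \<or> (u, v) \<in> conn E"
          proof (cases "A = D")
            case True
            have "{u, v} \<in> E"
              using homogeneous_across[OF hom D(1) C(1) dv(4) dv(1) _ dv(2) v dv(3)] u True by blast
            then show ?thesis using conn_edge by blast
          next
            case False
            then have "(u, d) \<in> conn E" using step(3) D u dv(1) by blast
            moreover have "{d, v} \<in> E"
              using homogeneous_across[OF hom D(1) C(1) dv(4) dv(1) dv(1) dv(2) v dv(3)] .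
            ultimately show ?thesis using conn_edge conn_trans by blast
          qed
        qed
      qed
      then show ?thesis using AB(2) by blast
    qed
    have "(u, v) \<in> conn E" if uv: "u \<in> U" "v \<in> U" for u v
    proof -
      obtain A B where AB: "A \<in> P" "B \<in> P" "u \<in> A" "v \<in> B" using block_of uv by blast
      show ?thesis
      proof (cases "A = B")
        case False then show ?thesis using reach[OF AB(1,2)] AB(3,4) by blast
      next
        case True
        have "\<exists>C\<in>P. C \<noteq> A"
        proof (rule ccontr)
          assume "\<not> (\<exists>C\<in>P. C \<noteq> A)"
          then have "P = {A}" using AB(1) by blast
          then show False using PU inv_partitionsD(7)[OF P] by auto
        qed
        then obtain C where C: "C \<in> P" "C \<noteq> A" by blast
        obtain w where w: "w \<in> C" using inv_partitionsD(4)[OF P C(1)] by blast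
        have "(u, w) \<in> conn E" using reach[OF AB(1) C(1)] AB(3) w C(2) by blast
        moreover have "(w, v) \<in> conn E" using reach[OF C(1) AB(2)] AB(4) w C(2) True by blast
        ultimately show ?thesis by (rule conn_trans)
      qed
    qed
    then show "connected_graph (U, E)" unfolding connected_iff using ne by blast
  qed
qed

end

definition twin_classes :: "label set \<Rightarrow> label set set \<Rightarrow> label set set" where
  "twin_classes U E = (\<lambda>u. {v\<in>U. twins U E u v}) ` U"

lemma twin_classes:
  assumes H: "group_on U H" and E: "E \<in> inv_edges U H"
  shows "twin_classes U E \<in> inv_partitions U H"
    and "P \<in> inv_partitions U H \<Longrightarrow> refines P (twin_classes U E) \<longleftrightarrow> homogeneous U E P"
    and "(\<forall>B\<in>twin_classes U E. \<exists>u. B = {u}) \<longleftrightarrow> bi_point_determining (U, E)"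
proof -
  let ?c = "\<lambda>u. {v\<in>U. twins U E u v}"
  interpret group_acting H "\<lambda>\<sigma>. \<sigma>" U by (rule group_onD(2)[OF H])
  have ceq: "?c u = ?c v" if "u \<in> U" "v \<in> U" "twins U E u v" for u v
    using that twins_trans twins_sym by blast
  have "partition_on U (twin_classes U E)"
    unfolding twin_classes_def
  proof (rule partition_onI)
    show "\<Union>(?c ` U) = U" "{} \<notin> ?c ` U" using twins_refl by blast+
    fix A B assume "A \<in> ?c ` U" "B \<in> ?c ` U" "A \<noteq> B"
    then obtain u v where uv: "u \<in> U" "v \<in> U" "A = ?c u" "B = ?c v" by auto
    have False if "x \<in> A" "x \<in> B" for x
      using that ceq[of u x] ceq[of v x] uv \<open>A \<noteq> B\<close> by auto
    then show "disjnt A B" unfolding disjnt_iff by blast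
  qed
  moreover have "\<sigma> ` B \<in> twin_classes U E" if s: "\<sigma> \<in> H" and B: "B \<in> twin_classes U E" for \<sigma> B
  proof -
    obtain u where u: "u \<in> U" "B = ?c u" using B unfolding twin_classes_def by blast
    have tw: "twins U E (\<sigma> v) (\<sigma> w) \<longleftrightarrow> twins U E v w" if vw: "v \<in> U" "w \<in> U" for v w
    proof -
      have "twins U E (\<sigma> v) (\<sigma> w) \<longleftrightarrow> (\<forall>x\<in>\<sigma> ` U. x \<noteq> \<sigma> v \<longrightarrow> x \<noteq> \<sigma> w \<longrightarrow> {\<sigma> v, x} \<in> E \<longleftrightarrow> {\<sigma> w, x} \<in> E)"
        unfolding twins_def group_onD(5)[OF H s] ..
      also have "\<dots> \<longleftrightarrow> (\<forall>x\<in>U. x \<noteq> v \<longrightarrow> x \<noteq> w \<longrightarrow> {v, x} \<in> E \<longleftrightarrow> {w, x} \<in> E)"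
        using inv_edgesD(2)[OF H E s vw(1)] inv_edgesD(2)[OF H E s vw(2)]
          inj_on_eq_iff[OF group_onD(4)[OF H s]] vw by simp
      finally show ?thesis unfolding twins_def .
    qed
    have "\<sigma> ` ?c u = ?c (\<sigma> u)"
    proof
      show "\<sigma> ` ?c u \<subseteq> ?c (\<sigma> u)" using tw[OF u(1)] closed[OF s] by auto
      show "?c (\<sigma> u) \<subseteq> \<sigma> ` ?c u"
      proof
        fix v assume v: "v \<in> ?c (\<sigma> u)"
        then have "v \<in> \<sigma> ` U" using group_onD(5)[OF H s] by simp
        then obtain w where "w \<in> U" "v = \<sigma> w" by blast
        then show "v \<in> \<sigma> ` ?c u" using v tw[OF u(1)] by blast
      qed
    qed
    then show ?thesis unfolding twin_classes_def u(2) using closed[OF s u(1)] by simp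
  qed
  ultimately show T: "twin_classes U E \<in> inv_partitions U H" unfolding inv_partitions_def by blast
  show "refines P (twin_classes U E) \<longleftrightarrow> homogeneous U E P" if P: "P \<in> inv_partitions U H"
  proof
    assume r: "refines P (twin_classes U E)"
    show "homogeneous U E P"
      unfolding homogeneous_def
    proof (intro ballI)
      fix B u v assume B: "B \<in> P" and uv: "u \<in> B" "v \<in> B"
      obtain w where w: "w \<in> U" "B \<subseteq> ?c w" using r B unfolding refines_def twin_classes_def by blast
      then have "u \<in> U" "v \<in> U" "twins U E w u" "twins U E w v" using uv by auto
      then show "twins U E u v" using twins_trans[OF twins_sym] w(1) by blast
    qed
  next
    assume h: "homogeneous U E P"
    show "refines P (twin_classes U E)"
      unfolding refines_def
    proof
      fix B assume B: "B \<in> P"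
      obtain u where u: "u \<in> B" using inv_partitionsD(4)[OF P B] by blast
      have "B \<subseteq> ?c u" using h B u inv_partitionsD(3)[OF P B] unfolding homogeneous_def by blast
      then show "\<exists>C\<in>twin_classes U E. B \<subseteq> C"
        unfolding twin_classes_def using u inv_partitionsD(3)[OF P B] by blast
    qed
  qed
  show "(\<forall>B\<in>twin_classes U E. \<exists>u. B = {u}) \<longleftrightarrow> bi_point_determining (U, E)"
    unfolding bi_point_determining_iff[OF inv_edgesD(1)[OF H E]]
  proof
    assume s: "\<forall>B\<in>twin_classes U E. \<exists>u. B = {u}"
    show "\<forall>u\<in>U. \<forall>v\<in>U. twins U E u v \<longrightarrow> u = v"
    proof (intro ballI impI)
      fix u v assume uv: "u \<in> U" "v \<in> U" "twins U E u v"
      obtain w where "?c u = {w}" using s uv(1) unfolding twin_classes_def by blast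
      then have "u \<in> {w}" "v \<in> {w}" using uv twins_refl by blast+
      then show "u = v" by simp
    qed
  next
    assume b: "\<forall>u\<in>U. \<forall>v\<in>U. twins U E u v \<longrightarrow> u = v"
    have "?c u = {u}" if "u \<in> U" for u using b that twins_refl by blast
    then show "\<forall>B\<in>twin_classes U E. \<exists>u. B = {u}" unfolding twin_classes_def by blast
  qed
qed

section \<open>The two identities\<close>

abbreviation (input) log_mark :: "label set \<Rightarrow> (label \<Rightarrow> label) set \<Rightarrow> int" where
  "log_mark \<equiv> umark one_plus_X_c"

abbreviation (input) twin_inverse where
  "twin_inverse \<equiv> one_plus_X_c +\<^sub>V one_plus_X_c -\<^sub>V virt sp_X"

lemma is_virtual_X: "is_virtual (virt sp_X)"
  by (rule is_virtual_virt[OF is_species_single])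

lemma umark_X: "umark (virt sp_X) U H = of_bool (\<exists>u. U = {u})"
  unfolding umark_virt mark_single by simp

lemma umark_add:
  "is_virtual V \<Longrightarrow> is_virtual W \<Longrightarrow> finite U \<Longrightarrow> umark (V +\<^sub>V W) U H = umark V U H + umark W U H"
  unfolding umark_def by (rule vmark_add)

lemma umark_diff:
  "is_virtual V \<Longrightarrow> is_virtual W \<Longrightarrow> finite U \<Longrightarrow> umark (V -\<^sub>V W) U H = umark V U H - umark W U H"
  unfolding umark_def by (rule vmark_diff)

lemma is_virtual_twin_inverse: "is_virtual twin_inverse"
  by (intro is_virtual_diff is_virtual_add one_plus_X_c(1) is_virtual_X)

lemma log_mark_point:
  assumes H: "group_on {u} H"
  shows "log_mark {u} H = 1"
proof -
  have none: "inv_partitions {u} H - {{{u}}} = {}"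
  proof (rule equals0I)
    fix P assume P: "P \<in> inv_partitions {u} H - {{{u}}}"
    then have P': "P \<in> inv_partitions {u} H" "P \<noteq> {{u}}" by auto
    obtain B where B: "B \<in> P" "u \<in> B" using inv_partitionsD(7)[OF P'(1)] by blast
    have "card B < 1" using block_card_less[OF _ P' B(1)] by simp
    moreover have "finite B" using inv_partitionsD(6)[OF P'(1) _ B(1)] by simp
    ultimately show False using B(2) by (simp add: card_gt_0_iff)
  qed
  then show ?thesis
    using one_plus_X_c(2)[OF H] unfolding plethysm_split_whole[OF H insert_not_empty] none by simp
qed

text \<open>On a set with at least two elements the clique and the independent set are different, and the mark
of \<open>2 (1 + X)\<^sup>c - X\<close> is twice that of \<open>(1 + X)\<^sup>c\<close>; on a point the two colours coincide, and the
marks are \<open>2 - 1\<close> and \<open>1\<close>.\<close>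

lemma twin_inverse_mark:
  assumes H: "group_on B K" and B: "B \<noteq> {}"
  shows "umark twin_inverse B K = int (card (colours B)) * log_mark B K"
proof -
  have fin: "finite B" by (rule group_onD(1)[OF H])
  have m: "umark twin_inverse B K = 2 * log_mark B K - of_bool (\<exists>u. B = {u})"
    by (simp add: umark_diff umark_add is_virtual_add one_plus_X_c(1) is_virtual_X fin umark_X)
  show ?thesis
  proof (cases "\<exists>u. B = {u}")
    case True
    then obtain u where u: "B = {u}" by blast
    have "pairs {u} = {}" unfolding pairs_def by auto
    then show ?thesis using m log_mark_point H unfolding u by simp
  next
    case False
    obtain u where u: "u \<in> B" using B by blast
    then obtain v where "v \<in> B" "v \<noteq> u" using False by blast
    then have "{u, v} \<in> pairs B" using u by simp
    then have "pairs B \<noteq> {}" by blast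
    then show ?thesis using m False by simp
  qed
qed

text \<open>The homogeneous partitions are those finer than the partition into twin classes, so the sum is a
product over the orbits of twin classes \<open>T\<close> of marks of \<open>\<E>\<^sub>+ \<circ> (1 + X)\<^sup>c = X\<close> on \<open>T\<close>.\<close>

lemma sum_over_twin_partitions:
  assumes H: "group_on U H" and E: "E \<in> inv_edges U H"
  shows "(\<Sum>P | P \<in> inv_partitions U H \<and> homogeneous U E P. orbit_prod H (`) P (\<lambda>B. log_mark B (stab H B))) =
    of_bool (bi_point_determining (U, E))"
proof -
  let ?T = "twin_classes U E"
  note T = twin_classes[OF H E]
  interpret group_acting H "(`)" ?T by (rule group_acting_blocks[OF H T(1)])
  have "(\<Sum>P | P \<in> inv_partitions U H \<and> homogeneous U E P. orbit_prod H (`) P (\<lambda>B. log_mark B (stab H B))) =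
      (\<Sum>P | P \<in> inv_partitions U H \<and> refines P ?T. orbit_prod H (`) P (\<lambda>B. log_mark B (stab H B)))"
    using T(2) by (intro sum.cong) auto
  also have "\<dots> = orbit_prod H (`) ?T (\<lambda>B. plethysm one log_mark B (stab H B))"
    by (simp add: orbit_prod_plethysm[OF H T(1) invariant_umark[OF one_plus_X_c(1)]] orbit_prod_one)
  also have "\<dots> = orbit_prod H (`) ?T (\<lambda>B. of_bool (\<exists>u. B = {u}))"
    by (rule orbit_prod_cong[OF group_acting_axioms],
        rule one_plus_X_c(2)[OF group_on_stab[OF H inv_partitionsD(3)[OF T(1)]] inv_partitionsD(4)[OF T(1)]])
  also have "\<dots> = of_bool (\<forall>B\<in>?T. \<exists>u. B = {u})"
  proof (cases "\<forall>B\<in>?T. \<exists>u. B = {u}")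
    case True
    then have "orbit_prod H (`) ?T (\<lambda>B. of_bool (\<exists>u. B = {u})) = orbit_prod H (`) ?T (\<lambda>B. 1)"
      by (intro orbit_prod_cong[OF group_acting_axioms]) simp
    then show ?thesis using True by (simp add: orbit_prod_one)
  next
    case False
    then obtain B where B: "B \<in> ?T" "\<not> (\<exists>u. B = {u})" by blast
    obtain t \<sigma> where t: "t \<in> transv H (`) ?T" "\<sigma> \<in> H" "\<sigma> ` t = B"
      using transv B(1) unfolding transversal_def by metis
    have "\<not> (\<exists>u. t = {u})" using B(2) t(3) by auto
    then have "orbit_prod H (`) ?T (\<lambda>B. of_bool (\<exists>u. B = {u})) = 0"
      unfolding orbit_prod_def
      using t(1) finite_subset[OF transv_sub inv_partitionsD(5)[OF T(1) group_onD(1)[OF H]]]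
      by (intro prod_zero) (auto intro!: bexI[of _ t])
    then show ?thesis using False by simp
  qed
  also have "\<dots> = of_bool (bi_point_determining (U, E))" unfolding T(3) ..
  finally show ?thesis .
qed

text \<open>For each partition \<open>P\<close>, the factor counting colourings is absorbed by blowing up the graph on the
set of blocks.  The sum over \<open>P\<close> and graphs on \<open>P\<close> becomes one over graphs on \<open>U\<close> and their
homogeneous partitions.\<close>

lemma plethysm_twin_inverse:
  assumes f: "\<And>V K. group_on V K \<Longrightarrow> V \<noteq> {} \<Longrightarrow> f V K = int (card {h\<in>inv_edges V K. Q (V, h)})"
    and H: "group_on U H" and U: "U \<noteq> {}"
  shows "plethysm f (umark twin_inverse) U H =
    (\<Sum>E\<in>inv_edges U H. \<Sum>P | P \<in> inv_partitions U H \<and> homogeneous U E P \<and> Q (blk ` P, quotient_edges P E).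
       orbit_prod H (`) P (\<lambda>B. log_mark B (stab H B)))"
proof -
  let ?I = "inv_partitions U H" and ?G = "inv_edges U H"
  define w where "w P = orbit_prod H (`) P (\<lambda>B. log_mark B (stab H B))" for P
  define R where "R E P \<longleftrightarrow> homogeneous U E P \<and> Q (blk ` P, quotient_edges P E)" for E P
  have fin: "finite ?I" "finite ?G"
    using finite_inv_partitions finite_inv_edges group_onD(1)[OF H] by blast+
  have "f (blk ` P) (lift ` H) * orbit_prod H (`) P (\<lambda>B. umark twin_inverse B (stab H B)) =
      (\<Sum>E | E \<in> ?G \<and> R E P. w P)" if P: "P \<in> ?I" for P
  proof -
    interpret invariant_partition U H P using H P by unfold_locales
    have "P \<noteq> {}" using inv_partitionsD(7)[OF P] U by auto
    then have fP: "f (blk ` P) (lift ` H) =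
        int (card {h\<in>inv_edges (blk ` P) (lift ` H). Q (blk ` P, h)})"
      using f[OF group_on_lift[OF H P]] by simp
    have "orbit_prod H (`) P (\<lambda>B. umark twin_inverse B (stab H B)) =
        orbit_prod H (`) P (\<lambda>B. int (card (colours B)) * log_mark B (stab H B))"
      by (rule orbit_prod_cong[OF group_acting_blocks[OF H P]],
          rule twin_inverse_mark[OF group_on_stab[OF H inv_partitionsD(3)[OF P]] inv_partitionsD(4)[OF P]])
    also have "\<dots> = int (card colourings) * w P" unfolding w_def by (rule sum_colourings)
    finally have "f (blk ` P) (lift ` H) * orbit_prod H (`) P (\<lambda>B. umark twin_inverse B (stab H B)) =
        int (card {h\<in>inv_edges (blk ` P) (lift ` H). Q (blk ` P, h)} * card colourings) * w P"
      unfolding fP by simp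
    also have "\<dots> = int (card {E\<in>?G. homogeneous U E P \<and> Q (blk ` P, quotient_edges P E)}) * w P"
      unfolding card_blow_ups[of "\<lambda>h. Q (blk ` P, h)"] ..
    finally show ?thesis unfolding R_def by simp
  qed
  then have "plethysm f (umark twin_inverse) U H = (\<Sum>P\<in>?I. \<Sum>E | E \<in> ?G \<and> R E P. w P)"
    unfolding plethysm_def by (rule sum.cong[OF refl])
  also have "\<dots> = (\<Sum>E\<in>?G. \<Sum>P | P \<in> ?I \<and> R E P. w P)"
    by (rule sum.swap_restrict[OF fin])
  finally show ?thesis unfolding R_def w_def .
qed

lemma umark_graph:
  "group_on U H \<Longrightarrow> umark (virt (graph_species Q)) U H = int (card {E\<in>inv_edges U H. Q (U, E)})"
  unfolding umark_virt by (rule mark_graph)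

text \<open>The identity \<open>(\<E>\<^sub>+ \<circ> \<G>\<^sup>c) \<circ> (2 (1 + X)\<^sup>c - X) = \<B>\<^sub>+\<close>.\<close>

lemma plethysm_all_graphs_twin_inverse:
  assumes H: "group_on U H" and U: "U \<noteq> {}"
  shows "plethysm (plethysm one (umark (virt sp_Gc))) (umark twin_inverse) U H = umark (virt sp_B_plus) U H"
proof -
  have "plethysm (plethysm one (umark (virt sp_Gc))) (umark twin_inverse) U H =
      (\<Sum>E\<in>inv_edges U H. of_bool (bi_point_determining (U, E)))"
    by (subst plethysm_twin_inverse[where Q = "\<lambda>_. True", OF _ H U])
      (simp_all add: plethysm_connected sum_over_twin_partitions[OF H])
  also have "\<dots> = umark (virt sp_B_plus) U H"
    unfolding sp_B_plus_def umark_graph[OF H]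
    using U finite_inv_edges[OF group_onD(1)[OF H], of H] by (simp add: Int_def)
  finally show ?thesis .
qed

text \<open>For a connected graph all homogeneous partitions have a connected quotient, and they add up as in
the case of all graphs.  A disconnected graph has a connected quotient only for the partition
\<open>{U}\<close>, which is homogeneous only if the graph is edgeless.\<close>

lemma plethysm_connected_twin_inverse:
  assumes H: "group_on U H" and U: "U \<noteq> {}"
  shows "plethysm (umark (virt sp_Gc)) (umark twin_inverse) U H =
    umark (virt sp_Bc) U H + log_mark U H - of_bool (\<exists>u. U = {u})"
proof -
  let ?G = "inv_edges U H"
  define w where "w P = orbit_prod H (`) P (\<lambda>B. log_mark B (stab H B))" for P
  define s where "s E = (\<Sum>P | P \<in> inv_partitions U H \<and> homogeneous U E P \<and>
      connected_graph (blk ` P, quotient_edges P E). w P)" for E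
  have fin: "finite ?G" by (rule finite_inv_edges[OF group_onD(1)[OF H]])
  have whole: "{U} \<in> inv_partitions U H" by (rule whole_inv_partition[OF H U])
  have cw: "connected_graph (blk ` {U}, h)" for h
    unfolding connected_iff using conn_refl by simp
  have iff: "connected_graph (blk ` P, quotient_edges P E) \<longleftrightarrow> P = {U} \<or> connected_graph (U, E)"
    if "P \<in> inv_partitions U H" "E \<in> ?G" "homogeneous U E P" for P E
  proof -
    interpret invariant_partition U H P using H that(1) by unfold_locales
    show ?thesis
      using connected_quotient_iff[OF inv_edgesD(1)[OF H that(2)] that(3) _ U] cw by blast
  qed
  have s1: "s E = of_bool (connected_graph (U, E) \<and> bi_point_determining (U, E))"
    if E: "E \<in> ?G" and c: "connected_graph (U, E)" for E
  proof -
    have "s E = (\<Sum>P | P \<in> inv_partitions U H \<and> homogeneous U E P. w P)"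
      unfolding s_def using iff[OF _ E] c by (intro sum.cong) auto
    then show ?thesis using sum_over_twin_partitions[OF H E] c unfolding w_def by simp
  qed
  have wU: "w {U} = log_mark U H" unfolding w_def by (rule orbit_prod_whole[OF H U])
  have s2: "s E = of_bool (E = {}) * log_mark U H"
    if E: "E \<in> ?G" and c: "\<not> connected_graph (U, E)" for E
  proof -
    have "{P. P \<in> inv_partitions U H \<and> homogeneous U E P \<and> connected_graph (blk ` P, quotient_edges P E)} =
        (if E = {} then {{U}} else {})"
    proof -
      have "homogeneous U {} {U}" unfolding homogeneous_def twins_def by simp
      moreover have "E = {}" if h: "homogeneous U E {U}"
      proof -
        interpret invariant_partition U H "{U}" using H whole by unfold_locales
        have "E \<inter> Pow U \<in> colours U"
          by (rule homogeneous_within[OF h inv_edgesD(1)[OF H E]]) simp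
        moreover have "E \<inter> Pow U = E" using inv_edgesD(1)[OF H E] pairs_Pow[of U] by blast
        moreover have "E \<noteq> pairs U"
        proof
          assume "E = pairs U"
          then have "(u, v) \<in> conn E" if "u \<in> U" "v \<in> U" for u v
            using that conn_edge[of u v E] conn_refl[of u E] by (cases "u = v") auto
          then show False using c U unfolding connected_iff by blast
        qed
        ultimately show ?thesis by simp
      qed
      ultimately show ?thesis using iff[OF _ E] c whole by auto
    qed
    then show ?thesis unfolding s_def using wU by simp
  qed
  have e: "{} \<in> ?G" unfolding inv_edges_def by simp
  have ce: "connected_graph (U, {}) \<longleftrightarrow> (\<exists>u. U = {u})"
  proof
    assume c: "connected_graph (U, {})"
    obtain u where u: "u \<in> U" using U by blast
    have "v = u" if "v \<in> U" for v
    proof -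
      have "(u, v) \<in> conn {}" using c u that unfolding connected_iff by blast
      then show ?thesis by (induction rule: conn_induct) auto
    qed
    then show "\<exists>u. U = {u}" using u by blast
  qed (auto simp: connected_iff conn_refl)
  have "plethysm (umark (virt sp_Gc)) (umark twin_inverse) U H = sum s ?G"
    unfolding s_def w_def
    by (rule plethysm_twin_inverse[OF _ H U]) (simp add: sp_Gc_def umark_graph)
  also have "\<dots> = (\<Sum>E\<in>?G. of_bool (connected_graph (U, E) \<and> bi_point_determining (U, E)) +
      (if E = {} then of_bool (\<not> connected_graph (U, {})) * log_mark U H else 0))"
  proof (rule sum.cong[OF refl])
    fix E assume E: "E \<in> ?G"
    show "s E = of_bool (connected_graph (U, E) \<and> bi_point_determining (U, E)) +
      (if E = {} then of_bool (\<not> connected_graph (U, {})) * log_mark U H else 0)"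
    proof (cases "connected_graph (U, E)")
      case True then show ?thesis using s1[OF E True] by (cases "E = {}") simp_all
    next
      case False then show ?thesis using s2[OF E False] by (cases "E = {}") simp_all
    qed
  qed
  also have "\<dots> = umark (virt sp_Bc) U H + of_bool (\<not> (\<exists>u. U = {u})) * log_mark U H"
    unfolding sum.distrib sum.delta[OF fin] sp_Bc_def umark_graph[OF H] ce using e fin by (simp add: Int_def)
  also have "\<dots> = umark (virt sp_Bc) U H + log_mark U H - of_bool (\<exists>u. U = {u})"
    using log_mark_point H by auto
  finally show ?thesis .
qed

lemma plethysm_X:
  assumes H: "group_on U H" and U: "U \<noteq> {}"
  shows "plethysm (plethysm one log_mark) h U H = h U H"
proof -
  have "plethysm one log_mark (blk ` P) (lift ` H) = of_bool (P = {U})" if P: "P \<in> inv_partitions U H" for P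
  proof -
    have ne: "blk ` P \<noteq> {}" using inv_partitionsD(7)[OF P] U by auto
    have "(\<exists>b. blk ` P = {b}) \<longleftrightarrow> P = {U}"
    proof
      assume "\<exists>b. blk ` P = {b}"
      then have "card P = 1"
        using card_image[OF inj_on_blk[OF group_onD(1)[OF H] inv_partitionsD(1)[OF P]]]
        by (metis is_singletonI is_singleton_altdef)
      then obtain B where "P = {B}" by (rule card_1_singletonE)
      then show "P = {U}" using inv_partitionsD(7)[OF P] by simp
    qed auto
    then show ?thesis using one_plus_X_c(2)[OF group_on_lift[OF H P] ne] by simp
  qed
  then have "plethysm (plethysm one log_mark) h U H =
      (\<Sum>P\<in>inv_partitions U H. if P = {U} then orbit_prod H (`) {U} (\<lambda>B. h B (stab H B)) else 0)"
    unfolding plethysm_def[of "plethysm one log_mark"] by (intro sum.cong) auto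
  then show ?thesis
    using whole_inv_partition[OF H U]
    by (simp add: sum.delta[OF finite_inv_partitions[OF group_onD(1)[OF H]]] orbit_prod_whole[OF H U])
qed

text \<open>Both sides become \<open>\<B>\<^sub>+\<close> after composition with \<open>\<E>\<^sub>+\<close> on the left, which is injective.\<close>

lemma plethysm_log_eq_plethysm_twin_inverse:
  assumes H: "group_on U H" and U: "U \<noteq> {}"
  shows "plethysm log_mark (umark (virt sp_B_plus)) U H = plethysm (umark (virt sp_Gc)) (umark twin_inverse) U H"
proof (rule plethysm_one_inject[OF _ H U])
  fix U H assume H: "group_on U H" and U: "U \<noteq> {}"
  have v: "is_virtual (virt sp_B_plus)" "is_virtual (virt sp_Gc)"
    by (intro is_virtual_virt is_species_graphs)+
  have "plethysm one (plethysm log_mark (umark (virt sp_B_plus))) U H = umark (virt sp_B_plus) U H"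
    unfolding plethysm_assoc[OF H invariant_umark[OF one_plus_X_c(1)] invariant_umark[OF v(1)]]
    by (rule plethysm_X[OF H U])
  moreover have "plethysm one (plethysm (umark (virt sp_Gc)) (umark twin_inverse)) U H = umark (virt sp_B_plus) U H"
    unfolding plethysm_assoc[OF H invariant_umark[OF v(2)] invariant_umark[OF is_virtual_twin_inverse]]
    by (rule plethysm_all_graphs_twin_inverse[OF H U])
  ultimately show "plethysm one (plethysm log_mark (umark (virt sp_B_plus))) U H =
      plethysm one (plethysm (umark (virt sp_Gc)) (umark twin_inverse)) U H" by simp
qed

theorem corollary4p7:
  shows "virt sp_Bc =\<^sub>V
           one_plus_X_c \<circ>\<^sub>V virt sp_B_plus -\<^sub>V one_plus_X_c +\<^sub>V virt sp_X
       \<and> virt sp_Bc =\<^sub>V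
           virt sp_Gc \<circ>\<^sub>V (one_plus_X_c +\<^sub>V one_plus_X_c -\<^sub>V virt sp_X)
             -\<^sub>V one_plus_X_c +\<^sub>V virt sp_X"
proof -
  note L = one_plus_X_c(1) and X = is_virtual_X and D = is_virtual_twin_inverse
  have v: "is_virtual (virt sp_Bc)" "is_virtual (virt sp_B_plus)" "is_virtual (virt sp_Gc)"
    by (intro is_virtual_virt is_species_graphs)+
  have eq: "virt sp_Bc =\<^sub>V V -\<^sub>V one_plus_X_c +\<^sub>V virt sp_X"
    if V: "is_virtual V"
      and e: "\<And>U H. group_on U H \<Longrightarrow> umark V U H =
        (if U = {} then 0 else plethysm (umark (virt sp_Gc)) (umark twin_inverse) U H)"
    for V :: "(unit, 'a, 'b) virtual"
  proof (subst virtual_eq_iff_umark)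
    show "is_virtual (V -\<^sub>V one_plus_X_c +\<^sub>V virt sp_X)"
      by (intro is_virtual_add is_virtual_diff V L X)
    show "\<forall>U H. group_on U H \<longrightarrow> umark (virt sp_Bc) U H = umark (V -\<^sub>V one_plus_X_c +\<^sub>V virt sp_X) U H"
    proof (intro allI impI)
      fix U H assume H: "group_on U H"
      have m: "umark (V -\<^sub>V one_plus_X_c +\<^sub>V virt sp_X) U H =
          umark V U H - log_mark U H + of_bool (\<exists>u. U = {u})"
        using group_onD(1)[OF H]
        by (simp add: umark_add umark_diff is_virtual_diff V L X umark_X)
      show "umark (virt sp_Bc) U H = umark (V -\<^sub>V one_plus_X_c +\<^sub>V virt sp_X) U H"
      proof (cases "U = {}")
        case True
        then show ?thesis
          unfolding m e[OF H] sp_Bc_def umark_graph[OF H] using one_plus_X_c(3)[of H]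
          by (simp add: connected_iff)
      next
        case False
        then show ?thesis unfolding m e[OF H] plethysm_connected_twin_inverse[OF H False] by simp
      qed
    qed
  qed (rule v)
  have empty: "plethysm f h {} H = f {} (lift ` H)" for f h and H :: "(label \<Rightarrow> label) set"
  proof -
    have "orbit_prod H (`) ({} :: label set set) v = 1" for v
    proof -
      have "group_acting H (`) ({} :: label set set)" if "H \<noteq> {}" for H :: "(label \<Rightarrow> label) set"
        using that by unfold_locales auto
      then show ?thesis
        unfolding orbit_prod_def transv_def transversal_def by (simp add: some_equality)
    qed
    then show ?thesis unfolding plethysm_def inv_partitions_empty by simp
  qed
  show ?thesis
  proof
    show "virt sp_Bc =\<^sub>V one_plus_X_c \<circ>\<^sub>V virt sp_B_plus -\<^sub>V one_plus_X_c +\<^sub>V virt sp_X"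
      by (rule eq) (auto simp: is_virtual_comp L v umark_comp[OF L v(2)] empty one_plus_X_c(3)
          plethysm_log_eq_plethysm_twin_inverse)
    have "umark (virt sp_Gc) {} K = 0" for K
      unfolding umark_virt mark_def fixed_structs_def structs_Gc by (simp add: connected_iff)
    then show "virt sp_Bc =\<^sub>V virt sp_Gc \<circ>\<^sub>V twin_inverse -\<^sub>V one_plus_X_c +\<^sub>V virt sp_X"
      by (intro eq) (auto simp: is_virtual_comp D v umark_comp[OF v(3) D] empty)
  qed
qed

end
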